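(* Let $d\in\mathbb{N}$, let $a<b$ be real numbers, let $P_1=P_1^*\in\mathbb{R}^{d\times d}$ be invertible, $P_0=-P_0^*\in\mathbb{R}^{d\times d}$, and let $\mathcal{H}\colon(a,b)\to\mathbb{R}^{d\times d}$ be measurable such that there are $m,M_0>0$ with $m\le \mathcal{H}(x)=\mathcal{H}(x)^*\le M_0$ for all $x\in(a,b)$. Assume that $\mathcal{H}$ is scalar-valued, i.e. there is a bounded function $h\colon(a,b)\to\mathbb{R}$ with $\mathcal{H}(x)=h(x)1_d$ for almost every $x\in(a,b)$. Let $W\in\mathbb{R}^{d\times 2d}$ have rank $d$ and satisfy $$W\begin{pmatrix}P_1&-P_1\\1_d&1_d\end{pmatrix}^{-1}\begin{pmatrix}0&1_d\\1_d&0\end{pmatrix}\left(W\begin{pmatrix}P_1&-P_1\\1_d&1_d\end{pmatrix}^{-1}\right)^*\ge 0.$$ Let $H$ be the Hilbert space $L_2(a,b)^d$ with inner product $\langle u,v\rangle_H=\langle\mathcal{H}u,v\rangle_{L_2}$ and let $\mathcal{A}\colon\operatorname{dom}(\mathcal{A})\subseteq H\to H$ be given by $\mathcal{A}u=P_1(\mathcal{H}u)'+P_0\mathcal{H}u$ with $$\operatorname{dom}(\mathcal{A})=\left\{u\in H\,;\ \mathcal{H}u\in H^1(a,b)^d,\ W\begin{pmatrix}(\mathcal{H}u)(b)\\(\mathcal{H}u)(a)\end{pmatrix}=0\right\}.$$ Assume that $\mathcal{A}$ is $m$-dissipative. If there exist $c>0$ and $\eta\in\{a,b\}$ such that for all $u\in\operatorname{dom}(\mathcal{A})$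 $$\langle u,\mathcal{A}u\rangle_H\le -c\|(\mathcal{H}u)(\eta)\|^2,$$ then $\mathcal{A}$ generates an exponentially stable $C_0$-semigroup.
   Context: $1_d$ is the $d\times d$ identity matrix. $L_2(a,b)^d$ and $H^1(a,b)^d$ consist of $\mathbb{R}^d$-valued functions; derivatives are weak derivatives, and point evaluations of $H^1$ functions refer to the continuous representative on $[a,b]$. Inequalities between matrices are in the sense of positive (semi-)definiteness. A $C_0$-semigroup $(S(t))_{t\ge0}$ is exponentially stable if there are $C\ge1$, $\omega>0$ with $\|S(t)\|\le C\mathrm{e}^{-\omega t}$ for all $t\ge0$. *)

theory Defs
  imports "HOL-Analysis.Analysis" "HOL-Library.Function_Algebras"
begin

section \<open>Functions as a real vector space\<close>

instantiation "fun" :: (type, real_vector) real_vector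
begin

definition "scaleR r f = (\<lambda>x. r *\<^sub>R f x)"

instance
  by standard (auto simp: fun_eq_iff scaleR_fun_def scaleR_add_right scaleR_add_left)

end


section \<open>Matrices\<close>

text \<open>In the type \<open>real ^ 'c ^ 'r\<close> of matrices, \<open>'c\<close> indexes columns and \<open>'r\<close> rows;
  \<open>d\<close> is \<open>CARD('n)\<close> and the sum type \<open>'n + 'n\<close> indexes the \<open>2 d\<close> block coordinates.\<close>

definition psd :: "real ^ 'n ^ 'n \<Rightarrow> bool" where
  "psd A \<longleftrightarrow> transpose A = A \<and> (\<forall>v. 0 \<le> v \<bullet> (A *v v))"

definition mat_le :: "real ^ 'n ^ 'n \<Rightarrow> real ^ 'n ^ 'n \<Rightarrow> bool" where
  "mat_le A B \<longleftrightarrow> psd (B - A)"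

definition block_matrix ::
  "real ^ 'n ^ 'n \<Rightarrow> real ^ 'n ^ 'n \<Rightarrow> real ^ 'n ^ 'n \<Rightarrow> real ^ 'n ^ 'n
    \<Rightarrow> real ^ ('n + 'n) ^ ('n + 'n)" where
  "block_matrix A B C D = (\<chi> i j.
     case i of
       Inl k \<Rightarrow> (case j of Inl l \<Rightarrow> A $ k $ l | Inr l \<Rightarrow> B $ k $ l)
     | Inr k \<Rightarrow> (case j of Inl l \<Rightarrow> C $ k $ l | Inr l \<Rightarrow> D $ k $ l))"

definition block_vector :: "real ^ 'n \<Rightarrow> real ^ 'n \<Rightarrow> real ^ ('n + 'n)" where
  "block_vector v w = (\<chi> i. case i of Inl k \<Rightarrow> v $ k | Inr k \<Rightarrow> w $ k)"


section \<open>Operators and semigroups on semi-inner product spaces\<close>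

text \<open>Elements of \<open>L\<^sub>2\<close> are handled through representatives. Accordingly, a Hilbert space is
  given by a linear subspace \<open>V\<close> of some real vector space and a semi-inner product \<open>ip\<close> on
  \<open>V\<close>; two elements \<open>u, v\<close> of \<open>V\<close> denote the same element of the Hilbert space iff
  \<open>seminorm_of ip (u - v) = 0\<close>. All equations between elements are stated in this sense.
  An unbounded operator is given by its domain \<open>D\<close> and a function \<open>A\<close>, whose values
  outside \<open>D\<close> are irrelevant.\<close>

definition seminorm_of :: "('v \<Rightarrow> 'v \<Rightarrow> real) \<Rightarrow> 'v \<Rightarrow> real" where
  "seminorm_of ip u = sqrt (ip u u)"

definition bounded_operator ::
  "'v::real_vector set \<Rightarrow> ('v \<Rightarrow> 'v \<Rightarrow> real) \<Rightarrow> ('v \<Rightarrow> 'v) \<Rightarrow> bool" where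
  "bounded_operator V ip T \<longleftrightarrow>
     (\<forall>u\<in>V. T u \<in> V) \<and>
     (\<forall>u\<in>V. \<forall>v\<in>V. seminorm_of ip (T (u + v) - (T u + T v)) = 0) \<and>
     (\<forall>r. \<forall>u\<in>V. seminorm_of ip (T (r *\<^sub>R u) - r *\<^sub>R T u) = 0) \<and>
     (\<exists>K. \<forall>u\<in>V. seminorm_of ip (T u) \<le> K * seminorm_of ip u)"

definition operator_norm ::
  "'v::real_vector set \<Rightarrow> ('v \<Rightarrow> 'v \<Rightarrow> real) \<Rightarrow> ('v \<Rightarrow> 'v) \<Rightarrow> real" where
  "operator_norm V ip T = (SUP u\<in>{u \<in> V. seminorm_of ip u \<le> 1}. seminorm_of ip (T u))"

definition C0_semigroup ::
  "'v::real_vector set \<Rightarrow> ('v \<Rightarrow> 'v \<Rightarrow> real) \<Rightarrow> (real \<Rightarrow> 'v \<Rightarrow> 'v) \<Rightarrow> bool" where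
  "C0_semigroup V ip S \<longleftrightarrow>
     (\<forall>t\<ge>0. bounded_operator V ip (S t)) \<and>
     (\<forall>u\<in>V. seminorm_of ip (S 0 u - u) = 0) \<and>
     (\<forall>s\<ge>0. \<forall>t\<ge>0. \<forall>u\<in>V. seminorm_of ip (S (s + t) u - S s (S t u)) = 0) \<and>
     (\<forall>u\<in>V. ((\<lambda>t. seminorm_of ip (S t u - u)) \<longlongrightarrow> 0) (at_right 0))"

definition generator_limit ::
  "('v::real_vector \<Rightarrow> 'v \<Rightarrow> real) \<Rightarrow> (real \<Rightarrow> 'v \<Rightarrow> 'v) \<Rightarrow> 'v \<Rightarrow> 'v \<Rightarrow> bool" where
  "generator_limit ip S u f \<longleftrightarrow>
     ((\<lambda>t. seminorm_of ip ((1 / t) *\<^sub>R (S t u - u) - f)) \<longlongrightarrow> 0) (at_right 0)"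

definition generates ::
  "'v::real_vector set \<Rightarrow> ('v \<Rightarrow> 'v \<Rightarrow> real) \<Rightarrow> 'v set \<Rightarrow> ('v \<Rightarrow> 'v)
    \<Rightarrow> (real \<Rightarrow> 'v \<Rightarrow> 'v) \<Rightarrow> bool" where
  "generates V ip D A S \<longleftrightarrow>
     C0_semigroup V ip S \<and>
     D = {u \<in> V. \<exists>f\<in>V. generator_limit ip S u f} \<and>
     (\<forall>u\<in>D. A u \<in> V \<and> generator_limit ip S u (A u))"

definition exponentially_stable ::
  "'v::real_vector set \<Rightarrow> ('v \<Rightarrow> 'v \<Rightarrow> real) \<Rightarrow> (real \<Rightarrow> 'v \<Rightarrow> 'v) \<Rightarrow> bool" where
  "exponentially_stable V ip S \<longleftrightarrow>
     (\<exists>C\<ge>1. \<exists>\<omega>>0. \<forall>t\<ge>0. operator_norm V ip (S t) \<le> C * exp (- \<omega> * t))"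

definition m_dissipative ::
  "'v::real_vector set \<Rightarrow> ('v \<Rightarrow> 'v \<Rightarrow> real) \<Rightarrow> 'v set \<Rightarrow> ('v \<Rightarrow> 'v) \<Rightarrow> bool" where
  "m_dissipative V ip D A \<longleftrightarrow>
     (\<forall>u\<in>D. ip u (A u) \<le> 0) \<and>
     (\<exists>\<mu>>0. \<forall>f\<in>V. \<exists>u\<in>D. seminorm_of ip (\<mu> *\<^sub>R u - A u - f) = 0)"


section \<open>The spaces \<open>L\<^sub>2(a,b)\<^sup>d\<close> and \<open>H\<^sup>1(a,b)\<^sup>d\<close>\<close>

abbreviation leb :: "real \<Rightarrow> real \<Rightarrow> real measure" where
  "leb a b \<equiv> lebesgue_on {a<..<b}"

definition L2 :: "real \<Rightarrow> real \<Rightarrow> (real \<Rightarrow> real ^ 'n) set" where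
  "L2 a b = {u \<in> borel_measurable (leb a b). integrable (leb a b) (\<lambda>x. (norm (u x))\<^sup>2)}"

definition test_function :: "real \<Rightarrow> real \<Rightarrow> (real \<Rightarrow> real) \<Rightarrow> bool" where
  "test_function a b \<phi> \<longleftrightarrow>
     (\<forall>k x. ((deriv ^^ k) \<phi>) field_differentiable (at x)) \<and>
     compact (closure {x. \<phi> x \<noteq> 0}) \<and> closure {x. \<phi> x \<noteq> 0} \<subseteq> {a<..<b}"

definition has_weak_derivative ::
  "real \<Rightarrow> real \<Rightarrow> (real \<Rightarrow> real ^ 'n) \<Rightarrow> (real \<Rightarrow> real ^ 'n) \<Rightarrow> bool" where
  "has_weak_derivative a b w g \<longleftrightarrow>
     (\<forall>\<phi>. test_function a b \<phi> \<longrightarrow>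
        (LINT x|leb a b. deriv \<phi> x *\<^sub>R w x) = - (LINT x|leb a b. \<phi> x *\<^sub>R g x))"

definition H1 :: "real \<Rightarrow> real \<Rightarrow> (real \<Rightarrow> real ^ 'n) set" where
  "H1 a b = {w \<in> L2 a b. \<exists>g \<in> L2 a b. has_weak_derivative a b w g}"

text \<open>A representative of the weak derivative, which is unique almost everywhere.\<close>

definition weak_deriv ::
  "real \<Rightarrow> real \<Rightarrow> (real \<Rightarrow> real ^ 'n) \<Rightarrow> real \<Rightarrow> real ^ 'n" where
  "weak_deriv a b w = (SOME g. g \<in> L2 a b \<and> has_weak_derivative a b w g)"

text \<open>The continuous representative of an \<open>H\<^sup>1\<close> function, which is unique on \<open>[a,b]\<close>.\<close>

definition cont_rep ::
  "real \<Rightarrow> real \<Rightarrow> (real \<Rightarrow> real ^ 'n) \<Rightarrow> real \<Rightarrow> real ^ 'n" where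
  "cont_rep a b w = (SOME v. continuous_on {a..b} v \<and> (AE x in leb a b. v x = w x))"


section \<open>The port-Hamiltonian operator\<close>

definition mat_mult ::
  "(real \<Rightarrow> real ^ 'n ^ 'n) \<Rightarrow> (real \<Rightarrow> real ^ 'n) \<Rightarrow> real \<Rightarrow> real ^ 'n" where
  "mat_mult \<H> u = (\<lambda>x. \<H> x *v u x)"

definition inner_H ::
  "real \<Rightarrow> real \<Rightarrow> (real \<Rightarrow> real ^ 'n ^ 'n) \<Rightarrow> (real \<Rightarrow> real ^ 'n) \<Rightarrow> (real \<Rightarrow> real ^ 'n) \<Rightarrow> real" where
  "inner_H a b \<H> u v = (LINT x|leb a b. mat_mult \<H> u x \<bullet> v x)"

definition pH_dom ::
  "real \<Rightarrow> real \<Rightarrow> (real \<Rightarrow> real ^ 'n ^ 'n) \<Rightarrow> real ^ ('n + 'n) ^ 'n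
    \<Rightarrow> (real \<Rightarrow> real ^ 'n) set" where
  "pH_dom a b \<H> W =
     {u \<in> L2 a b. mat_mult \<H> u \<in> H1 a b \<and>
        W *v block_vector (cont_rep a b (mat_mult \<H> u) b) (cont_rep a b (mat_mult \<H> u) a) = 0}"

definition pH_op ::
  "real \<Rightarrow> real \<Rightarrow> real ^ 'n ^ 'n \<Rightarrow> real ^ 'n ^ 'n \<Rightarrow> (real \<Rightarrow> real ^ 'n ^ 'n)
    \<Rightarrow> (real \<Rightarrow> real ^ 'n) \<Rightarrow> real \<Rightarrow> real ^ 'n" where
  "pH_op a b P1 P0 \<H> u = (\<lambda>x. P1 *v weak_deriv a b (mat_mult \<H> u) x + P0 *v mat_mult \<H> u x)"

end

theory Submission
  imports Defs "HOL-Computational_Algebra.Polynomial"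
begin

text \<open>The energy \<open>\<langle>u, u\<rangle>\<^sub>H\<close> is only known to be dissipated at the end point \<open>\<eta>\<close>. A multiplier makes the
  dissipation visible in the interior. Write \<open>w = \<H>u\<close> and \<open>Q = P1\<^sup>-\<^sup>1\<close>, let \<open>p\<close> be the norm of
  \<open>Q P0\<close>, and let \<open>e\<close> be a smooth real function with \<open>e' = (2p + 2) |e|\<close>. Then
    \<open>\<integral> e w \<bullet> Q Au = \<integral> e w \<bullet> w' + \<integral> e w \<bullet> Q P0 w
      = 1/2 [e |w|\<^sup>2]\<^sub>a\<^sup>b - 1/2 \<integral> e' |w|\<^sup>2 + \<integral> e w \<bullet> Q P0 w
      \<le> 1/2 [e |w|\<^sup>2]\<^sub>a\<^sup>b - \<integral> |e| |w|\<^sup>2\<close>.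
  If \<open>e\<close> is small, and positive for \<open>\<eta> = b\<close> or negative for \<open>\<eta> = a\<close>, then the boundary term is at
  most \<open>c |w(\<eta>)|\<^sup>2\<close>, which the assumed damping absorbs. So \<open>A + \<delta>\<close> is dissipative for some
  \<open>\<delta> > 0\<close> with respect to the form \<open>\<langle>u, v\<rangle>\<^sub>H + \<integral> e \<H>u \<bullet> Q v\<close>. Here it is essential that \<open>\<H>\<close> is
  scalar: it then commutes with \<open>Q\<close>, and the form is symmetric. For small \<open>e\<close> it is an inner
  product equivalent to the given one. The density \<open>\<H>\<close> is never differentiated, since the weight
  multiplies \<open>w\<close> and not \<open>u\<close>. This part is
  \<open>weighted_energy_identity\<close> and \<open>lyapunov_dissipation\<close>.

  In the new inner product the theorem of Lumer and Phillips yields a semigroup with norm at most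
  \<open>exp (- \<delta> t)\<close>; returning to the original norm costs a constant factor. The generation
  theorem is proved with the implicit Euler scheme: with \<open>J = (1 - \<tau> A)\<^sup>-\<^sup>1\<close>, the
  powers \<open>J\<^sup>k\<close> with \<open>k \<approx> t / \<tau>\<close> converge as \<open>\<tau>\<close> runs through \<open>\<tau>\<^sub>0 / 2\<^sup>n\<close>, because two half steps differ from
  a full step by \<open>O(\<tau>\<^sup>2)\<close> on the domain of \<open>A\<^sup>2\<close> and all resolvents are commuting
  contractions. All other properties of the semigroup are limits of elementary estimates for
  these powers.

  Three facts about function spaces carry the integration by parts and the
  completeness: square integrable functions form a complete space (\<open>L2_complete\<close>); a function
  with a weak derivative is almost everywhere the primitive of that derivative
  (\<open>has_weak_derivative_primitive\<close>); and primitives of integrable functions satisfy the product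
  rule (\<open>ac_primitive_product\<close>).\<close>

section \<open>Semi-inner product spaces\<close>

text \<open>Vectors stand for their classes modulo null elements, so the form need not be definite; and
  since spaces are subsets of a type, every law is relative to the carrier \<open>V\<close>.\<close>

locale semi_inner_space =
  fixes V :: "'v::real_vector set" and ip :: "'v \<Rightarrow> 'v \<Rightarrow> real"
  assumes subspace_V: "subspace V"
    and ip_add_left: "\<lbrakk>u \<in> V; v \<in> V; w \<in> V\<rbrakk> \<Longrightarrow> ip (u + v) w = ip u w + ip v w"
    and ip_scale_left: "\<lbrakk>u \<in> V; w \<in> V\<rbrakk> \<Longrightarrow> ip (r *\<^sub>R u) w = r * ip u w"
    and ip_commute: "\<lbrakk>u \<in> V; v \<in> V\<rbrakk> \<Longrightarrow> ip u v = ip v u"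
    and ip_nonneg: "u \<in> V \<Longrightarrow> 0 \<le> ip u u"
begin

abbreviation N :: "'v \<Rightarrow> real" where "N \<equiv> seminorm_of ip"

lemma mem [simp, intro]:
  "0 \<in> V" "\<lbrakk>u \<in> V; v \<in> V\<rbrakk> \<Longrightarrow> u + v \<in> V" "\<lbrakk>u \<in> V; v \<in> V\<rbrakk> \<Longrightarrow> u - v \<in> V"
  "u \<in> V \<Longrightarrow> r *\<^sub>R u \<in> V" "u \<in> V \<Longrightarrow> - u \<in> V"
  using subspace_V by (auto simp: subspace_0 subspace_add subspace_diff subspace_scale subspace_neg)

lemma ip_add_right: "\<lbrakk>u \<in> V; v \<in> V; w \<in> V\<rbrakk> \<Longrightarrow> ip w (u + v) = ip w u + ip w v"
  by (metis ip_add_left ip_commute mem(2))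

lemma ip_scale_right: "\<lbrakk>u \<in> V; w \<in> V\<rbrakk> \<Longrightarrow> ip w (r *\<^sub>R u) = r * ip w u"
  by (metis ip_scale_left ip_commute mem(4))

lemma ip_diff_left: "\<lbrakk>u \<in> V; v \<in> V; w \<in> V\<rbrakk> \<Longrightarrow> ip (u - v) w = ip u w - ip v w"
  using ip_add_left[of "u - v" v w] by simp

lemma ip_diff_right: "\<lbrakk>u \<in> V; v \<in> V; w \<in> V\<rbrakk> \<Longrightarrow> ip w (u - v) = ip w u - ip w v"
  using ip_add_right[of "u - v" v w] by simp

lemma N_power2: "u \<in> V \<Longrightarrow> (N u)\<^sup>2 = ip u u"
  by (simp add: seminorm_of_def ip_nonneg)

lemma N_nonneg [simp]: "u \<in> V \<Longrightarrow> 0 \<le> N u"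
  by (simp add: seminorm_of_def ip_nonneg)

lemma N_scale: "u \<in> V \<Longrightarrow> N (r *\<^sub>R u) = \<bar>r\<bar> * N u"
  by (simp add: seminorm_of_def ip_scale_left ip_scale_right real_sqrt_mult flip: mult.assoc power2_eq_square)

lemma N_0 [simp]: "N 0 = 0"
  using N_scale[of 0 0] by simp

lemma N_minus: "u \<in> V \<Longrightarrow> N (- u) = N u"
  using N_scale[of u "-1"] by simp

lemma N_minus_commute: "\<lbrakk>u \<in> V; v \<in> V\<rbrakk> \<Longrightarrow> N (u - v) = N (v - u)"
  using N_minus[of "u - v"] by simp

text \<open>The quadratic function \<open>t \<mapsto> ip (u + t v) (u + t v)\<close> is nonnegative. If \<open>ip v v = 0\<close> it is
  affine, hence constant; otherwise its value at the minimum gives the inequality.\<close>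

lemma Cauchy_Schwarz:
  assumes [simp]: "u \<in> V" "v \<in> V"
  shows "\<bar>ip u v\<bar> \<le> N u * N v"
proof -
  have q: "0 \<le> ip u u + 2 * t * ip u v + t\<^sup>2 * ip v v" for t
    using ip_nonneg[of "u + t *\<^sub>R v"]
    by (simp add: ip_add_left ip_add_right ip_scale_left ip_scale_right ip_commute[of v u]
        power2_eq_square algebra_simps)
  have "(ip u v)\<^sup>2 \<le> ip u u * ip v v"
  proof (cases "ip v v = 0")
    case True
    have "ip u v = 0"
    proof (rule ccontr)
      assume "ip u v \<noteq> 0"
      then show False
        using q[of "- (ip u u + 1) / (2 * ip u v)"] True by (simp add: field_simps)
    qed
    then show ?thesis by (simp add: True)
  next
    case False
    then have "0 < ip v v" using ip_nonneg[of v] by simp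
    then show ?thesis
      using q[of "- ip u v / ip v v"] by (simp add: field_simps power2_eq_square)
  qed
  also have "\<dots> = (N u * N v)\<^sup>2"
    by (simp add: power_mult_distrib N_power2)
  finally show ?thesis
    using power2_le_iff_abs_le[of "N u * N v" "ip u v"] by simp
qed

lemma N_triangle:
  assumes [simp]: "u \<in> V" "v \<in> V"
  shows "N (u + v) \<le> N u + N v"
proof -
  have "(N (u + v))\<^sup>2 = ip u u + 2 * ip u v + ip v v"
    by (simp add: N_power2 ip_add_left ip_add_right ip_commute[of v u])
  also have "\<dots> \<le> (N u + N v)\<^sup>2"
    using Cauchy_Schwarz[of u v] by (simp add: power2_sum N_power2)
  finally show ?thesis
    using power2_le_imp_le[of "N (u + v)" "N u + N v"] by simp
qed

lemma N_triangle_minus: "\<lbrakk>u \<in> V; v \<in> V\<rbrakk> \<Longrightarrow> N (u - v) \<le> N u + N v"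
  using N_triangle[of u "- v"] by (simp add: N_minus)

lemma N_triangle_diff:
  assumes "u \<in> V" "v \<in> V" "w \<in> V"
  shows "N (u - w) \<le> N (u - v) + N (v - w)"
  using N_triangle[of "u - v" "v - w"] assms by simp

lemma N_triangle_le:
  assumes "u \<in> V" "v \<in> V"
  shows "N u \<le> N (u - v) + N v"
  using N_triangle[of "u - v" v] assms by simp

lemma N_null_cong: "\<lbrakk>u \<in> V; v \<in> V; N (u - v) = 0\<rbrakk> \<Longrightarrow> N u = N v"
  by (smt (verit) N_triangle_le N_minus_commute)

lemma N_diff_limit:
  assumes "\<And>n. X n \<in> V" "x \<in> V" "(\<lambda>n. N (X n - x)) \<longlonglongrightarrow> 0" "y \<in> V"
  shows "(\<lambda>n. N (X n - y)) \<longlonglongrightarrow> N (x - y)"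
proof -
  have "\<bar>N (X n - y) - N (x - y)\<bar> \<le> N (X n - x)" for n
    using N_triangle_diff[of "X n" x y] N_triangle_diff[of x "X n" y] N_minus_commute[of x "X n"] assms
    by simp
  then have "(\<lambda>n. N (X n - y) - N (x - y)) \<longlonglongrightarrow> 0"
    by (intro Lim_null_comparison[OF _ assms(3)] always_eventually) simp
  then show ?thesis by (simp add: LIM_zero_iff)
qed

lemma N_limit:
  assumes "\<And>n. X n \<in> V" "x \<in> V" "(\<lambda>n. N (X n - x)) \<longlonglongrightarrow> 0"
  shows "(\<lambda>n. N (X n)) \<longlonglongrightarrow> N x"
  using N_diff_limit[OF assms, of 0] by simp

end

locale complete_semi_inner_space = semi_inner_space +
  assumes complete:
    "\<And>X. \<lbrakk>\<And>n. X n \<in> V; \<And>e. e > 0 \<Longrightarrow> \<exists>M. \<forall>m\<ge>M. \<forall>n\<ge>M. seminorm_of ip (X m - X n) < e\<rbrakk>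
       \<Longrightarrow> \<exists>x\<in>V. (\<lambda>n. seminorm_of ip (X n - x)) \<longlonglongrightarrow> 0"
begin

lemma geometric_Cauchy_converges:
  assumes X: "\<And>n. X n \<in> V" and q: "0 \<le> q" "q < 1"
    and step: "\<And>n. N (X (Suc n) - X n) \<le> C * q ^ n"
  shows "\<exists>x\<in>V. (\<lambda>n. N (X n - x)) \<longlonglongrightarrow> 0"
proof (rule complete[OF X])
  have bound: "N (X (n + k) - X n) \<le> C / (1 - q) * (q ^ n - q ^ (n + k))" for n k
  proof (induction k)
    case (Suc k)
    have "N (X (n + Suc k) - X n) \<le> N (X (Suc (n + k)) - X (n + k)) + N (X (n + k) - X n)"
      using N_triangle_diff X by simp
    also have "\<dots> \<le> C * q ^ (n + k) + C / (1 - q) * (q ^ n - q ^ (n + k))"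
      using Suc step[of "n + k"] by simp
    also have "\<dots> = C / (1 - q) * (q ^ n - q ^ (n + Suc k))"
      using q by (simp add: field_simps)
    finally show ?case .
  qed simp
  have C: "0 \<le> C"
    using order_trans[OF N_nonneg step[of 0]] X by simp
  have tail: "N (X m - X n) \<le> C / (1 - q) * q ^ M" if "M \<le> n" "n \<le> m" for m n M
  proof -
    have "N (X m - X n) \<le> C / (1 - q) * (q ^ n - q ^ m)"
      using bound[of n "m - n"] that by simp
    also have "\<dots> \<le> C / (1 - q) * q ^ M"
      using C q that by (intro mult_left_mono) (auto intro: order_trans[OF _ power_decreasing[of M n q]])
    finally show ?thesis .
  qed
  fix e :: real assume "e > 0"
  moreover have "(\<lambda>M. C / (1 - q) * q ^ M) \<longlonglongrightarrow> C / (1 - q) * 0"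
    using q by (intro tendsto_intros) auto
  ultimately have "\<forall>\<^sub>F M in sequentially. C / (1 - q) * q ^ M < e"
    by (intro order_tendstoD(2)) auto
  then obtain M where M: "C / (1 - q) * q ^ M < e"
    by (auto simp: eventually_sequentially)
  have "N (X m - X n) < e" if "M \<le> m" "M \<le> n" for m n
    using tail[of M n m] tail[of M m n] that M N_minus_commute[of "X m" "X n"] X by (cases "n \<le> m") auto
  then show "\<exists>M. \<forall>m\<ge>M. \<forall>n\<ge>M. N (X m - X n) < e" by blast
qed

end

text \<open>Definiteness turns equations up to null elements into equations, so that resolvents are
  exactly linear and commute exactly.\<close>

locale hilbert_carrier = complete_semi_inner_space +
  assumes definite: "\<And>u. \<lbrakk>u \<in> V; ip u u = 0\<rbrakk> \<Longrightarrow> u = 0"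
begin

lemma N_eq_0: "u \<in> V \<Longrightarrow> N u = 0 \<longleftrightarrow> u = 0"
  using N_power2[of u] definite[of u] by (auto simp: zero_power2)

lemma limit_unique:
  assumes "\<And>n. X n \<in> V" "x \<in> V" "y \<in> V"
    and "(\<lambda>n. N (X n - x)) \<longlonglongrightarrow> 0" "(\<lambda>n. N (X n - y)) \<longlonglongrightarrow> 0"
  shows "x = y"
proof -
  have "N (x - y) = 0"
    using LIMSEQ_unique[OF N_diff_limit[OF assms(1,2,4,3)] assms(5)] by simp
  then show ?thesis using N_eq_0[of "x - y"] assms by simp
qed

lemma contraction_fixpoint:
  assumes F: "\<And>x. x \<in> V \<Longrightarrow> F x \<in> V" and q: "0 \<le> q" "q < 1"
    and contr: "\<And>x y. \<lbrakk>x \<in> V; y \<in> V\<rbrakk> \<Longrightarrow> N (F x - F y) \<le> q * N (x - y)"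
  shows "\<exists>x\<in>V. F x = x"
proof -
  define X where "X n = (F ^^ n) 0" for n
  have X: "X n \<in> V" for n unfolding X_def by (induction n) (auto simp: F)
  have "N (X (Suc n) - X n) \<le> N (X 1 - X 0) * q ^ n" for n
  proof (induction n)
    case (Suc n)
    have "N (X (Suc (Suc n)) - X (Suc n)) \<le> q * N (X (Suc n) - X n)"
      using contr[OF X X, of "Suc n" n] by (simp add: X_def)
    also have "\<dots> \<le> q * (N (X 1 - X 0) * q ^ n)"
      using Suc q by (intro mult_left_mono) auto
    finally show ?case by (simp add: mult_ac)
  qed simp
  then have "\<exists>x\<in>V. (\<lambda>n. N (X n - x)) \<longlonglongrightarrow> 0"
    by (rule geometric_Cauchy_converges[OF X q])
  then obtain x where x: "x \<in> V" and lim: "(\<lambda>n. N (X n - x)) \<longlonglongrightarrow> 0"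
    by blast
  have "(\<lambda>n. N (X (Suc n) - F x)) \<longlonglongrightarrow> 0"
  proof (rule Lim_null_comparison)
    show "\<forall>\<^sub>F n in sequentially. norm (N (X (Suc n) - F x)) \<le> q * N (X n - x)"
      using contr[OF X x] F X x by (simp add: X_def)
    show "(\<lambda>n. q * N (X n - x)) \<longlonglongrightarrow> 0"
      using tendsto_mult_right_zero[OF lim] .
  qed
  then have "F x = x"
    using limit_unique[of "\<lambda>n. X (Suc n)" "F x" x] X F x LIMSEQ_Suc[OF lim] by simp
  then show ?thesis using x by blast
qed

end

section \<open>The semigroup of a strictly m-dissipative operator\<close>

text \<open>Applied to the numbers of steps that fit into \<open>s\<close>, \<open>t\<close> and \<open>s + t\<close>; one additional step is harmless in
  the limit.\<close>

lemma floor_add_cases: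
  fixes x y :: real
  assumes "0 \<le> x" "0 \<le> y"
  shows "nat \<lfloor>x + y\<rfloor> = nat \<lfloor>x\<rfloor> + nat \<lfloor>y\<rfloor> \<or> nat \<lfloor>x + y\<rfloor> = Suc (nat \<lfloor>x\<rfloor> + nat \<lfloor>y\<rfloor>)"
  using assms by linarith

text \<open>The strictness \<open>\<delta>\<close> serves twice: it makes the fixed point argument that halves the step size a
  genuine contraction, and it becomes the decay rate of the semigroup.\<close>

locale strictly_m_dissipative = hilbert_carrier +
  fixes D :: "'a set" and A :: "'a \<Rightarrow> 'a" and \<delta> \<mu> :: real
  assumes subspace_D: "subspace D" and D_subset: "D \<subseteq> V"
    and A_mem: "\<And>u. u \<in> D \<Longrightarrow> A u \<in> V"
    and A_add: "\<And>u v. \<lbrakk>u \<in> D; v \<in> D\<rbrakk> \<Longrightarrow> A (u + v) = A u + A v"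
    and A_scale: "\<And>r u. u \<in> D \<Longrightarrow> A (r *\<^sub>R u) = r *\<^sub>R A u"
    and \<delta>_pos: "\<delta> > 0" and \<mu>_pos: "\<mu> > 0"
    and dissipative: "\<And>u. u \<in> D \<Longrightarrow> ip u (A u) \<le> - \<delta> * ip u u"
    and onto: "\<And>f. f \<in> V \<Longrightarrow> \<exists>u\<in>D. \<mu> *\<^sub>R u - A u = f"
begin

lemma memD [simp, intro]:
  "0 \<in> D" "\<lbrakk>u \<in> D; v \<in> D\<rbrakk> \<Longrightarrow> u + v \<in> D" "\<lbrakk>u \<in> D; v \<in> D\<rbrakk> \<Longrightarrow> u - v \<in> D"
  "u \<in> D \<Longrightarrow> r *\<^sub>R u \<in> D"  "u \<in> D \<Longrightarrow> u \<in> V" "u \<in> D \<Longrightarrow> A u \<in> V"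
  using subspace_D D_subset A_mem
  by (auto simp: subspace_0 subspace_add subspace_diff subspace_scale)

lemma A_diff: "\<lbrakk>u \<in> D; v \<in> D\<rbrakk> \<Longrightarrow> A (u - v) = A u - A v"
  using A_add[of "u - v" v] by simp

lemma resolvent_bound:
  assumes u [simp]: "u \<in> D" and s: "0 \<le> s"
  shows "(1 + s * \<delta>) * N u \<le> N (u - s *\<^sub>R A u)"
proof (cases "N u = 0")
  case False
  then have pos: "N u > 0" by (simp add: order_less_le)
  have "(1 + s * \<delta>) * (N u)\<^sup>2 \<le> ip u (u - s *\<^sub>R A u)"
    using mult_left_mono[OF dissipative[OF u] s]
    by (simp add: ip_diff_right ip_scale_right N_power2 algebra_simps)
  also have "\<dots> \<le> N u * N (u - s *\<^sub>R A u)"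
    using Cauchy_Schwarz[of u "u - s *\<^sub>R A u"] by simp
  finally have "N u * ((1 + s * \<delta>) * N u) \<le> N u * N (u - s *\<^sub>R A u)"
    by (simp add: power2_eq_square mult_ac)
  then show ?thesis using pos by simp
qed simp

text \<open>Step sizes of the implicit Euler scheme. The first one corresponds to the point \<open>\<mu>\<close> of the
  resolvent set that is given; halving makes \<open>k\<close> steps comparable with \<open>2 k\<close> steps of the next size.\<close>

definition \<tau> :: "nat \<Rightarrow> real" where "\<tau> n = 1 / (\<mu> * 2 ^ n)"

lemma \<tau>_pos [simp]: "0 < \<tau> n" "0 \<le> \<tau> n" "\<tau> n \<noteq> 0"
  using \<mu>_pos by (auto simp: \<tau>_def)

lemma \<tau>_Suc: "\<tau> (Suc n) = \<tau> n / 2" by (simp add: \<tau>_def)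

lemma \<tau>_power: "\<tau> n = \<tau> 0 * (1/2) ^ n" by (simp add: \<tau>_def power_one_over)

lemma \<tau>_tendsto_0: "\<tau> \<longlonglongrightarrow> 0"
proof -
  have "(\<lambda>n. \<tau> 0 * (1/2) ^ n) \<longlonglongrightarrow> \<tau> 0 * 0"
    by (intro tendsto_intros LIMSEQ_power_zero) auto
  then show ?thesis unfolding \<tau>_power[symmetric] by simp
qed

text \<open>The equation \<open>u - (s / 2) A u = f\<close> is equivalent to \<open>u - s A u = 2 f - u\<close>, that is, to
  \<open>u = K (2 f - u)\<close> with \<open>K = (1 - s A)\<^sup>-\<^sup>1\<close>. By strict dissipativity \<open>K\<close> has the Lipschitz
  constant \<open>1 / (1 + s \<delta>) < 1\<close>.\<close>

lemma onto_half_step: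
  assumes s: "s > 0" and onto_s: "\<And>f. f \<in> V \<Longrightarrow> \<exists>u\<in>D. u - s *\<^sub>R A u = f" and f: "f \<in> V"
  shows "\<exists>u\<in>D. u - (s / 2) *\<^sub>R A u = f"
proof -
  obtain K where K: "\<And>f. f \<in> V \<Longrightarrow> K f \<in> D \<and> K f - s *\<^sub>R A (K f) = f"
    using onto_s by metis
  define q where "q = 1 / (1 + s * \<delta>)"
  have s\<delta>: "0 < s * \<delta>" using s \<delta>_pos by simp
  then have q: "0 \<le> q" "q < 1" by (auto simp: q_def)
  have "N (K (2 *\<^sub>R f - x) - K (2 *\<^sub>R f - y)) \<le> q * N (x - y)" if "x \<in> V" "y \<in> V" for x y
  proof -
    let ?u = "K (2 *\<^sub>R f - x)" and ?v = "K (2 *\<^sub>R f - y)"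
    have uv: "?u \<in> D" "?v \<in> D" using K f that by auto
    have "(1 + s * \<delta>) * N (?u - ?v) \<le> N ((?u - ?v) - s *\<^sub>R A (?u - ?v))"
      using uv s by (intro resolvent_bound) auto
    also have "(?u - ?v) - s *\<^sub>R A (?u - ?v) = (?u - s *\<^sub>R A ?u) - (?v - s *\<^sub>R A ?v)"
      using uv by (simp add: A_diff algebra_simps)
    also have "\<dots> = y - x" using K f that by simp
    finally show ?thesis
      using s\<delta> that N_minus_commute[of x y] pos_le_divide_eq[of "1 + s * \<delta>"]
      by (simp add: q_def mult.commute)
  qed
  then obtain x where x: "x \<in> V" "K (2 *\<^sub>R f - x) = x"
    using contraction_fixpoint[of "\<lambda>x. K (2 *\<^sub>R f - x)" q] K f q by auto
  then have "x \<in> D" "x - s *\<^sub>R A x = 2 *\<^sub>R f - x"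
    using K[of "2 *\<^sub>R f - x"] f by auto
  then have "2 *\<^sub>R (x - (s / 2) *\<^sub>R A x) = 2 *\<^sub>R f"
    by (simp add: algebra_simps scaleR_2)
  then show ?thesis using \<open>x \<in> D\<close> by auto
qed

lemma onto_\<tau>: "f \<in> V \<Longrightarrow> \<exists>u\<in>D. u - \<tau> n *\<^sub>R A u = f"
proof (induction n arbitrary: f)
  case 0
  obtain u where "u \<in> D" "\<mu> *\<^sub>R u - A u = \<mu> *\<^sub>R f" using onto[of "\<mu> *\<^sub>R f"] 0 by auto
  then have "\<mu> *\<^sub>R (u - \<tau> 0 *\<^sub>R A u) = \<mu> *\<^sub>R f"
    using \<mu>_pos by (simp add: \<tau>_def algebra_simps)
  then show ?case using \<open>u \<in> D\<close> \<mu>_pos by auto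
next
  case (Suc n)
  show ?case unfolding \<tau>_Suc by (rule onto_half_step) (use Suc in auto)
qed

lemma step_inj:
  assumes "u \<in> D" "v \<in> D" "u - \<tau> n *\<^sub>R A u = v - \<tau> n *\<^sub>R A v"
  shows "u = v"
proof -
  have "(1 + \<tau> n * \<delta>) * N (u - v) \<le> N ((u - v) - \<tau> n *\<^sub>R A (u - v))"
    using assms by (intro resolvent_bound) auto
  also have "(u - v) - \<tau> n *\<^sub>R A (u - v) = (u - \<tau> n *\<^sub>R A u) - (v - \<tau> n *\<^sub>R A v)"
    using assms(1,2) by (simp add: A_diff algebra_simps)
  also have "N \<dots> = 0" using assms(3) by simp
  finally have "N (u - v) = 0"
    using \<delta>_pos N_nonneg[of "u - v"] assms(1,2)
    by (smt (verit) memD(3,5) mult_nonneg_nonneg mult_pos_pos \<tau>_pos(1))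
  then show ?thesis using N_eq_0[of "u - v"] assms by simp
qed

text \<open>One implicit Euler step, the resolvent \<open>(1 - \<tau>\<^sub>n A)\<^sup>-\<^sup>1\<close>.\<close>

definition J :: "nat \<Rightarrow> 'a \<Rightarrow> 'a" where
  "J n f = (THE u. u \<in> D \<and> u - \<tau> n *\<^sub>R A u = f)"

lemma J_eqI: "\<lbrakk>u \<in> D; u - \<tau> n *\<^sub>R A u = f\<rbrakk> \<Longrightarrow> J n f = u"
  unfolding J_def using step_inj by blast

lemma J:
  assumes "f \<in> V"
  shows J_mem [simp, intro]: "J n f \<in> D" and J_eq: "J n f - \<tau> n *\<^sub>R A (J n f) = f"
  using onto_\<tau>[OF assms, of n] J_eqI by auto

lemma \<tau>_A_J: "f \<in> V \<Longrightarrow> \<tau> n *\<^sub>R A (J n f) = J n f - f"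
  using J_eq[of f n] by (simp add: diff_eq_eq eq_diff_eq add.commute)

lemma A_J: "f \<in> V \<Longrightarrow> A (J n f) = (1 / \<tau> n) *\<^sub>R (J n f - f)"
  by (simp flip: \<tau>_A_J)

lemma J_add: "\<lbrakk>f \<in> V; g \<in> V\<rbrakk> \<Longrightarrow> J n (f + g) = J n f + J n g"
  by (intro J_eqI) (auto simp: A_add scaleR_add_right \<tau>_A_J)

lemma J_scale: "f \<in> V \<Longrightarrow> J n (r *\<^sub>R f) = r *\<^sub>R J n f"
  by (intro J_eqI) (auto simp: A_scale scaleR_left_commute[of "\<tau> n"] J_eq simp flip: scaleR_diff_right simp del: scaleR_scaleR)

lemma J_diff: "\<lbrakk>f \<in> V; g \<in> V\<rbrakk> \<Longrightarrow> J n (f - g) = J n f - J n g"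
  using J_add[of "f - g" g] by simp

lemma J_bound: "f \<in> V \<Longrightarrow> (1 + \<tau> n * \<delta>) * N (J n f) \<le> N f"
  using resolvent_bound[of "J n f" "\<tau> n"] J_eq[of f n] by simp

lemma J_contraction: "f \<in> V \<Longrightarrow> N (J n f) \<le> N f"
  using J_bound[of f n] \<delta>_pos by (smt (verit) J_mem N_nonneg \<tau>_pos(1) memD(5) mult_le_cancel_right1 mult_pos_pos)

lemma J_A:
  assumes u: "u \<in> D"
  shows "J n (A u) = A (J n u)"
proof -
  have "J n (u - \<tau> n *\<^sub>R A u) = u" using u by (intro J_eqI) auto
  then have "J n u - \<tau> n *\<^sub>R J n (A u) = u" using u by (simp add: J_diff J_scale)
  then have "\<tau> n *\<^sub>R J n (A u) = J n u - u" by (metis diff_diff_eq2 add_diff_cancel_left')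
  then have "\<tau> n *\<^sub>R J n (A u) = \<tau> n *\<^sub>R A (J n u)" using u by (simp add: \<tau>_A_J)
  then show ?thesis by simp
qed

lemma A_J_mem: "u \<in> D \<Longrightarrow> A (J n u) \<in> D"
  by (simp add: A_J)

lemma J_commute: "f \<in> V \<Longrightarrow> J m (J n f) = J n (J m f)"
proof (rule J_eqI)
  assume f: "f \<in> V"
  have "J n (J m f) - \<tau> m *\<^sub>R A (J n (J m f)) = J n (J m f - \<tau> m *\<^sub>R A (J m f))"
    using f by (simp add: J_diff J_scale J_A)
  then show "J n (J m f) - \<tau> m *\<^sub>R A (J n (J m f)) = J n f"
    using J_eq[OF f] by simp
qed auto

lemma powJ_mem [simp, intro]: "u \<in> V \<Longrightarrow> (J n ^^ k) u \<in> V"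
  by (induction k) auto

lemma powJ_memD: "u \<in> D \<Longrightarrow> (J n ^^ k) u \<in> D"
  by (induction k) auto

lemma powJ_add: "\<lbrakk>f \<in> V; g \<in> V\<rbrakk> \<Longrightarrow> (J n ^^ k) (f + g) = (J n ^^ k) f + (J n ^^ k) g"
  by (induction k) (auto simp: J_add)

lemma powJ_scale: "f \<in> V \<Longrightarrow> (J n ^^ k) (r *\<^sub>R f) = r *\<^sub>R (J n ^^ k) f"
  by (induction k) (auto simp: J_scale)

lemma powJ_diff: "\<lbrakk>f \<in> V; g \<in> V\<rbrakk> \<Longrightarrow> (J n ^^ k) (f - g) = (J n ^^ k) f - (J n ^^ k) g"
  by (induction k) (auto simp: J_diff)

lemma powJ_contraction: "f \<in> V \<Longrightarrow> N ((J n ^^ k) f) \<le> N f"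
  by (induction k) (auto intro: order_trans[OF J_contraction])

lemma powJ_bound: "f \<in> V \<Longrightarrow> (1 + \<tau> n * \<delta>) ^ k * N ((J n ^^ k) f) \<le> N f"
proof (induction k)
  case (Suc k)
  have "(1 + \<tau> n * \<delta>) ^ Suc k * N ((J n ^^ Suc k) f)
      = (1 + \<tau> n * \<delta>) ^ k * ((1 + \<tau> n * \<delta>) * N (J n ((J n ^^ k) f)))" by simp
  also have "\<dots> \<le> (1 + \<tau> n * \<delta>) ^ k * N ((J n ^^ k) f)"
    using Suc \<delta>_pos by (intro mult_left_mono J_bound) (auto intro!: zero_le_power add_nonneg_nonneg)
  finally show ?case using Suc by simp
qed simp

lemma J_powJ_commute: "f \<in> V \<Longrightarrow> J m ((J n ^^ k) f) = (J n ^^ k) (J m f)"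
  by (induction k) (simp_all add: J_commute[of _ m n])

lemma J_diff_self: "u \<in> D \<Longrightarrow> J n u - u = \<tau> n *\<^sub>R J n (A u)"
  by (simp add: J_A \<tau>_A_J)

text \<open>In particular the domain is dense. Put \<open>z\<^sub>n = x - J\<^sub>n x\<close>. Dissipativity at \<open>J\<^sub>m x - J\<^sub>n x\<close> shows
  \<open>\<parallel>z\<^sub>m - z\<^sub>n\<parallel>\<^sup>2 \<le> \<parallel>z\<^sub>m\<parallel>\<^sup>2 - \<parallel>z\<^sub>n\<parallel>\<^sup>2\<close> for \<open>m \<le> n\<close>. So the norms decrease and \<open>z\<close> is a Cauchy
  sequence. Its limit is mapped to \<open>0\<close> by the injective map \<open>J\<^sub>0\<close>, since
  \<open>J\<^sub>0 z\<^sub>n = - \<tau>\<^sub>n J\<^sub>0 A J\<^sub>n x\<close> and \<open>J\<^sub>0 A\<close> is bounded.\<close>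

lemma J_tendsto:
  assumes x [simp]: "x \<in> V"
  shows "(\<lambda>n. N (J n x - x)) \<longlonglongrightarrow> 0"
proof -
  define z where "z n = x - J n x" for n
  have z [simp]: "z n \<in> V" for n by (auto simp: z_def)
  have zA: "z n = - \<tau> n *\<^sub>R A (J n x)" for n
    by (simp add: z_def \<tau>_A_J)
  define p where "p n = 1 / \<tau> n" for n
  have p_pos: "p n > 0" for n by (simp add: p_def)
  have AJ: "A (J n x) = - p n *\<^sub>R z n" for n by (simp add: zA p_def)
  have key: "(N (z m - z n))\<^sup>2 \<le> (N (z m))\<^sup>2 - (N (z n))\<^sup>2" if "m \<le> n" for m n
  proof -
    have pmn: "p m \<le> p n" using that \<mu>_pos by (simp add: p_def \<tau>_def power_increasing)
    have "ip (J m x - J n x) (A (J m x - J n x)) \<le> 0"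
      using dissipative[of "J m x - J n x"] \<delta>_pos ip_nonneg[of "J m x - J n x"]
      by (smt (verit) J_mem memD(3,5) mult_nonneg_nonneg mult_minus_left x)
    moreover have "J m x - J n x = z n - z m" by (simp add: z_def)
    moreover have "A (J m x - J n x) = p n *\<^sub>R z n - p m *\<^sub>R z m" by (simp add: A_diff AJ)
    ultimately have "ip (z n - z m) (p n *\<^sub>R z n - p m *\<^sub>R z m) \<le> 0" by simp
    then have *: "p n * ip (z n) (z n) + p m * ip (z m) (z m) \<le> (p m + p n) * ip (z m) (z n)"
      by (simp add: ip_diff_left ip_diff_right ip_scale_right ip_commute[of "z n" "z m"] algebra_simps)
    have "(p m + p n) * (N (z m - z n))\<^sup>2
        = (p m + p n) * (ip (z m) (z m) + ip (z n) (z n)) - 2 * ((p m + p n) * ip (z m) (z n))"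
      by (simp add: N_power2 ip_diff_left ip_diff_right ip_commute[of "z n" "z m"] algebra_simps)
    also have "\<dots> \<le> (p n - p m) * (ip (z m) (z m) - ip (z n) (z n))"
      using * by (simp add: algebra_simps)
    finally have **: "(p m + p n) * (N (z m - z n))\<^sup>2 \<le> (p n - p m) * (ip (z m) (z m) - ip (z n) (z n))" .
    have "0 \<le> (p m + p n) * (N (z m - z n))\<^sup>2" using p_pos[of m] p_pos[of n] by auto
    with ** have ge: "p n = p m \<or> 0 \<le> ip (z m) (z m) - ip (z n) (z n)"
      using pmn by (smt (verit) zero_le_mult_iff)
    show ?thesis
    proof (cases "p n = p m")
      case True
      then have "m = n" using \<mu>_pos that by (simp add: p_def \<tau>_def)
      then show ?thesis by simp
    next
      case False
      then have "(p n - p m) * (ip (z m) (z m) - ip (z n) (z n))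
          \<le> (p m + p n) * (ip (z m) (z m) - ip (z n) (z n))"
        using ge p_pos[of m] by (intro mult_right_mono) auto
      with ** have "(p m + p n) * (N (z m - z n))\<^sup>2 \<le> (p m + p n) * (ip (z m) (z m) - ip (z n) (z n))"
        by simp
      then show ?thesis using p_pos[of m] p_pos[of n] by (simp add: N_power2)
    qed
  qed
  have "decseq (\<lambda>n. (N (z n))\<^sup>2)"
    unfolding decseq_def using key by (smt (verit) zero_le_power2)
  then have "convergent (\<lambda>n. (N (z n))\<^sup>2)"
    by (metis decseq_convergent convergentI zero_le_power2)
  then have "Cauchy (\<lambda>n. (N (z n))\<^sup>2)" by (simp add: Cauchy_convergent_iff)
  then have "\<exists>l\<in>V. (\<lambda>n. N (z n - l)) \<longlonglongrightarrow> 0"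
  proof (intro complete)
    fix e :: real assume C: "Cauchy (\<lambda>n. (N (z n))\<^sup>2)" and e: "e > 0"
    obtain M where M: "\<And>m n. \<lbrakk>M \<le> m; M \<le> n\<rbrakk> \<Longrightarrow> \<bar>(N (z m))\<^sup>2 - (N (z n))\<^sup>2\<bar> < e\<^sup>2"
      using CauchyD[OF C, of "e\<^sup>2"] e by auto
    have *: "N (z m - z n) < e" if "M \<le> m" "m \<le> n" for m n
      using key[of m n] M[of m n] that e by (intro power2_less_imp_less[of _ e]) auto
    have "N (z m - z n) < e" if "M \<le> m" "M \<le> n" for m n
      using *[of m n] *[of n m] that N_minus_commute[of "z m" "z n"] by (cases "m \<le> n") auto
    then show "\<exists>M. \<forall>m\<ge>M. \<forall>n\<ge>M. N (z m - z n) < e" by blast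
  qed auto
  then obtain l where l [simp]: "l \<in> V" and lim: "(\<lambda>n. N (z n - l)) \<longlonglongrightarrow> 0" by blast
  \<comment> \<open>\<open>J 0 (A y) = p 0 *\<^sub>R (J 0 y - y)\<close> is bounded by \<open>2 * p 0 * N y\<close>.\<close>
  have Jz: "N (J 0 (z n)) \<le> 2 * p 0 * \<tau> n * N x" for n
  proof -
    have "J 0 (z n) = - \<tau> n *\<^sub>R J 0 (A (J n x))" by (simp add: zA J_scale flip: scaleR_minus_left)
    also have "J 0 (A (J n x)) = p 0 *\<^sub>R (J 0 (J n x) - J n x)"
      using J_A[of "J n x" 0] A_J[of "J n x" 0] by (simp add: p_def)
    finally have "N (J 0 (z n)) = \<tau> n * p 0 * N (J 0 (J n x) - J n x)"
      using p_pos[of 0] by (simp add: N_scale N_minus abs_mult)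
    also have "N (J 0 (J n x) - J n x) \<le> N (J 0 (J n x)) + N (J n x)"
      by (rule N_triangle_minus) auto
    also have "\<dots> \<le> 2 * N x"
      using J_contraction[of "J n x" 0] J_contraction[of x n] by simp
    finally show ?thesis using p_pos[of 0] by (simp add: mult_left_mono mult_ac)
  qed
  have "(\<lambda>n. N (J 0 (z n) - 0)) \<longlonglongrightarrow> 0"
  proof (rule Lim_null_comparison)
    show "(\<lambda>n. 2 * p 0 * \<tau> n * N x) \<longlonglongrightarrow> 0"
      using \<tau>_tendsto_0 by (intro tendsto_eq_intros) auto
  qed (use Jz in auto)
  moreover have "(\<lambda>n. N (J 0 (z n) - J 0 l)) \<longlonglongrightarrow> 0"
  proof (rule Lim_null_comparison[OF _ lim])
    show "\<forall>\<^sub>F n in sequentially. norm (N (J 0 (z n) - J 0 l)) \<le> N (z n - l)"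
      using J_contraction[of "z _ - l" 0] by (simp add: J_diff)
  qed
  ultimately have "J 0 l = 0" using limit_unique[of "\<lambda>n. J 0 (z n)" "J 0 l" 0] by auto
  then have "l = 0" using J_eq[of l 0] A_scale[of 0 0] by simp
  then show ?thesis using lim N_minus_commute[of x "J _ x"] by (simp add: z_def)
qed

lemma D2_dense:
  assumes u: "u \<in> V" and e: "e > 0"
  obtains v where "v \<in> D" "A v \<in> D" "N (u - v) < e"
proof -
  obtain n where n: "N (J n u - u) < e / 2"
    using order_tendstoD(2)[OF J_tendsto[OF u], of "e / 2"] e by (auto simp: eventually_sequentially)
  have "N (u - J n (J n u)) \<le> N (u - J n u) + N (J n (u - J n u))"
    using N_triangle_diff[of u "J n u" "J n (J n u)"] u by (simp add: J_diff)
  also have "\<dots> \<le> 2 * N (J n u - u)"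
    using J_contraction[of "u - J n u" n] N_minus_commute[of u "J n u"] u by simp
  finally show ?thesis using that[of "J n (J n u)"] n u A_J_mem by auto
qed

definition steps :: "nat \<Rightarrow> real \<Rightarrow> nat" where "steps n t = nat \<lfloor>t / \<tau> n\<rfloor>"

abbreviation E :: "nat \<Rightarrow> real \<Rightarrow> 'a \<Rightarrow> 'a" where "E n t \<equiv> J n ^^ steps n t"

lemma steps_le: "0 \<le> t \<Longrightarrow> real (steps n t) * \<tau> n \<le> t"
  by (simp add: steps_def flip: pos_le_divide_eq)

lemma steps_ge: "0 \<le> t \<Longrightarrow> t - \<tau> n \<le> real (steps n t) * \<tau> n"
proof -
  assume "0 \<le> t"
  then have "t / \<tau> n - 1 \<le> real (steps n t)" unfolding steps_def by linarith
  then have "(t / \<tau> n - 1) * \<tau> n \<le> real (steps n t) * \<tau> n" by (intro mult_right_mono) auto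
  then show ?thesis by (simp add: left_diff_distrib)
qed

lemma steps_tendsto: "0 \<le> t \<Longrightarrow> (\<lambda>n. real (steps n t) * \<tau> n) \<longlonglongrightarrow> t"
  by (rule tendsto_sandwich[of "\<lambda>n. t - \<tau> n" _ _ "\<lambda>n. t"])
     (auto simp: steps_le steps_ge intro!: tendsto_eq_intros \<tau>_tendsto_0)

lemma steps_0 [simp]: "steps n 0 = 0" by (simp add: steps_def)

lemma powJ_Suc_diff: "u \<in> D \<Longrightarrow> N ((J n ^^ Suc k) u - (J n ^^ k) u) \<le> \<tau> n * N (A u)"
proof -
  assume u: "u \<in> D"
  have "(J n ^^ Suc k) u - (J n ^^ k) u = (J n ^^ k) (J n u - u)"
    using u by (simp add: powJ_diff funpow_swap1)
  then have "N ((J n ^^ Suc k) u - (J n ^^ k) u) \<le> N (J n u - u)"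
    using u by (simp add: powJ_contraction del: funpow.simps)
  also have "\<dots> \<le> \<tau> n * N (A u)"
    using u by (simp add: J_diff_self N_scale J_contraction)
  finally show ?thesis .
qed

lemma powJ_diff_self: "u \<in> D \<Longrightarrow> N ((J n ^^ k) u - u) \<le> real k * \<tau> n * N (A u)"
proof (induction k)
  case (Suc k)
  have "N ((J n ^^ Suc k) u - u) \<le> N ((J n ^^ Suc k) u - (J n ^^ k) u) + N ((J n ^^ k) u - u)"
    using Suc.prems by (intro N_triangle_diff) auto
  also have "\<dots> \<le> \<tau> n * N (A u) + real k * \<tau> n * N (A u)"
    using Suc powJ_Suc_diff[of u k n] by (simp del: funpow.simps)
  finally show ?case by (simp add: algebra_simps)
qed simp

text \<open>From \<open>(1 - \<tau>/2 A)\<^sup>2 = (1 - \<tau> A) + \<tau>\<^sup>2/4 A\<^sup>2\<close>, two half steps and one full step differ by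
  \<open>\<tau>\<^sup>2/4\<close> times resolvents applied to \<open>A\<^sup>2 u\<close>. Since resolvents commute and contract, the local
  errors of \<open>k\<close> steps simply add up.\<close>

lemma powJ_double_step:
  assumes u: "u \<in> D" "A u \<in> D"
  shows "N ((J n ^^ k) u - (J (Suc n) ^^ (2 * k)) u) \<le> real k * ((\<tau> n)\<^sup>2 / 4) * N (A (A u))"
proof (induction k)
  case (Suc k)
  let ?K = "\<lambda>u. J (Suc n) (J (Suc n) u)"
  let ?w = "(J (Suc n) ^^ (2 * k)) u"
  have w: "?w \<in> D" using powJ_memD u by blast
  have local_error: "N (J n u - ?K u) \<le> (\<tau> n)\<^sup>2 / 4 * N (A (A u))"
  proof -
    define v where "v = ?K u"
    define y where "y = J (Suc n) u"
    have y: "y \<in> D" "y - \<tau> (Suc n) *\<^sub>R A y = u" using J_eq u by (auto simp: y_def)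
    have v: "v \<in> D" "v - \<tau> (Suc n) *\<^sub>R A v = y" "A v \<in> D"
      using J_eq[of y] y u A_J_mem by (auto simp: v_def y_def)
    have "v - \<tau> n *\<^sub>R A v + ((\<tau> n)\<^sup>2 / 4) *\<^sub>R A (A v) = u"
    proof -
      have "u = (v - \<tau> (Suc n) *\<^sub>R A v) - \<tau> (Suc n) *\<^sub>R A (v - \<tau> (Suc n) *\<^sub>R A v)"
        using y v by simp
      also have "\<dots> = v - (\<tau> (Suc n) + \<tau> (Suc n)) *\<^sub>R A v + (\<tau> (Suc n) * \<tau> (Suc n)) *\<^sub>R A (A v)"
        using v by (simp add: A_diff A_scale algebra_simps flip: scaleR_left_distrib)
      finally show ?thesis by (simp add: \<tau>_Suc power2_eq_square)
    qed
    then have "J n u = J n ((v - \<tau> n *\<^sub>R A v) + ((\<tau> n)\<^sup>2 / 4) *\<^sub>R A (A v))" by simp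
    also have "\<dots> = v + ((\<tau> n)\<^sup>2 / 4) *\<^sub>R J n (A (A v))"
      using v J_eqI[of v n "v - \<tau> n *\<^sub>R A v"] by (simp add: J_add J_scale)
    finally have "N (J n u - v) = (\<tau> n)\<^sup>2 / 4 * N (J n (A (A v)))" using v by (simp add: N_scale)
    also have "A (A v) = ?K (A (A u))"
      using u A_J_mem by (simp add: v_def flip: J_A)
    also have "N (J n (?K (A (A u)))) \<le> N (A (A u))"
      using u by (intro J_contraction[THEN order_trans]) (auto intro!: J_contraction)
    finally show ?thesis by (simp add: v_def mult_left_mono)
  qed
  have "(J n ^^ Suc k) u - (J (Suc n) ^^ (2 * Suc k)) u
     = J n ((J n ^^ k) u - ?w) + (J n ?w - ?K ?w)"
    using u w by (simp add: J_diff)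
  also have "J n ?w - ?K ?w = (J (Suc n) ^^ (2 * k)) (J n u - ?K u)"
    using u by (simp add: powJ_diff J_powJ_commute)
  finally have "N ((J n ^^ Suc k) u - (J (Suc n) ^^ (2 * Suc k)) u)
     \<le> N (J n ((J n ^^ k) u - ?w)) + N ((J (Suc n) ^^ (2 * k)) (J n u - ?K u))"
    using u w by (simp add: N_triangle del: funpow.simps)
  also have "\<dots> \<le> N ((J n ^^ k) u - ?w) + N (J n u - ?K u)"
    using u w by (intro add_mono J_contraction powJ_contraction) auto
  also have "\<dots> \<le> real k * ((\<tau> n)\<^sup>2 / 4) * N (A (A u)) + (\<tau> n)\<^sup>2 / 4 * N (A (A u))"
    using Suc.IH local_error by simp
  finally show ?case by (simp add: algebra_simps del: funpow.simps)
qed simp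

text \<open>About \<open>t / \<tau>\<^sub>n\<close> local errors of size \<open>\<tau>\<^sub>n\<^sup>2\<close> amount to \<open>O(\<tau>\<^sub>n)\<close>, and so does the one step that
  may be gained by rounding when the step size is halved. As \<open>\<tau>\<^sub>n\<close> is geometric in \<open>n\<close>, the sequence converges.\<close>

lemma E_converges_smooth:
  assumes u: "u \<in> D" "A u \<in> D" and t: "0 \<le> t"
  shows "\<exists>x\<in>V. (\<lambda>n. N (E n t u - x)) \<longlonglongrightarrow> 0"
proof (rule geometric_Cauchy_converges)
  define C where "C = \<tau> 0 * (t / 4 * N (A (A u)) + N (A u) / 2)"
  show "E n t u \<in> V" for n using u by auto
  show "N (E (Suc n) t u - E n t u) \<le> C * (1/2) ^ n" for n
  proof -
    let ?k = "steps n t"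
    have "t / \<tau> (Suc n) = t / \<tau> n + t / \<tau> n" by (simp add: \<tau>_Suc)
    then have "steps (Suc n) t = nat \<lfloor>t / \<tau> n + t / \<tau> n\<rfloor>" by (simp add: steps_def)
    then have cs: "steps (Suc n) t = 2 * ?k \<or> steps (Suc n) t = Suc (2 * ?k)"
      using floor_add_cases[of "t / \<tau> n" "t / \<tau> n"] t by (auto simp: steps_def)
    have 1: "N (E (Suc n) t u - (J (Suc n) ^^ (2 * ?k)) u) \<le> \<tau> (Suc n) * N (A u)"
      using cs powJ_Suc_diff[of u "2 * ?k" "Suc n"] u by (auto simp del: funpow.simps)
    have 2: "N ((J (Suc n) ^^ (2 * ?k)) u - E n t u) \<le> t * \<tau> n / 4 * N (A (A u))"
    proof -
      have "N ((J (Suc n) ^^ (2 * ?k)) u - E n t u) \<le> real ?k * ((\<tau> n)\<^sup>2 / 4) * N (A (A u))"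
        using powJ_double_step[OF u, of ?k n] N_minus_commute[of "(J (Suc n) ^^ (2 * ?k)) u" "E n t u"] u by simp
      also have "\<dots> = (real ?k * \<tau> n) * (\<tau> n / 4 * N (A (A u)))" by (simp add: power2_eq_square)
      also have "\<dots> \<le> t * (\<tau> n / 4 * N (A (A u)))"
        using steps_le[OF t] u by (intro mult_right_mono) auto
      finally show ?thesis by simp
    qed
    have "N (E (Suc n) t u - E n t u) \<le> \<tau> (Suc n) * N (A u) + t * \<tau> n / 4 * N (A (A u))"
      using N_triangle_diff[of "E (Suc n) t u" "(J (Suc n) ^^ (2 * ?k)) u" "E n t u"] 1 2 u by auto
    also have "\<dots> = C * (1/2) ^ n" by (subst \<tau>_Suc, subst (1 2) \<tau>_power) (simp add: C_def algebra_simps)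
    finally show ?thesis .
  qed
qed auto

lemma E_converges:
  assumes u: "u \<in> V" and t: "0 \<le> t"
  shows "\<exists>x\<in>V. (\<lambda>n. N (E n t u - x)) \<longlonglongrightarrow> 0"
proof (rule complete)
  show "E n t u \<in> V" for n using u by auto
  fix e :: real assume e: "e > 0"
  obtain v where v: "v \<in> D" "A v \<in> D" "N (u - v) < e / 4" using D2_dense[OF u, of "e / 4"] e by auto
  obtain x where x: "x \<in> V" "(\<lambda>n. N (E n t v - x)) \<longlonglongrightarrow> 0" using E_converges_smooth[OF v(1,2) t] by blast
  then obtain M where M: "\<And>n. M \<le> n \<Longrightarrow> N (E n t v - x) < e / 4"
    using order_tendstoD(2)[OF x(2), of "e / 4"] e by (auto simp: eventually_sequentially)
  have *: "N (E n t u - x) < e / 2" if "M \<le> n" for n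
  proof -
    have "N (E n t u - x) \<le> N (E n t u - E n t v) + N (E n t v - x)"
      using u v x by (intro N_triangle_diff) auto
    also have "N (E n t u - E n t v) \<le> N (u - v)"
      using powJ_contraction[of "u - v"] u v by (simp add: powJ_diff)
    finally show ?thesis using M[OF that] v by simp
  qed
  have "N (E m t u - E n t u) < e" if "M \<le> m" "M \<le> n" for m n
    using *[OF that(1)] *[OF that(2)] N_triangle_diff[of "E m t u" x "E n t u"] N_minus_commute[of x "E n t u"] u x
    by auto
  then show "\<exists>M. \<forall>m\<ge>M. \<forall>n\<ge>M. N (E m t u - E n t u) < e" by blast
qed

definition S :: "real \<Rightarrow> 'a \<Rightarrow> 'a" where
  "S t u = (THE x. x \<in> V \<and> (\<lambda>n. N (E n t u - x)) \<longlonglongrightarrow> 0)"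

lemma S_eqI:
  assumes "u \<in> V" "x \<in> V" "(\<lambda>n. N (E n t u - x)) \<longlonglongrightarrow> 0"
  shows "S t u = x"
  unfolding S_def using assms limit_unique[of "\<lambda>n. E n t u"] by blast

lemma S:
  assumes "u \<in> V" "0 \<le> t"
  shows S_mem [simp, intro]: "S t u \<in> V" and S_lim: "(\<lambda>n. N (E n t u - S t u)) \<longlonglongrightarrow> 0"
  using E_converges[OF assms] S_eqI[OF assms(1)] by auto

lemma S_add:
  assumes "u \<in> V" "v \<in> V" "0 \<le> t"
  shows "S t (u + v) = S t u + S t v"
proof (rule S_eqI)
  have eq: "E n t (u + v) - (S t u + S t v) = (E n t u - S t u) + (E n t v - S t v)" for n
    using assms by (simp add: powJ_add)
  show "(\<lambda>n. N (E n t (u + v) - (S t u + S t v))) \<longlonglongrightarrow> 0"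
  proof (rule Lim_null_comparison)
    show "\<forall>\<^sub>F n in sequentially. norm (N (E n t (u + v) - (S t u + S t v)))
       \<le> N (E n t u - S t u) + N (E n t v - S t v)"
      unfolding eq using assms by (intro always_eventually) (auto intro!: N_triangle)
    show "(\<lambda>n. N (E n t u - S t u) + N (E n t v - S t v)) \<longlonglongrightarrow> 0"
      using tendsto_add[OF S_lim[OF assms(1,3)] S_lim[OF assms(2,3)]] by simp
  qed
qed (use assms in auto)

lemma S_scale:
  assumes "u \<in> V" "0 \<le> t"
  shows "S t (r *\<^sub>R u) = r *\<^sub>R S t u"
proof (rule S_eqI)
  have "E n t (r *\<^sub>R u) - r *\<^sub>R S t u = r *\<^sub>R (E n t u - S t u)" for n
    using assms by (simp add: powJ_scale scaleR_diff_right)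
  then show "(\<lambda>n. N (E n t (r *\<^sub>R u) - r *\<^sub>R S t u)) \<longlonglongrightarrow> 0"
    using tendsto_mult_right_zero[OF S_lim[OF assms]] assms by (simp add: N_scale)
qed (use assms in auto)

lemma S_diff: "\<lbrakk>u \<in> V; v \<in> V; 0 \<le> t\<rbrakk> \<Longrightarrow> S t (u - v) = S t u - S t v"
  using S_add[of "u - v" v t] by simp

lemma S_0: "u \<in> V \<Longrightarrow> S 0 u = u"
  by (rule S_eqI) auto

text \<open>Bernoulli's inequality replaces \<open>(1 + \<tau>\<delta>)\<^sup>k\<close> by \<open>1 + k\<tau>\<delta>\<close>, whose limit is obvious. The
  exponential rate is recovered from the semigroup law in \<open>S_decay\<close>.\<close>

lemma S_decay_linear:
  assumes u: "u \<in> V" and t: "0 \<le> t"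
  shows "(1 + \<delta> * t) * N (S t u) \<le> N u"
proof (rule LIMSEQ_le_const2)
  show "(\<lambda>n. (1 + \<delta> * (real (steps n t) * \<tau> n)) * N (E n t u)) \<longlonglongrightarrow> (1 + \<delta> * t) * N (S t u)"
    using u t by (intro tendsto_intros steps_tendsto N_limit S_lim) auto
  have "(1 + \<delta> * (real (steps n t) * \<tau> n)) * N (E n t u) \<le> N u" for n
  proof -
    have "1 + \<delta> * (real (steps n t) * \<tau> n) \<le> (1 + \<tau> n * \<delta>) ^ steps n t"
      using Bernoulli_inequality[of "\<tau> n * \<delta>" "steps n t"] \<delta>_pos
      by (simp add: mult_ac) (smt (verit) \<tau>_pos(1) mult_pos_pos)
    then have "(1 + \<delta> * (real (steps n t) * \<tau> n)) * N (E n t u) \<le> (1 + \<tau> n * \<delta>) ^ steps n t * N (E n t u)"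
      using u by (intro mult_right_mono) auto
    also have "\<dots> \<le> N u" by (rule powJ_bound[OF u])
    finally show ?thesis .
  qed
  then show "\<exists>M. \<forall>n\<ge>M. (1 + \<delta> * (real (steps n t) * \<tau> n)) * N (E n t u) \<le> N u" by blast
qed

lemma S_contraction: "\<lbrakk>u \<in> V; 0 \<le> t\<rbrakk> \<Longrightarrow> N (S t u) \<le> N u"
  using S_decay_linear[of u t] \<delta>_pos
  by (smt (verit) N_nonneg S_mem mult_le_cancel_right1 mult_nonneg_nonneg)

text \<open>A single step tends to the identity, so miscounting by one step does not change the limit.\<close>

lemma E_tendsto_shift:
  assumes u: "u \<in> V" and k: "\<And>n. k n = steps n t \<or> k n = Suc (steps n t)" and t: "0 \<le> t"
  shows "(\<lambda>n. N ((J n ^^ k n) u - S t u)) \<longlonglongrightarrow> 0"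
proof (rule Lim_null_comparison)
  show "(\<lambda>n. N (J n u - u) + N (E n t u - S t u)) \<longlonglongrightarrow> 0"
    using tendsto_add[OF J_tendsto[OF u] S_lim[OF u t]] by simp
  have "N ((J n ^^ k n) u - S t u) \<le> N (J n u - u) + N (E n t u - S t u)" for n
  proof -
    have "N ((J n ^^ k n) u - E n t u) \<le> N (J n u - u)"
    proof (cases "k n = steps n t")
      case False
      then have "k n = Suc (steps n t)" using k by blast
      then have "(J n ^^ k n) u - E n t u = E n t (J n u - u)"
        using u by (simp add: powJ_diff funpow_swap1)
      then show ?thesis using u by (simp add: powJ_contraction)
    qed (use u in simp)
    then show ?thesis
      using N_triangle_diff[of "(J n ^^ k n) u" "E n t u" "S t u"] u t by auto
  qed
  then show "\<forall>\<^sub>F n in sequentially. norm (N ((J n ^^ k n) u - S t u)) \<le> N (J n u - u) + N (E n t u - S t u)"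
    using u t by (intro always_eventually) auto
qed

lemma S_semigroup:
  assumes u: "u \<in> V" and s: "0 \<le> s" and t: "0 \<le> t"
  shows "S (s + t) u = S s (S t u)"
proof -
  have ks: "steps n (s + t) = steps n s + steps n t \<or> steps n (s + t) = Suc (steps n s + steps n t)" for n
    using floor_add_cases[of "s / \<tau> n" "t / \<tau> n"] s t by (auto simp: steps_def add_divide_distrib)
  \<comment> \<open>The step that may be gained by rounding is assigned to the time \<open>s\<close>.\<close>
  define k where "k n = steps n (s + t) - steps n t" for n
  have k: "k n = steps n s \<or> k n = Suc (steps n s)" "steps n (s + t) = k n + steps n t" for n
    using ks[of n] by (auto simp: k_def)
  show ?thesis
  proof (rule S_eqI[OF u])
    show "S s (S t u) \<in> V" using u s t by auto
    show "(\<lambda>n. N (E n (s + t) u - S s (S t u))) \<longlonglongrightarrow> 0"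
    proof (rule Lim_null_comparison)
      show "(\<lambda>n. N (E n t u - S t u) + N ((J n ^^ k n) (S t u) - S s (S t u))) \<longlonglongrightarrow> 0"
        using tendsto_add[OF S_lim[OF u t] E_tendsto_shift[of "S t u" k s]] u s t k by auto
      have "N (E n (s + t) u - S s (S t u))
          \<le> N (E n t u - S t u) + N ((J n ^^ k n) (S t u) - S s (S t u))" for n
      proof -
        have "E n (s + t) u = (J n ^^ k n) (E n t u)" by (simp add: k(2) funpow_add)
        then have "N (E n (s + t) u - (J n ^^ k n) (S t u)) \<le> N (E n t u - S t u)"
          using powJ_contraction[of "E n t u - S t u"] u t by (simp add: powJ_diff)
        then show ?thesis
          using N_triangle_diff[of "E n (s + t) u" "(J n ^^ k n) (S t u)" "S s (S t u)"] u s t by auto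
      qed
      then show "\<forall>\<^sub>F n in sequentially. norm (N (E n (s + t) u - S s (S t u)))
          \<le> N (E n t u - S t u) + N ((J n ^^ k n) (S t u) - S s (S t u))"
        using u s t by (intro always_eventually) auto
    qed
  qed
qed

lemma S_power_decay:
  assumes u: "u \<in> V" and t: "0 \<le> t"
  shows "(1 + \<delta> * t) ^ n * N (S (real n * t) u) \<le> N u"
proof (induction n)
  case 0 then show ?case using u by (simp add: S_0)
next
  case (Suc n)
  have "S (real (Suc n) * t) u = S t (S (real n * t) u)"
    using S_semigroup[of u t "real n * t"] u t by (simp add: algebra_simps)
  then have "(1 + \<delta> * t) * N (S (real (Suc n) * t) u) \<le> N (S (real n * t) u)"
    using S_decay_linear[of "S (real n * t) u" t] u t by auto
  then have "(1 + \<delta> * t) ^ n * ((1 + \<delta> * t) * N (S (real (Suc n) * t) u))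
      \<le> (1 + \<delta> * t) ^ n * N (S (real n * t) u)"
    using \<delta>_pos t by (intro mult_left_mono) (auto intro!: zero_le_power add_nonneg_nonneg)
  then show ?case using Suc by (simp add: mult_ac)
qed

lemma S_decay:
  assumes u: "u \<in> V" and t: "0 \<le> t"
  shows "N (S t u) \<le> exp (- \<delta> * t) * N u"
proof -
  have "exp (\<delta> * t) * N (S t u) \<le> N u"
  proof (rule LIMSEQ_le_const2)
    show "(\<lambda>n. (1 + \<delta> * t / real n) ^ n * N (S t u)) \<longlonglongrightarrow> exp (\<delta> * t) * N (S t u)"
      by (intro tendsto_intros tendsto_exp_limit_sequentially)
    have "(1 + \<delta> * t / real n) ^ n * N (S t u) \<le> N u" if "1 \<le> n" for n
      using S_power_decay[OF u, of "t / real n" n] t that by simp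
    then show "\<exists>M. \<forall>n\<ge>M. (1 + \<delta> * t / real n) ^ n * N (S t u) \<le> N u" by blast
  qed
  then show ?thesis by (simp add: exp_minus field_simps)
qed

text \<open>For vectors outside the domain the first order bound is lost; approximating by \<open>g \<in> D\<close>
  leaves an estimate that is uniform in the step size.\<close>

lemma powJ_diff_self_approx:
  assumes "u \<in> V" "g \<in> D"
  shows "N ((J n ^^ k) u - u) \<le> 2 * N (u - g) + real k * \<tau> n * N (A g)"
proof -
  have "N ((J n ^^ k) u - u) \<le> N ((J n ^^ k) u - (J n ^^ k) g) + N ((J n ^^ k) g - u)"
    using assms by (intro N_triangle_diff) auto
  also have "\<dots> \<le> N ((J n ^^ k) u - (J n ^^ k) g) + (N ((J n ^^ k) g - g) + N (g - u))"
    using assms N_triangle_diff[of "(J n ^^ k) g" g u] by auto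
  also have "N ((J n ^^ k) u - (J n ^^ k) g) \<le> N (u - g)"
    using powJ_contraction[of "u - g" k n] assms by (simp add: powJ_diff)
  finally show ?thesis
    using powJ_diff_self[OF assms(2), of k n] N_minus_commute[of g u] assms by auto
qed

lemma S_diff_self:
  assumes "u \<in> V" "g \<in> D" "0 \<le> t"
  shows "N (S t u - u) \<le> 2 * N (u - g) + t * N (A g)"
proof (rule LIMSEQ_le)
  show "(\<lambda>n. N (E n t u - u)) \<longlonglongrightarrow> N (S t u - u)"
    using assms by (intro N_diff_limit S_lim) auto
  show "(\<lambda>n. 2 * N (u - g) + real (steps n t) * \<tau> n * N (A g)) \<longlonglongrightarrow> 2 * N (u - g) + t * N (A g)"
    using assms by (intro tendsto_intros steps_tendsto)
qed (use assms powJ_diff_self_approx in auto)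

text \<open>The \<open>j\<close>-th step adds \<open>\<tau> J\<^sup>j A u\<close>, which is compared with \<open>\<tau> A u\<close>. Since \<open>A u\<close> need not lie in
  the domain, it is approximated by \<open>g\<close>.\<close>

lemma powJ_derivative:
  assumes u: "u \<in> D" and g: "g \<in> D"
  shows "N ((J n ^^ k) u - u - (real k * \<tau> n) *\<^sub>R A u)
      \<le> real k * \<tau> n * (2 * N (A u - g) + real k * \<tau> n * N (A g))"
proof -
  have "N ((J n ^^ j) u - u - (real j * \<tau> n) *\<^sub>R A u)
      \<le> real j * \<tau> n * (2 * N (A u - g) + real k * \<tau> n * N (A g))" if "j \<le> k" for j
    using that
  proof (induction j)
    case (Suc j)
    let ?B = "2 * N (A u - g) + real k * \<tau> n * N (A g)"
    have "(J n ^^ Suc j) u - (J n ^^ j) u = (J n ^^ j) (J n u - u)"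
      using u by (simp add: powJ_diff funpow_swap1)
    also have "\<dots> = \<tau> n *\<^sub>R (J n ^^ Suc j) (A u)"
      using u by (simp add: J_diff_self powJ_scale funpow_swap1)
    finally have eq: "(J n ^^ Suc j) u - u - (real (Suc j) * \<tau> n) *\<^sub>R A u
       = \<tau> n *\<^sub>R ((J n ^^ Suc j) (A u) - A u) + ((J n ^^ j) u - u - (real j * \<tau> n) *\<^sub>R A u)"
      by (simp add: algebra_simps del: funpow.simps)
    have "N ((J n ^^ Suc j) (A u) - A u) \<le> 2 * N (A u - g) + real (Suc j) * \<tau> n * N (A g)"
      using powJ_diff_self_approx[of "A u" g "Suc j" n] u g by blast
    also have "\<dots> \<le> ?B" using Suc.prems g u by (intro add_mono mult_right_mono) auto
    finally have "\<tau> n * N ((J n ^^ Suc j) (A u) - A u) \<le> \<tau> n * ?B"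
      by (intro mult_left_mono) auto
    moreover have "N ((J n ^^ Suc j) u - u - (real (Suc j) * \<tau> n) *\<^sub>R A u)
       \<le> \<tau> n * N ((J n ^^ Suc j) (A u) - A u) + N ((J n ^^ j) u - u - (real j * \<tau> n) *\<^sub>R A u)"
      unfolding eq using u
      by (intro order_trans[OF N_triangle]) (auto simp: N_scale simp del: funpow.simps)
    ultimately show ?case using Suc by (simp add: algebra_simps del: funpow.simps)
  qed simp
  then show ?thesis by blast
qed

lemma S_derivative:
  assumes u: "u \<in> D" and g: "g \<in> D" and t: "0 \<le> t"
  shows "N (S t u - u - t *\<^sub>R A u) \<le> t * (2 * N (A u - g) + t * N (A g))"
proof (rule LIMSEQ_le)
  let ?X = "\<lambda>n. E n t u - u - (real (steps n t) * \<tau> n) *\<^sub>R A u"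
  show "(\<lambda>n. N (?X n)) \<longlonglongrightarrow> N (S t u - u - t *\<^sub>R A u)"
  proof (rule N_limit)
    show "(\<lambda>n. N (?X n - (S t u - u - t *\<^sub>R A u))) \<longlonglongrightarrow> 0"
    proof (rule Lim_null_comparison)
      have "(\<lambda>n. N (E n t u - S t u) + \<bar>t - real (steps n t) * \<tau> n\<bar> * N (A u)) \<longlonglongrightarrow> 0 + \<bar>t - t\<bar> * N (A u)"
        using u t by (intro tendsto_intros steps_tendsto S_lim) auto
      then show "(\<lambda>n. N (E n t u - S t u) + \<bar>t - real (steps n t) * \<tau> n\<bar> * N (A u)) \<longlonglongrightarrow> 0" by simp
      have "N (?X n - (S t u - u - t *\<^sub>R A u)) \<le> N (E n t u - S t u) + \<bar>t - real (steps n t) * \<tau> n\<bar> * N (A u)" for n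
      proof -
        have eq: "?X n - (S t u - u - t *\<^sub>R A u) = (E n t u - S t u) + (t - real (steps n t) * \<tau> n) *\<^sub>R A u"
          by (simp add: algebra_simps)
        show ?thesis unfolding eq
          using N_triangle[of "E n t u - S t u" "(t - real (steps n t) * \<tau> n) *\<^sub>R A u"] u t
          by (simp add: N_scale)
      qed
      then show "\<forall>\<^sub>F n in sequentially. norm (N (?X n - (S t u - u - t *\<^sub>R A u)))
          \<le> N (E n t u - S t u) + \<bar>t - real (steps n t) * \<tau> n\<bar> * N (A u)"
        using u t by (intro always_eventually) auto
    qed
  qed (use u t in auto)
  show "(\<lambda>n. real (steps n t) * \<tau> n * (2 * N (A u - g) + real (steps n t) * \<tau> n * N (A g)))
     \<longlonglongrightarrow> t * (2 * N (A u - g) + t * N (A g))"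
    using t by (intro tendsto_intros steps_tendsto)
qed (use u g powJ_derivative in auto)

lemma S_continuous:
  assumes u: "u \<in> V"
  shows "((\<lambda>t. N (S t u - u)) \<longlongrightarrow> 0) (at_right 0)"
proof (rule tendstoI)
  fix e :: real assume e: "e > 0"
  obtain g where g: "g \<in> D" "N (u - g) < e / 4" using D2_dense[OF u, of "e / 4"] e by auto
  have "((\<lambda>t. 2 * N (u - g) + t * N (A g)) \<longlongrightarrow> 2 * N (u - g) + 0 * N (A g)) (at_right 0)"
    by (intro tendsto_intros)
  then have "\<forall>\<^sub>F t in at_right 0. 2 * N (u - g) + t * N (A g) < e"
    by (rule order_tendstoD(2)) (use g e in auto)
  then show "\<forall>\<^sub>F t in at_right 0. dist (N (S t u - u)) 0 < e"
    using eventually_at_right_less[of 0]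
  proof eventually_elim
    case (elim t)
    then show ?case using S_diff_self[OF u g(1), of t] u by auto
  qed
qed

lemma S_generator:
  assumes u: "u \<in> D"
  shows "generator_limit ip S u (A u)"
  unfolding generator_limit_def
proof (rule tendstoI)
  fix e :: real assume e: "e > 0"
  obtain g where g: "g \<in> D" "N (A u - g) < e / 4" using D2_dense[of "A u" "e / 4"] e u by auto
  have "((\<lambda>t. 2 * N (A u - g) + t * N (A g)) \<longlongrightarrow> 2 * N (A u - g) + 0 * N (A g)) (at_right 0)"
    by (intro tendsto_intros)
  then have "\<forall>\<^sub>F t in at_right 0. 2 * N (A u - g) + t * N (A g) < e"
    by (rule order_tendstoD(2)) (use g e in auto)
  then show "\<forall>\<^sub>F t in at_right 0. dist (N ((1 / t) *\<^sub>R (S t u - u) - A u)) 0 < e"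
    using eventually_at_right_less[of 0]
  proof eventually_elim
    case (elim t)
    have eq: "(1 / t) *\<^sub>R (S t u - u) - A u = (1 / t) *\<^sub>R (S t u - u - t *\<^sub>R A u)"
      using elim by (simp add: scaleR_diff_right)
    have "N (S t u - u - t *\<^sub>R A u) < t * e"
      using S_derivative[OF u g(1), of t] elim
      by (smt (verit) mult_strict_left_mono)
    then show ?case
      unfolding eq using elim u by (simp add: N_scale pos_divide_less_eq mult.commute)
  qed
qed

text \<open>The generator of the semigroup is a dissipative extension of \<open>A\<close>, and \<open>\<mu> - A\<close> is already onto,
  so the extension cannot be proper. If \<open>v \<in> D\<close> solves \<open>\<mu> v - A v = \<mu> u - f\<close>, then the
  difference \<open>e = u - v\<close> satisfies \<open>(S\<^sub>t e - e) / t \<longlonglongrightarrow> \<mu> e\<close>, which contradicts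
  \<open>\<parallel>S\<^sub>t e\<parallel> \<le> \<parallel>e\<parallel>\<close> unless \<open>e = 0\<close>.\<close>

lemma generator_domain:
  assumes u: "u \<in> V" and f: "f \<in> V" and lim: "generator_limit ip S u f"
  shows "u \<in> D"
proof -
  obtain v where v: "v \<in> D" "\<mu> *\<^sub>R v - A v = \<mu> *\<^sub>R u - f" using onto[of "\<mu> *\<^sub>R u - f"] u f by auto
  define e where "e = u - v"
  have e: "e \<in> V" using u v by (auto simp: e_def)
  have \<mu>e: "\<mu> *\<^sub>R e = f - A v" using v by (simp add: e_def algebra_simps)
  \<comment> \<open>The error terms of the two difference quotients bound \<open>\<mu> * N e\<close>.\<close>
  let ?F = "\<lambda>t. N ((1 / t) *\<^sub>R (S t u - u) - f) + N ((1 / t) *\<^sub>R (S t v - v) - A v)"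
  have "(?F \<longlongrightarrow> 0 + 0) (at_right 0)"
    using lim S_generator[OF v(1)] unfolding generator_limit_def by (rule tendsto_add)
  moreover have "\<forall>\<^sub>F t in at_right 0. \<mu> * N e \<le> ?F t"
    using eventually_at_right_less[of 0]
  proof eventually_elim
    case (elim t)
    let ?x = "(1 / t) *\<^sub>R (S t u - u) - f" and ?y = "(1 / t) *\<^sub>R (S t v - v) - A v"
    have "S t e - t *\<^sub>R (?x - ?y) = (S t u - S t v) - ((S t u - u) - (S t v - v)) + t *\<^sub>R (f - A v)"
      using elim u v by (simp add: e_def S_diff algebra_simps)
    also have "\<dots> = (1 + t * \<mu>) *\<^sub>R e"
      by (simp add: e_def algebra_simps flip: \<mu>e)
    finally have "(1 + t * \<mu>) * N e = N (S t e - t *\<^sub>R (?x - ?y))"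
      using elim \<mu>_pos e by (simp add: N_scale)
    also have "\<dots> \<le> N (S t e) + t * N (?x - ?y)"
      using N_triangle_minus[of "S t e" "t *\<^sub>R (?x - ?y)"] elim e u v f by (simp add: N_scale)
    also have "\<dots> \<le> N e + t * (N ?x + N ?y)"
      using S_contraction[of e t] N_triangle_minus[of ?x ?y] elim e u v f
      by (intro add_mono mult_left_mono) auto
    finally have "t * (\<mu> * N e) \<le> t * ?F t" by (simp add: algebra_simps)
    then show ?case using elim by simp
  qed
  ultimately have "\<mu> * N e \<le> 0" by (auto intro: tendsto_lowerbound)
  then have "N e = 0" using \<mu>_pos N_nonneg[OF e] by (simp add: mult_le_0_iff)
  then show ?thesis using N_eq_0[OF e] v by (simp add: e_def)
qed

end

section \<open>Generation modulo null elements\<close>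

text \<open>Representatives modulo null elements can be chosen linearly: extend a basis of the null space
  to a basis of \<open>V\<close>, and let \<open>P\<close> annihilate the former and fix the added vectors.\<close>

lemma (in semi_inner_space) linear_representatives:
  "\<exists>P. linear P \<and> (\<forall>u\<in>V. P u \<in> V \<and> N (P u - u) = 0 \<and> (N u = 0 \<longrightarrow> P u = 0))"
proof -
  define Z where "Z = {u \<in> V. N u = 0}"
  have Z: "subspace Z"
    unfolding subspace_def
  proof (intro conjI ballI allI)
    fix u v assume "u \<in> Z" "v \<in> Z"
    then show "u + v \<in> Z"
      using N_triangle[of u v] N_nonneg[of "u + v"] by (auto simp: Z_def simp del: N_nonneg)
  qed (auto simp: Z_def N_scale)
  obtain B\<^sub>0 where B\<^sub>0: "B\<^sub>0 \<subseteq> Z" "independent B\<^sub>0" "Z \<subseteq> span B\<^sub>0"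
    using maximal_independent_subset[of Z] by blast
  obtain B where B: "B\<^sub>0 \<subseteq> B" "B \<subseteq> V" "independent B" "V \<subseteq> span B"
    using maximal_independent_subset_extend[of B\<^sub>0 V] B\<^sub>0 unfolding Z_def by blast
  obtain P where P: "linear P" "\<And>b. b \<in> B \<Longrightarrow> P b = (if b \<in> B\<^sub>0 then 0 else b)"
    using linear_independent_extend[OF B(3), of "\<lambda>b. if b \<in> B\<^sub>0 then 0 else b"] by blast
  interpret P: linear P by (rule P(1))
  have "P u - u \<in> Z" if "u \<in> V" for u
  proof -
    have "u \<in> span B" using that B by blast
    then show ?thesis
    proof (induction rule: span_induct_alt)
      case base
      then show ?case using subspace_0[OF Z] by (simp add: P.zero)
    next
      case (step c b y)
      have "P b - b \<in> Z"
        using P(2)[OF step(1)] B\<^sub>0(1) subspace_0[OF Z] subspace_neg[OF Z] by auto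
      then have "c *\<^sub>R (P b - b) + (P y - y) \<in> Z"
        by (intro subspace_add[OF Z] subspace_scale[OF Z] step.IH)
      then show ?case by (simp add: P.add P.scale scaleR_diff_right add_diff_add)
    qed
  qed
  moreover have "P u = 0" if "u \<in> Z" for u
  proof -
    have "u \<in> span B\<^sub>0" using that B\<^sub>0 by blast
    then show ?thesis
    proof (induction rule: span_induct_alt)
      case (step c b y)
      then show ?case using P(2)[of b] B(1) by (simp add: P.add P.scale subset_iff)
    qed (simp add: P.zero)
  qed
  ultimately have "P u \<in> V \<and> N (P u - u) = 0 \<and> (N u = 0 \<longrightarrow> P u = 0)" if "u \<in> V" for u
    using that mem(2)[of "P u - u" u] by (auto simp: Z_def)
  then show ?thesis using P(1) by blast
qed

text \<open>The theorem of Lumer and Phillips for strictly dissipative operators. On the image of the linear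
  choice of representatives \<open>P\<close> the form is definite, and \<open>P \<circ> A\<close> is exactly linear there. The
  semigroup of that operator, precomposed with \<open>P\<close>, is generated by \<open>A\<close>.\<close>

theorem (in complete_semi_inner_space) generation:
  fixes D :: "'a set" and A :: "'a \<Rightarrow> 'a" and \<delta> \<mu> :: real
  assumes D: "subspace D" "D \<subseteq> V" and A_mem: "\<And>u. u \<in> D \<Longrightarrow> A u \<in> V"
    and A_add: "\<And>u v. \<lbrakk>u \<in> D; v \<in> D\<rbrakk> \<Longrightarrow> N (A (u + v) - (A u + A v)) = 0"
    and A_scale: "\<And>r u. u \<in> D \<Longrightarrow> N (A (r *\<^sub>R u) - r *\<^sub>R A u) = 0"
    and D_cong: "\<And>u v. \<lbrakk>u \<in> D; v \<in> V; N (u - v) = 0\<rbrakk> \<Longrightarrow> v \<in> D"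
    and A_null: "\<And>u. \<lbrakk>u \<in> D; N u = 0\<rbrakk> \<Longrightarrow> N (A u) = 0"
    and \<delta>: "\<delta> > 0" and \<mu>: "\<mu> > 0"
    and dissipative: "\<And>u. u \<in> D \<Longrightarrow> ip u (A u) \<le> - \<delta> * ip u u"
    and onto: "\<And>f. f \<in> V \<Longrightarrow> \<exists>u\<in>D. N (\<mu> *\<^sub>R u - A u - f) = 0"
  shows "\<exists>S. generates V ip D A S \<and> (\<forall>t\<ge>0. \<forall>u\<in>V. N (S t u) \<le> exp (- \<delta> * t) * N u)"
proof -
  obtain P where "linear P" and P: "\<And>u. u \<in> V \<Longrightarrow> P u \<in> V" "\<And>u. u \<in> V \<Longrightarrow> N (P u - u) = 0"
    "\<And>u. \<lbrakk>u \<in> V; N u = 0\<rbrakk> \<Longrightarrow> P u = 0"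
    using linear_representatives by blast
  interpret P: linear P by fact
  have P_eqI: "P u = P v" if "u \<in> V" "v \<in> V" "N (u - v) = 0" for u v
    using P(3)[of "u - v"] that by (simp add: P.diff)
  define V' where "V' = P ` V"
  have V': "V' \<subseteq> V" using P(1) by (auto simp: V'_def)
  have PV': "P u \<in> V'" if "u \<in> V" for u using that by (simp add: V'_def)
  have P_fix: "P u = u" if u: "u \<in> V'" for u
  proof -
    obtain v where v: "v \<in> V" "u = P v" using u by (auto simp: V'_def)
    show ?thesis unfolding v(2) by (rule P_eqI) (use P v(1) in auto)
  qed
  have NP: "N (P u) = N u" if "u \<in> V" for u
    using N_null_cong[of "P u" u] P that by blast
  define D' where "D' = D \<inter> V'"
  have PD: "P u \<in> D'" if "u \<in> D" for u
  proof -
    have "u \<in> V" using that D by blast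
    then have "N (u - P u) = 0" using P N_minus_commute by metis
    then show ?thesis using D_cong[OF that, of "P u"] P(1) PV' \<open>u \<in> V\<close> by (simp add: D'_def)
  qed
  have PAP: "P (A (P u)) = P (A u)" if u: "u \<in> D" for u
  proof -
    have mem: "u \<in> V" "P u \<in> D" using u D PD by (auto simp: D'_def)
    then have d: "P u - u \<in> D" using u D subspace_diff by blast
    have "P (A (u + (P u - u))) = P (A u + A (P u - u))"
    proof (rule P_eqI)
      show "A (u + (P u - u)) \<in> V" "A u + A (P u - u) \<in> V"
        using u d subspace_add[OF D(1) u d] A_mem by blast+
    qed (rule A_add[OF u d])
    moreover have "P (A (P u - u)) = 0"
      by (rule P(3)) (use A_mem A_null d P(2) mem in auto)
    ultimately show ?thesis by (simp add: P.add)
  qed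
  interpret R: strictly_m_dissipative V' ip D' "\<lambda>u. P (A u)" \<delta> \<mu>
  proof
    show "subspace V'" unfolding V'_def by (rule linear_subspace_image[OF \<open>linear P\<close> subspace_V])
    then show "subspace D'" unfolding D'_def using D by (intro subspace_inter)
    show "D' \<subseteq> V'" by (simp add: D'_def)
    show "u = 0" if "u \<in> V'" "ip u u = 0" for u
      using P(3)[of u] P_fix[of u] V' that by (auto simp: seminorm_of_def)
    show "P (A u) \<in> V'" if "u \<in> D'" for u using that A_mem PV' by (auto simp: D'_def)
    show "P (A (u + v)) = P (A u) + P (A v)" if "u \<in> D'" "v \<in> D'" for u v
      unfolding P.add[symmetric]
      by (rule P_eqI) (use that A_mem A_add subspace_add[OF D(1)] in \<open>auto simp: D'_def\<close>)
    show "P (A (r *\<^sub>R u)) = r *\<^sub>R P (A u)" if "u \<in> D'" for r u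
      unfolding P.scale[symmetric]
      by (rule P_eqI) (use that A_mem A_scale subspace_scale[OF D(1)] in \<open>auto simp: D'_def\<close>)
    show "ip u (P (A u)) \<le> - \<delta> * ip u u" if "u \<in> D'" for u
    proof -
      have u: "u \<in> D" "u \<in> V" "A u \<in> V" using that V' A_mem by (auto simp: D'_def)
      have "\<bar>ip u (P (A u) - A u)\<bar> \<le> 0"
        using Cauchy_Schwarz[of u "P (A u) - A u"] u P(1,2) by simp
      then show ?thesis using dissipative[OF u(1)] u P(1) by (simp add: ip_diff_right)
    qed
    show "\<exists>u\<in>D'. \<mu> *\<^sub>R u - P (A u) = f" if f: "f \<in> V'" for f
    proof -
      obtain u where u: "u \<in> D" "N (\<mu> *\<^sub>R u - A u - f) = 0" using onto f V' by blast
      have mem: "u \<in> V" "A u \<in> V" "f \<in> V" using u D A_mem f V' by auto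
      have "P (\<mu> *\<^sub>R u - A u) = P f" by (rule P_eqI) (use u mem in auto)
      then have "\<mu> *\<^sub>R P u - P (A (P u)) = f" using PAP[OF u(1)] P_fix[OF f] by (simp add: P.diff P.scale)
      then show ?thesis using PD[OF u(1)] by blast
    qed
    fix X :: "nat \<Rightarrow> 'a" assume X: "\<And>n. X n \<in> V'"
      and C: "\<And>e. e > 0 \<Longrightarrow> \<exists>M. \<forall>m\<ge>M. \<forall>n\<ge>M. N (X m - X n) < e"
    obtain x where x: "x \<in> V" "(\<lambda>n. N (X n - x)) \<longlonglongrightarrow> 0"
      using complete[of X] X C V' by blast
    have eq: "N (X n - P x) = N (X n - x)" for n
      using NP[of "X n - x"] P_fix[OF X, of n] X[of n] V' x(1) by (simp add: P.diff subset_iff)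
    show "\<exists>x\<in>V'. (\<lambda>n. N (X n - x)) \<longlonglongrightarrow> 0"
      by (rule bexI[of _ "P x"]) (simp_all add: eq x PV')
  qed (use V' \<delta> \<mu> ip_add_left ip_scale_left ip_commute ip_nonneg in \<open>auto simp: subset_iff\<close>)
  define S where "S t u = R.S t (P u)" for t u
  have RS_V: "R.S t u \<in> V" if "u \<in> V'" "0 \<le> t" for t u using R.S_mem[OF that] V' by blast
  have S_V: "S t u \<in> V" if "u \<in> V" "0 \<le> t" for t u
    unfolding S_def using RS_V PV' that by blast
  have N_diff_P: "N (x - u) = N (x - P u)" if "x \<in> V" "u \<in> V" for x u
    using that P N_minus_commute[of u "P u"] by (intro N_null_cong) (auto simp: algebra_simps)
  have lim_iff: "generator_limit ip S u f \<longleftrightarrow> generator_limit ip R.S (P u) (P f)"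
    if u: "u \<in> V" and f: "f \<in> V" for u f
  proof -
    have "\<forall>\<^sub>F t in at_right 0. N ((1 / t) *\<^sub>R (S t u - u) - f)
        = N ((1 / t) *\<^sub>R (R.S t (P u) - P u) - P f)"
      using eventually_at_right_less[of 0]
    proof eventually_elim
      case (elim t)
      have S: "R.S t (P u) \<in> V" "P (R.S t (P u)) = R.S t (P u)"
        using RS_V PV' u elim R.S_mem P_fix by auto
      have "N ((1 / t) *\<^sub>R (S t u - u) - f) = N (P ((1 / t) *\<^sub>R (S t u - u) - f))"
        using u f S by (intro NP[symmetric]) (auto simp: S_def)
      then show ?case using S by (simp add: P.diff P.scale S_def)
    qed
    then show ?thesis unfolding generator_limit_def by (rule tendsto_cong)
  qed
  have "generates V ip D A S"
    unfolding generates_def C0_semigroup_def bounded_operator_def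
  proof (intro conjI allI impI ballI)
    fix t :: real assume t: "0 \<le> t"
    show "S t u \<in> V" if "u \<in> V" for u using S_V that t by blast
    show "N (S t (u + v) - (S t u + S t v)) = 0" if "u \<in> V" "v \<in> V" for u v
      using that t by (simp add: S_def P.add R.S_add PV')
    show "N (S t (r *\<^sub>R u) - r *\<^sub>R S t u) = 0" if "u \<in> V" for r u
      using that t by (simp add: S_def P.scale R.S_scale PV')
    show "\<exists>K. \<forall>u\<in>V. N (S t u) \<le> K * N u"
      using R.S_contraction[OF PV' t] NP by (intro exI[of _ 1]) (simp add: S_def)
  next
    show "N (S 0 u - u) = 0" if "u \<in> V" for u
      using that P(2) by (simp add: S_def R.S_0 PV')
    show "N (S (s + t) u - S s (S t u)) = 0" if "0 \<le> s" "0 \<le> t" "u \<in> V" for s t u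
      using that by (simp add: S_def R.S_semigroup PV' P_fix R.S_mem)
    show "((\<lambda>t. N (S t u - u)) \<longlongrightarrow> 0) (at_right 0)" if u: "u \<in> V" for u
    proof (rule Lim_transform_eventually[OF R.S_continuous[OF PV'[OF u]]])
      show "\<forall>\<^sub>F t in at_right 0. N (R.S t (P u) - P u) = N (S t u - u)"
        using eventually_at_right_less[of 0]
        by eventually_elim (use N_diff_P S_V u in \<open>simp add: S_def\<close>)
    qed
  next
    have gen: "generator_limit ip S u (A u)" if u: "u \<in> D" for u
    proof -
      have "u \<in> V" "A u \<in> V" using u D A_mem by auto
      then show ?thesis using R.S_generator[OF PD[OF u]] lim_iff PAP[OF u] by simp
    qed
    show "D = {u \<in> V. \<exists>f\<in>V. generator_limit ip S u f}"
    proof (intro equalityI subsetI)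
      fix u assume "u \<in> D"
      then show "u \<in> {u \<in> V. \<exists>f\<in>V. generator_limit ip S u f}" using gen A_mem D by blast
    next
      fix u assume "u \<in> {u \<in> V. \<exists>f\<in>V. generator_limit ip S u f}"
      then obtain f where u: "u \<in> V" and "f \<in> V" "generator_limit ip S u f" by blast
      then have "P u \<in> D'" using R.generator_domain[of "P u" "P f"] PV' lim_iff by blast
      then show "u \<in> D" using D_cong[of "P u" u] P(2) u by (simp add: D'_def)
    qed
    show "A u \<in> V" "generator_limit ip S u (A u)" if "u \<in> D" for u using that A_mem gen by auto
  qed
  moreover have "N (S t u) \<le> exp (- \<delta> * t) * N u" if "0 \<le> t" "u \<in> V" for t u
    using R.S_decay[OF PV'[OF that(2)] that(1)] NP[OF that(2)] by (simp add: S_def)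
  ultimately show ?thesis by blast
qed

section \<open>Equivalent inner products and exponential stability\<close>

text \<open>Generation depends only on the topology, whereas dissipativity depends on the inner product.
  This permits to work with whichever inner product makes the operator dissipative.\<close>

lemma generates_equivalent_seminorm:
  assumes V: "subspace V"
    and nonneg: "\<And>u. u \<in> V \<Longrightarrow> 0 \<le> seminorm_of ip u" "\<And>u. u \<in> V \<Longrightarrow> 0 \<le> seminorm_of ip' u"
    and le: "\<And>u. u \<in> V \<Longrightarrow> seminorm_of ip u \<le> c * seminorm_of ip' u"
      "\<And>u. u \<in> V \<Longrightarrow> seminorm_of ip' u \<le> c * seminorm_of ip u"
    and c: "c > 0" and gen: "generates V ip D A S"
  shows "generates V ip' D A S"
proof -
  have null: "seminorm_of ip' u = 0" if "u \<in> V" "seminorm_of ip u = 0" for u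
    using le(2)[OF that(1)] nonneg(2)[OF that(1)] that(2) by simp
  have lim: "(f \<longlongrightarrow> 0) F" if "(g \<longlongrightarrow> 0) F" "\<forall>\<^sub>F x in F. 0 \<le> f x \<and> f x \<le> c * g x"
    for f g :: "real \<Rightarrow> real" and F
    using that tendsto_mult_right_zero[OF that(1), of c]
    by (intro Lim_null_comparison[of f "\<lambda>x. c * g x"]) (auto elim!: eventually_mono)
  have S_mem: "S t u \<in> V" if "0 \<le> t" "u \<in> V" for t u
    using gen that by (auto simp: generates_def C0_semigroup_def bounded_operator_def)
  have mem: "(1 / t) *\<^sub>R (S t u - u) - f \<in> V" if "0 < t" "u \<in> V" "f \<in> V" for t u f
    using that V S_mem[of t u] by (auto intro!: subspace_diff subspace_scale)
  have diff: "S t u - u \<in> V" if "0 < t" "u \<in> V" for t u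
    using that V S_mem[of t u] by (auto intro!: subspace_diff)
  have gl: "generator_limit ip S u f \<longleftrightarrow> generator_limit ip' S u f" if "u \<in> V" "f \<in> V" for u f
  proof
    have ev: "\<forall>\<^sub>F t in at_right 0. (1 / t) *\<^sub>R (S t u - u) - f \<in> V"
      using eventually_at_right_less[of 0] by eventually_elim (use mem that in auto)
    show "generator_limit ip S u f" if "generator_limit ip' S u f"
      using that unfolding generator_limit_def
      by (rule lim) (use ev nonneg le in \<open>auto elim!: eventually_mono\<close>)
    show "generator_limit ip' S u f" if "generator_limit ip S u f"
      using that unfolding generator_limit_def
      by (rule lim) (use ev nonneg le in \<open>auto elim!: eventually_mono\<close>)
  qed
  have bdd: "bounded_operator V ip' T" if T: "bounded_operator V ip T" for T
  proof -
    obtain K where K: "\<And>u. u \<in> V \<Longrightarrow> seminorm_of ip (T u) \<le> K * seminorm_of ip u"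
      and TV: "\<And>u. u \<in> V \<Longrightarrow> T u \<in> V"
      using T unfolding bounded_operator_def by meson
    have "seminorm_of ip' (T u) \<le> (c * \<bar>K\<bar> * c) * seminorm_of ip' u" if u: "u \<in> V" for u
    proof -
      have "seminorm_of ip' (T u) \<le> c * seminorm_of ip (T u)" using le TV u by blast
      also have "\<dots> \<le> c * (\<bar>K\<bar> * seminorm_of ip u)"
        using c order_trans[OF K[OF u] mult_right_mono[OF abs_ge_self nonneg(1)[OF u]]]
        by (intro mult_left_mono) auto
      also have "\<dots> \<le> c * (\<bar>K\<bar> * (c * seminorm_of ip' u))"
        using c le(1)[OF u] by (intro mult_left_mono) auto
      finally show ?thesis by (simp add: mult_ac)
    qed
    moreover have "T (u + v) - (T u + T v) \<in> V" if "u \<in> V" "v \<in> V" for u v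
      using that TV V by (simp add: subspace_diff subspace_add)
    moreover have "T (r *\<^sub>R u) - r *\<^sub>R T u \<in> V" if "u \<in> V" for r u
      using that TV V by (simp add: subspace_diff subspace_scale)
    ultimately show ?thesis
      using T null unfolding bounded_operator_def by blast
  qed
  have "C0_semigroup V ip' S"
    unfolding C0_semigroup_def
  proof (intro conjI allI ballI impI)
    have C0: "C0_semigroup V ip S" using gen by (simp add: generates_def)
    show "bounded_operator V ip' (S t)" if "0 \<le> t" for t
      using C0 bdd that by (simp add: C0_semigroup_def)
    show "seminorm_of ip' (S 0 u - u) = 0" if "u \<in> V" for u
      using C0 that S_mem[of 0 u] by (intro null subspace_diff[OF V]) (auto simp: C0_semigroup_def)
    show "seminorm_of ip' (S (s + t) u - S s (S t u)) = 0" if "0 \<le> s" "0 \<le> t" "u \<in> V" for s t u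
      using C0 that S_mem by (intro null subspace_diff[OF V]) (auto simp: C0_semigroup_def)
    show "((\<lambda>t. seminorm_of ip' (S t u - u)) \<longlongrightarrow> 0) (at_right 0)" if u: "u \<in> V" for u
    proof (rule lim)
      show "((\<lambda>t. seminorm_of ip (S t u - u)) \<longlongrightarrow> 0) (at_right 0)"
        using C0 u by (simp add: C0_semigroup_def)
      show "\<forall>\<^sub>F t in at_right 0. 0 \<le> seminorm_of ip' (S t u - u)
          \<and> seminorm_of ip' (S t u - u) \<le> c * seminorm_of ip (S t u - u)"
        using eventually_at_right_less[of 0] by eventually_elim (use diff u nonneg le in auto)
    qed
  qed
  moreover have "D \<subseteq> V" using gen by (auto simp: generates_def)
  ultimately show ?thesis
    using gen gl unfolding generates_def by (auto simp: subset_iff)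
qed

lemma complete_of_equivalent_seminorm:
  assumes ip: "semi_inner_space V ip" and ip': "semi_inner_space V ip'"
    and le: "\<And>u. u \<in> V \<Longrightarrow> seminorm_of ip u \<le> c * seminorm_of ip' u"
      "\<And>u. u \<in> V \<Longrightarrow> seminorm_of ip' u \<le> c * seminorm_of ip u" and c: "c > 0"
    and complete: "\<And>X. \<lbrakk>\<And>n. X n \<in> V; \<And>e. e > 0 \<Longrightarrow> \<exists>M. \<forall>m\<ge>M. \<forall>n\<ge>M. seminorm_of ip' (X m - X n) < e\<rbrakk>
       \<Longrightarrow> \<exists>x\<in>V. (\<lambda>n. seminorm_of ip' (X n - x)) \<longlonglongrightarrow> 0"
  shows "complete_semi_inner_space V ip"
proof -
  interpret semi_inner_space V ip by (rule ip)
  interpret I': semi_inner_space V ip' by (rule ip')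
  show ?thesis
  proof
    fix X :: "nat \<Rightarrow> 'a"
    assume X: "\<And>n. X n \<in> V"
      and C: "\<And>e. e > 0 \<Longrightarrow> \<exists>M. \<forall>m\<ge>M. \<forall>n\<ge>M. seminorm_of ip (X m - X n) < e"
    have "\<exists>M. \<forall>m\<ge>M. \<forall>n\<ge>M. seminorm_of ip' (X m - X n) < e" if e: "e > 0" for e
    proof -
      obtain M where M: "\<forall>m\<ge>M. \<forall>n\<ge>M. seminorm_of ip (X m - X n) < e / c"
        using C[of "e / c"] e c by auto
      have "seminorm_of ip' (X m - X n) < e" if "M \<le> m" "M \<le> n" for m n
      proof -
        have "seminorm_of ip' (X m - X n) \<le> c * seminorm_of ip (X m - X n)" using le(2) X by blast
        also have "\<dots> < e" using M that c by (simp add: pos_less_divide_eq mult.commute)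
        finally show ?thesis .
      qed
      then show ?thesis by blast
    qed
    then obtain x where x: "x \<in> V" "(\<lambda>n. seminorm_of ip' (X n - x)) \<longlonglongrightarrow> 0"
      using complete[of X] X by blast
    have "(\<lambda>n. seminorm_of ip (X n - x)) \<longlonglongrightarrow> 0"
    proof (rule Lim_null_comparison)
      show "\<forall>\<^sub>F n in sequentially. norm (seminorm_of ip (X n - x)) \<le> c * seminorm_of ip' (X n - x)"
        using le(1) X x(1) by (intro always_eventually allI) simp
      show "(\<lambda>n. c * seminorm_of ip' (X n - x)) \<longlonglongrightarrow> 0" using tendsto_mult_right_zero[OF x(2)] .
    qed
    then show "\<exists>x\<in>V. (\<lambda>n. seminorm_of ip (X n - x)) \<longlonglongrightarrow> 0" using x(1) by blast
  qed
qed

lemma seminorm_le_of_ip_le: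
  assumes "ip u u \<le> C * ip' u u" 
  shows "seminorm_of ip u \<le> sqrt C * seminorm_of ip' u"
  using assms by (simp add: seminorm_of_def real_sqrt_mult[symmetric])

lemma exponentially_stableI:
  assumes "0 \<in> V" "seminorm_of ip 0 \<le> 1" "C \<ge> 1" "\<omega> > 0"
    and bound: "\<And>t u. \<lbrakk>0 \<le> t; u \<in> V\<rbrakk> \<Longrightarrow> seminorm_of ip (S t u) \<le> C * exp (- \<omega> * t) * seminorm_of ip u"
  shows "exponentially_stable V ip S"
  unfolding exponentially_stable_def
proof (intro exI conjI allI impI)
  fix t :: real assume t: "0 \<le> t"
  show "operator_norm V ip (S t) \<le> C * exp (- \<omega> * t)"
    unfolding operator_norm_def
  proof (rule cSUP_least)
    show "{u \<in> V. seminorm_of ip u \<le> 1} \<noteq> {}" using assms by blast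
    fix u assume u: "u \<in> {u \<in> V. seminorm_of ip u \<le> 1}"
    then have "seminorm_of ip (S t u) \<le> C * exp (- \<omega> * t) * seminorm_of ip u" using bound t by blast
    also have "\<dots> \<le> C * exp (- \<omega> * t) * 1" using u assms by (intro mult_left_mono) auto
    finally show "seminorm_of ip (S t u) \<le> C * exp (- \<omega> * t)" by simp
  qed
qed (use assms in auto)

section \<open>Smooth functions with compact support\<close>

definition smooth :: "(real \<Rightarrow> real) \<Rightarrow> bool" where
  "smooth f \<longleftrightarrow> (\<forall>k x. ((deriv ^^ k) f) field_differentiable (at x))"

text \<open>Smoothness is a greatest fixed point: membership in any class that is closed under
  differentiation suffices.\<close>

lemma smooth_coinduct:
  assumes "f \<in> F" and F: "\<And>f. f \<in> F \<Longrightarrow> \<exists>g\<in>F. \<forall>x. (f has_real_derivative g x) (at x)"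
  shows "smooth f"
proof -
  have "(deriv ^^ k) f \<in> F" for k
  proof (induction k)
    case (Suc k)
    obtain g where g: "g \<in> F" "\<And>x. ((deriv ^^ k) f has_real_derivative g x) (at x)"
      using F[OF Suc] by blast
    have "deriv ((deriv ^^ k) f) = g" using DERIV_imp_deriv[OF g(2)] by blast
    then show ?case using g(1) by simp
  qed (use assms in simp)
  then show ?thesis unfolding smooth_def field_differentiable_def using F by blast
qed

lemma smooth_has_derivative: "smooth f \<Longrightarrow> (f has_real_derivative deriv f x) (at x)"
  by (auto simp: smooth_def field_differentiable_derivI dest: spec[of _ 0])

lemma smooth_deriv: "smooth f \<Longrightarrow> smooth (deriv f)"
  unfolding smooth_def by (metis funpow_Suc_right comp_apply)

lemma smooth_continuous_on: "smooth f \<Longrightarrow> continuous_on S f"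
  by (meson DERIV_isCont continuous_at_imp_continuous_on smooth_has_derivative)

lemma smooth_antiderivative:
  assumes "smooth g" "\<And>x. (f has_real_derivative g x) (at x)"
  shows "smooth f"
  by (rule smooth_coinduct[where F = "insert f {g. smooth g}"])
     (use assms smooth_has_derivative smooth_deriv in blast)+

lemma smooth_linear_combination:
  assumes "smooth f" "smooth g"
  shows "smooth (\<lambda>x. c * f x + d * g x)"
proof (rule smooth_coinduct[where F = "{\<lambda>x. c * f x + d * g x | f g. smooth f \<and> smooth g}"])
  fix h assume "h \<in> {\<lambda>x. c * f x + d * g x | f g. smooth f \<and> smooth g}"
  then obtain f g where h: "h = (\<lambda>x. c * f x + d * g x)" "smooth f" "smooth g" by blast
  have "(h has_real_derivative c * deriv f x + d * deriv g x) (at x)" for x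
    unfolding h(1) by (intro DERIV_add DERIV_cmult smooth_has_derivative h)
  moreover have "(\<lambda>x. c * deriv f x + d * deriv g x) \<in> {\<lambda>x. c * f x + d * g x | f g. smooth f \<and> smooth g}"
    using h(2,3) smooth_deriv by blast
  ultimately show "\<exists>g\<in>{\<lambda>x. c * f x + d * g x | f g. smooth f \<and> smooth g}. \<forall>x. (h has_real_derivative g x) (at x)"
    by (rule_tac bexI) auto
qed (use assms in blast)

lemma smooth_affine:
  assumes "smooth f"
  shows "smooth (\<lambda>x. f (c * x + d))"
proof (rule smooth_coinduct[where F = "{\<lambda>x. k * f (c * x + d) | k f. smooth f}"])
  show "(\<lambda>x. f (c * x + d)) \<in> {\<lambda>x. k * f (c * x + d) | k f. smooth f}"
    using assms by (intro CollectI exI[of _ 1] exI[of _ f]) simp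
  fix h assume "h \<in> {\<lambda>x. k * f (c * x + d) | k f. smooth f}"
  then obtain k f where h: "h = (\<lambda>x. k * f (c * x + d))" "smooth f" by blast
  have "(h has_real_derivative (k * c) * deriv f (c * x + d)) (at x)" for x
  proof -
    have "((\<lambda>x. f (c * x + d)) has_real_derivative deriv f (c * x + d) * c) (at x)"
      by (rule DERIV_chain2[OF smooth_has_derivative[OF h(2)]]) (auto intro!: derivative_eq_intros)
    then show ?thesis unfolding h(1) by (auto intro!: derivative_eq_intros)
  qed
  moreover have "(\<lambda>x. (k * c) * deriv f (c * x + d)) \<in> {\<lambda>x. k * f (c * x + d) | k f. smooth f}"
    using h(2) smooth_deriv by blast
  ultimately show "\<exists>g\<in>{\<lambda>x. k * f (c * x + d) | k f. smooth f}. \<forall>x. (h has_real_derivative g x) (at x)"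
    by (rule_tac bexI) auto
qed

text \<open>The model of a function that vanishes to infinite order at \<open>0\<close>. The powers in the denominator
  are those that differentiation of \<open>exp (- 1 / q)\<close> produces.\<close>

definition flat :: "nat \<Rightarrow> real \<Rightarrow> real" where
  "flat m q = (if q > 0 then exp (- (1 / q)) / q ^ m else 0)"

lemma flat_tendsto_0: "(flat m \<longlongrightarrow> 0) (at 0)"
proof (rule filterlim_split_at_real)
  have "((\<lambda>q. inverse q ^ m / exp (inverse q)) \<longlongrightarrow> (0::real)) (at_right 0)"
    by (rule filterlim_compose[OF tendsto_power_div_exp_0 filterlim_inverse_at_top_right])
  then show "(flat m \<longlongrightarrow> 0) (at_right 0)"
  proof (rule Lim_transform_eventually)
    show "\<forall>\<^sub>F q in at_right 0. inverse q ^ m / exp (inverse q) = flat m q"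
      using eventually_at_right_less[of 0]
      by eventually_elim (simp add: flat_def exp_minus field_simps)
  qed
  have "\<forall>\<^sub>F q in at_left 0. flat m q = 0"
    by (auto simp: eventually_at_left_field flat_def intro!: exI[of _ "-1"])
  then show "(flat m \<longlongrightarrow> 0) (at_left 0)" by (rule tendsto_eventually)
qed

lemma flat_derivative: "(flat m has_real_derivative flat (m + 2) q - real m * flat (m + 1) q) (at q)"
proof -
  consider "q > 0" | "q < 0" | "q = 0" by linarith
  then show ?thesis
  proof cases
    case 1
    have "((\<lambda>q. exp (- (1 / q)) / q ^ m) has_real_derivative flat (m + 2) q - real m * flat (m + 1) q) (at q)"
    proof (cases m)
      case 0
      then show ?thesis using 1
        by (auto intro!: derivative_eq_intros simp: flat_def power2_eq_square)
    next
      case (Suc k)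
      then show ?thesis using 1
        by (auto intro!: derivative_eq_intros simp: flat_def)
           (cases k; simp add: field_simps)
    qed
    then show ?thesis
      by (rule has_field_derivative_transform_within_open[where S = "{0<..}"]) (use 1 in \<open>auto simp: flat_def\<close>)
  next
    case 2
    have "((\<lambda>q. 0) has_real_derivative flat (m + 2) q - real m * flat (m + 1) q) (at q)"
      using 2 by (auto simp: flat_def)
    then show ?thesis
      by (rule has_field_derivative_transform_within_open[where S = "{..<0}"]) (use 2 in \<open>auto simp: flat_def\<close>)
  next
    case 3
    have "(\<lambda>h. (flat m (0 + h) - flat m 0) / h) = flat (m + 1)"
      by (auto simp: flat_def fun_eq_iff)
    then show ?thesis using flat_tendsto_0[of "m + 1"] 3 by (simp add: DERIV_def flat_def)
  qed
qed

text \<open>A class of functions vanishing outside \<open>[0, 1]\<close> that is closed under differentiation, because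
  the derivative of \<open>flat m\<close> is a combination of \<open>flat (m + 1)\<close> and \<open>flat (m + 2)\<close>.\<close>

inductive_set flat_combinations :: "(real \<Rightarrow> real) set" where
  base: "(\<lambda>x. poly p x * flat m (x * (1 - x))) \<in> flat_combinations"
| add: "\<lbrakk>f \<in> flat_combinations; g \<in> flat_combinations\<rbrakk> \<Longrightarrow> (\<lambda>x. f x + g x) \<in> flat_combinations"

lemma flat_combinations_derivative:
  "f \<in> flat_combinations \<Longrightarrow> \<exists>g\<in>flat_combinations. \<forall>x. (f has_real_derivative g x) (at x)"
proof (induction rule: flat_combinations.induct)
  case (base p m)
  let ?q = "\<lambda>x::real. x * (1 - x)"
  let ?g = "\<lambda>x. poly (pderiv p) x * flat m (?q x)
     + (poly (p * [:1, -2:]) x * flat (m + 2) (?q x)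
        + poly (smult (- real m) (p * [:1, -2:])) x * flat (m + 1) (?q x))"
  have "((\<lambda>x. poly p x * flat m (?q x)) has_real_derivative ?g x) (at x)" for x
  proof -
    have "((\<lambda>x. flat m (?q x)) has_real_derivative
        (flat (m + 2) (?q x) - real m * flat (m + 1) (?q x)) * (1 - 2 * x)) (at x)"
      by (rule DERIV_chain2[OF flat_derivative]) (auto intro!: derivative_eq_intros)
    from DERIV_mult[OF poly_DERIV[of p x] this]
    show ?thesis by (rule DERIV_cong) (simp add: algebra_simps)
  qed
  moreover have "?g \<in> flat_combinations"
    by (intro flat_combinations.intros)
  ultimately show ?case by (rule_tac bexI) auto
next
  case (add f g)
  then obtain f' g' where "f' \<in> flat_combinations" "g' \<in> flat_combinations"
    "\<And>x. (f has_real_derivative f' x) (at x)" "\<And>x. (g has_real_derivative g' x) (at x)" by blast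
  then show ?case
    by (intro bexI[of _ "\<lambda>x. f' x + g' x"]) (auto intro!: DERIV_add flat_combinations.add)
qed

definition bump :: "real \<Rightarrow> real" where "bump x = flat 0 (x * (1 - x))"

lemma smooth_bump: "smooth bump"
proof (rule smooth_coinduct[OF _ flat_combinations_derivative])
  have "(\<lambda>x. poly 1 x * flat 0 (x * (1 - x))) \<in> flat_combinations" by (rule base)
  then show "bump \<in> flat_combinations" by (simp add: bump_def[abs_def])
qed

lemma bump_pos: "x \<in> {0<..<1} \<Longrightarrow> 0 < bump x" 
  by (simp add: bump_def flat_def)

lemma bump_nonneg: "0 \<le> bump x"
  by (simp add: bump_def flat_def)

lemma bump_eq_0: "x \<notin> {0<..<1} \<Longrightarrow> bump x = 0"
  by (auto simp: bump_def flat_def zero_less_mult_iff)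

text \<open>If \<open>g\<close> has mean zero, the primitive has compact support too. This is how mean-zero functions
  arise as derivatives of test functions.\<close>

lemma smooth_primitive_compact_support:
  assumes g: "smooth g" and supp: "\<And>x. x \<notin> {p<..<q} \<Longrightarrow> g x = 0" and pq: "p \<le> q"
  obtains G where "smooth G" "\<And>x. (G has_real_derivative g x) (at x)"
    "\<And>x. x \<le> p \<Longrightarrow> G x = 0" "\<And>x. q \<le> x \<Longrightarrow> G x = integral {p..q} g"
proof -
  obtain G0 where G0: "\<And>x. (G0 has_real_derivative g x) (at x)"
  proof -
    have "isCont g x" for x using DERIV_isCont[OF smooth_has_derivative[OF g]] .
    then have "\<exists>F. \<forall>x::real. -\<infinity> < ereal x \<longrightarrow> ereal x < \<infinity> \<longrightarrow> (F has_vector_derivative g x) (at x)"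
      by (intro einterval_antiderivative) auto
    then show ?thesis using that by (auto simp: has_real_derivative_iff_has_vector_derivative)
  qed
  have const: "G0 x = G0 y" if S: "convex S" "x \<in> S" "y \<in> S" "\<And>z. z \<in> S \<Longrightarrow> z \<notin> {p<..<q}" for S x y
  proof -
    have "\<exists>c. \<forall>x\<in>S. G0 x = c"
    proof (rule has_field_derivative_zero_constant[OF S(1)])
      fix z assume "z \<in> S"
      then show "(G0 has_real_derivative 0) (at z within S)"
        using DERIV_subset[OF G0[of z], of S] supp[OF S(4)] by simp
    qed
    then show ?thesis using S(2,3) by auto
  qed
  let ?G = "\<lambda>x. G0 x - G0 p"
  have d: "(?G has_real_derivative g x) (at x)" for x
    using DERIV_diff[OF G0[of x] DERIV_const] by simp
  have "(g has_integral G0 q - G0 p) {p..q}"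
    by (rule fundamental_theorem_of_calculus[OF pq])
       (use G0 has_vector_derivative_at_within in \<open>auto simp flip: has_real_derivative_iff_has_vector_derivative intro: DERIV_subset\<close>)
  then have int: "integral {p..q} g = G0 q - G0 p" by (rule integral_unique)
  show ?thesis
  proof (rule that[of ?G])
    show "smooth ?G" by (rule smooth_antiderivative[OF g d])
    show "?G x = 0" if "x \<le> p" for x using const[of "{..p}" x p] that by auto
    show "?G x = integral {p..q} g" if "q \<le> x" for x using const[of "{q..}" x q] that int by auto
  qed (rule d)
qed

lemma smooth_step_exists:
  obtains s where "smooth s" "\<And>x. x \<le> 0 \<Longrightarrow> s x = 0" "\<And>x. 1 \<le> x \<Longrightarrow> s x = (1::real)"
    "\<And>x. 0 \<le> s x" "\<And>x. s x \<le> 1"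
proof -
  obtain G where G: "smooth G" "\<And>x. (G has_real_derivative bump x) (at x)"
    "\<And>x. x \<le> 0 \<Longrightarrow> G x = 0" "\<And>x. 1 \<le> x \<Longrightarrow> G x = integral {0..1} bump"
    using smooth_primitive_compact_support[OF smooth_bump, of 0 1] bump_eq_0 by auto
  have mono: "G x \<le> G y" if "x \<le> y" for x y
    using DERIV_nonneg_imp_nondecreasing[OF that, of G] G(2) bump_nonneg by blast
  have "G 0 < G 1"
    by (rule DERIV_pos_imp_increasing_open[of 0 1 G])
       (use G(2) bump_pos smooth_continuous_on[OF G(1)] in \<open>auto\<close>)
  then have pos: "G 1 > 0" using G(3)[of 0] by simp
  show ?thesis
  \<comment> \<open>The second summand only gives the shape of \<open>smooth_linear_combination\<close>.\<close>
  proof (rule that[of "\<lambda>x. (1 / G 1) * G x + 0 * G x"])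
    show "smooth (\<lambda>x. (1 / G 1) * G x + 0 * G x)"
      by (rule smooth_linear_combination[OF G(1) G(1)])
    show "(1 / G 1) * G x + 0 * G x = 0" if "x \<le> 0" for x using G(3) that by simp
    show "(1 / G 1) * G x + 0 * G x = 1" if "1 \<le> x" for x using G(4)[of x] G(4)[of 1] that pos by simp
    show "0 \<le> (1 / G 1) * G x + 0 * G x" for x
      using mono[of 0 x] G(3) pos by (cases "x \<le> 0") auto
    show "(1 / G 1) * G x + 0 * G x \<le> 1" for x
      using mono[of x 1] G(4)[of x] G(4)[of 1] pos by (cases "x \<le> 1") auto
  qed
qed

lemma test_functionI:
  assumes "smooth \<phi>" "a < p" "q < b" "\<And>x. x \<notin> {p<..<q} \<Longrightarrow> \<phi> x = 0"
  shows "test_function a b \<phi>"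
proof -
  have sub: "closure {x. \<phi> x \<noteq> 0} \<subseteq> {p..q}"
    using closure_minimal[of "{x. \<phi> x \<noteq> 0}" "{p..q}"] assms(4) by force
  then have "compact (closure {x. \<phi> x \<noteq> 0})"
    by (meson bounded_closed_interval bounded_subset closed_closure compact_eq_bounded_closed)
  then show ?thesis
    using sub assms by (force simp: test_function_def smooth_def)
qed

text \<open>For a smooth step \<open>s\<close> from \<open>0\<close> to \<open>1\<close> on \<open>[0, 1]\<close>, the function
  \<open>s (c (x - p)) - s (1 - c (q - x))\<close> rises just to the right of \<open>p\<close> and falls just to the left of
  \<open>q\<close>, both within the distance \<open>1 / c\<close>. Only differences and affine changes of variable of one
  smooth function are involved.\<close>

lemma smooth_approximations_of_interval:
  fixes p q :: real
  assumes "p < q"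
  obtains \<psi> :: "nat \<Rightarrow> real \<Rightarrow> real" where
    "\<And>n. smooth (\<psi> n)" "\<And>n x. x \<notin> {p<..<q} \<Longrightarrow> \<psi> n x = 0" "\<And>n x. \<bar>\<psi> n x\<bar> \<le> 1"
    "\<And>x. (\<lambda>n. \<psi> n x) \<longlonglongrightarrow> indicator {p<..<q} x"
proof -
  obtain s where s: "smooth s" "\<And>x. x \<le> 0 \<Longrightarrow> s x = 0" "\<And>x. 1 \<le> x \<Longrightarrow> s x = (1::real)"
    "\<And>x. 0 \<le> s x" "\<And>x. s x \<le> 1"
    using smooth_step_exists by blast
  obtain k :: nat where k: "1 / (q - p) < real k" using reals_Archimedean2 by blast
  \<comment> \<open>The offset \<open>k\<close> makes the transitions narrower than \<open>q - p\<close> for every \<open>n\<close>, so that both stay inside \<open>[p, q]\<close>.\<close>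
  define c where "c n = real (n + k)" for n
  have ck: "1 / (q - p) < c n" for n using k by (simp add: c_def)
  have c: "1 < c n * (q - p)" for n
    using ck[of n] assms by (simp add: field_simps)
  have c0: "0 < c n" for n using c[of n] assms by (smt (verit) mult_nonpos_nonneg)
  have c_lim: "\<exists>m. \<forall>n\<ge>m. 1 \<le> c n * y" if "y > 0" for y
  proof -
    obtain m :: nat where "1 / y < real m" using reals_Archimedean2 by blast
    then have "1 / y \<le> c n" if "n \<ge> m" for n using that by (simp add: c_def)
    then show ?thesis using that by (auto simp: field_simps)
  qed
  define \<psi> where "\<psi> n x = 1 * s (c n * x + (- c n * p)) + (- 1) * s (c n * x + (1 - c n * q))" for n x
  have \<psi>: "\<psi> n x = s (c n * (x - p)) - s (1 - c n * (q - x))" for n x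
    by (simp add: \<psi>_def algebra_simps)
  show ?thesis
  proof (rule that[of \<psi>])
    show "smooth (\<psi> n)" for n
      unfolding \<psi>_def[abs_def] by (intro smooth_linear_combination smooth_affine s)
    show zero: "\<psi> n x = 0" if x: "x \<notin> {p<..<q}" for n x
    proof (cases "x \<le> p")
      case True
      have "c n * (q - p) \<le> c n * (q - x)" using True c0[of n] by simp
      then have "1 - c n * (q - x) \<le> 0" using c[of n] by simp
      moreover have "c n * (x - p) \<le> 0" using True c0[of n] by (simp add: mult_nonneg_nonpos)
      ultimately show ?thesis unfolding \<psi> by (simp add: s)
    next
      case False
      then have "q \<le> x" using x by auto
      then have "c n * (q - p) \<le> c n * (x - p)" "c n * (q - x) \<le> 0"
        using c0[of n] by (auto simp: mult_nonneg_nonpos)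
      then have "1 \<le> c n * (x - p)" "1 \<le> 1 - c n * (q - x)" using c[of n] by auto
      then show ?thesis unfolding \<psi> by (simp add: s)
    qed
    show "\<bar>\<psi> n x\<bar> \<le> 1" for n x unfolding \<psi> using s(4,5) by (smt (verit))
    show "(\<lambda>n. \<psi> n x) \<longlonglongrightarrow> indicator {p<..<q} x" for x
    proof (cases "x \<in> {p<..<q}")
      case True
      obtain m1 m2 where "\<forall>n\<ge>m1. 1 \<le> c n * (x - p)" "\<forall>n\<ge>m2. 1 \<le> c n * (q - x)"
        using c_lim[of "x - p"] c_lim[of "q - x"] True by auto
      then have "\<psi> n x = 1" if "n \<ge> max m1 m2" for n
        using that by (simp add: \<psi> s)
      then have "\<forall>\<^sub>F n in sequentially. \<psi> n x = indicator {p<..<q} x"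
        using True unfolding eventually_sequentially by (intro exI[of _ "max m1 m2"]) simp
      then show ?thesis by (rule tendsto_eventually)
    qed (use zero in auto)
  qed
qed

section \<open>Absolutely continuous functions\<close>

lemma integrable_leb_iff: 
  fixes f :: "real \<Rightarrow> 'b::euclidean_space"
  shows "integrable (leb a b) f \<longleftrightarrow> f absolutely_integrable_on {a..b}"
proof -
  have "integrable (leb a b) f \<longleftrightarrow> f absolutely_integrable_on {a<..<b}"
    by (simp add: set_integrable_def integrable_restrict_space)
  then show ?thesis by (simp add: absolutely_integrable_on_Icc_iff_Ioo)
qed

lemma LINT_leb_eq_integral:
  fixes f :: "real \<Rightarrow> 'b::euclidean_space"
  assumes "integrable (leb a b) f"
  shows "(LINT x|leb a b. f x) = integral {a..b} f"
  using lebesgue_integral_eq_integral[OF assms] by (simp add: integral_open_interval_real)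

text \<open>By Henstock's lemma, the sum of the norms of \<open>content k f x - integral k f\<close> over a fine tagged
  division is small. The integrals vanish, so what is small is a Riemann sum of the norm of \<open>f\<close>.\<close>

lemma norm_integral_zero_of_interval_integrals_zero:
  fixes f :: "real \<Rightarrow> 'b::euclidean_space"
  assumes f: "f integrable_on {a..b}"
    and zero: "\<And>p q. \<lbrakk>a \<le> p; p \<le> q; q \<le> b\<rbrakk> \<Longrightarrow> integral {p..q} f = 0"
  shows "((\<lambda>x. norm (f x)) has_integral 0) {a..b}"
proof -
  have "((\<lambda>x. norm (f x)) has_integral 0) (cbox a b)"
    unfolding has_integral
  proof (intro allI impI)
    fix e :: real assume e: "e > 0"
    obtain \<gamma> where \<gamma>: "gauge \<gamma>"
      and small: "\<And>p. \<lbrakk>p tagged_partial_division_of cbox a b; \<gamma> fine p\<rbrakk> \<Longrightarrow>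
        (\<Sum>(x, k)\<in>p. norm (measure lborel k *\<^sub>R f x - integral k f)) < e"
      using Henstock_lemma[of f a b e] f e by auto
    have "norm ((\<Sum>(x, k)\<in>\<D>. measure lborel k *\<^sub>R norm (f x)) - 0) < e"
      if \<D>: "\<D> tagged_division_of cbox a b" "\<gamma> fine \<D>" for \<D>
    proof -
      have "(\<Sum>(x, k)\<in>\<D>. measure lborel k *\<^sub>R norm (f x)) = (\<Sum>(x, k)\<in>\<D>. norm (measure lborel k *\<^sub>R f x - integral k f))"
      proof (rule sum.cong[OF refl])
        fix xk assume "xk \<in> \<D>"
        then obtain x k where xk: "xk = (x, k)" "(x, k) \<in> \<D>" by (cases xk) auto
        obtain p q where k: "k = cbox p q" using tagged_division_ofD(4)[OF \<D>(1) xk(2)] by blast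
        have "cbox p q \<subseteq> cbox a b" "x \<in> cbox p q"
          using tagged_division_ofD(2,3)[OF \<D>(1) xk(2)] k by auto
        then have "a \<le> p" "p \<le> q" "q \<le> b" by auto
        then have "integral k f = 0" using zero k by simp
        then show "(case xk of (x, k) \<Rightarrow> measure lborel k *\<^sub>R norm (f x))
            = (case xk of (x, k) \<Rightarrow> norm (measure lborel k *\<^sub>R f x - integral k f))"
          by (simp add: xk)
      qed
      also have "\<dots> < e"
        using \<D> unfolding tagged_division_of_def by (intro small) blast+
      finally have "(\<Sum>(x, k)\<in>\<D>. measure lborel k *\<^sub>R norm (f x)) < e" .
      moreover have "0 \<le> (\<Sum>(x, k)\<in>\<D>. measure lborel k *\<^sub>R norm (f x))"
        by (rule sum_nonneg) auto
      ultimately show ?thesis by simp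
    qed
    then show "\<exists>\<gamma>. gauge \<gamma> \<and> (\<forall>\<D>. \<D> tagged_division_of cbox a b \<and> \<gamma> fine \<D> \<longrightarrow>
        norm ((\<Sum>(x, k)\<in>\<D>. measure lborel k *\<^sub>R norm (f x)) - 0) < e)"
      using \<gamma> by blast
  qed
  then show ?thesis by simp
qed

lemma AE_zero_of_interval_integrals_zero:
  fixes f :: "real \<Rightarrow> 'b::euclidean_space"
  assumes f: "integrable (leb a b) f"
    and zero: "\<And>p q. \<lbrakk>a < p; p < q; q < b\<rbrakk> \<Longrightarrow> integral {p..q} f = 0"
  shows "AE x in leb a b. f x = 0"
proof -
  have fabs: "f absolutely_integrable_on {a..b}" using f by (simp add: integrable_leb_iff)
  have compact: "AE x in lebesgue. x \<in> {p..q} \<longrightarrow> f x = 0" if pq: "a < p" "q < b" for p q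
  proof -
    have "{p..q} \<subseteq> {a..b}" using pq by auto
    then have fpq: "f absolutely_integrable_on {p..q}"
      using fabs absolutely_integrable_on_subinterval by blast
    have "integral {r..s} f = 0" if "p \<le> r" "r \<le> s" "s \<le> q" for r s
      using zero[of r s] that pq by (cases "r = s") auto
    then have "((\<lambda>x. norm (f x)) has_integral 0) {p..q}"
      by (intro norm_integral_zero_of_interval_integrals_zero set_lebesgue_integral_eq_integral(1)[OF fpq])
    moreover have int: "integrable (lebesgue_on {p..q}) (\<lambda>x. norm (f x))"
      by (intro integrable_norm absolutely_integrable_imp_integrable[OF fpq]) simp
    ultimately have "(LINT x|lebesgue_on {p..q}. norm (f x)) = 0"
      using lebesgue_integral_eq_integral[OF int] by (simp add: integral_unique)
    then have "AE x in lebesgue_on {p..q}. norm (f x) = 0"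
      using integral_nonneg_eq_0_iff_AE[OF int] by simp
    then show ?thesis by (simp add: AE_restrict_space_iff)
  qed
  have "AE x in lebesgue. \<forall>n::nat. x \<in> {a + 1 / (real n + 1)..b - 1 / (real n + 1)} \<longrightarrow> f x = 0"
    unfolding AE_all_countable by (intro allI compact) auto
  then have "AE x in lebesgue. x \<in> {a<..<b} \<longrightarrow> f x = 0"
  proof eventually_elim
    case (elim x)
    show ?case
    proof
      assume x: "x \<in> {a<..<b}"
      obtain n :: nat where "inverse (real (Suc n)) < min (x - a) (b - x)"
        using reals_Archimedean[of "min (x - a) (b - x)"] x by auto
      then have "x \<in> {a + 1 / (real n + 1)..b - 1 / (real n + 1)}" by (auto simp: inverse_eq_divide add.commute)
      then show "f x = 0" using elim by blast
    qed
  qed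
  then show ?thesis by (simp add: AE_restrict_space_iff)
qed

text \<open>\<open>F\<close> is absolutely continuous, and \<open>f\<close> is its derivative almost everywhere; the value of \<open>F\<close> at \<open>a\<close> is arbitrary.\<close>

definition ac_primitive :: "real \<Rightarrow> real \<Rightarrow> (real \<Rightarrow> 'b::euclidean_space) \<Rightarrow> (real \<Rightarrow> 'b) \<Rightarrow> bool" where
  "ac_primitive a b F f \<longleftrightarrow>
     f absolutely_integrable_on {a..b} \<and> (\<forall>x\<in>{a..b}. F x = F a + integral {a..x} f)"

lemma ac_primitiveD:
  assumes "ac_primitive a b F f"
  shows "f absolutely_integrable_on {a..b}" "x \<in> {a..b} \<Longrightarrow> F x = F a + integral {a..x} f"
  using assms unfolding ac_primitive_def by blast+

lemma ac_primitive_subinterval_integrable: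
  assumes "ac_primitive a b F f" "a \<le> x" "y \<le> b"
  shows "f absolutely_integrable_on {x..y}" "f integrable_on {x..y}"
proof -
  show "f absolutely_integrable_on {x..y}"
    using assms(2,3) by (intro absolutely_integrable_on_subinterval[OF ac_primitiveD(1)[OF assms(1)]]) auto
  then show "f integrable_on {x..y}" by (rule set_lebesgue_integral_eq_integral(1))
qed

lemma ac_primitive_increment:
  assumes F: "ac_primitive a b F f" and "a \<le> x" "x \<le> y" "y \<le> b"
  shows "F y - F x = integral {x..y} f"
proof -
  have "integral {a..x} f + integral {x..y} f = integral {a..y} f"
    by (rule Henstock_Kurzweil_Integration.integral_combine)
       (use assms(2-) ac_primitive_subinterval_integrable(2)[OF F, of a y] in auto)
  moreover have "F y = F a + integral {a..y} f" "F x = F a + integral {a..x} f"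
    using assms(2-) by (auto intro!: ac_primitiveD(2)[OF F])
  ultimately have "F y - F x = (integral {a..x} f + integral {x..y} f) - integral {a..x} f" by simp
  then show ?thesis by simp
qed

lemma ac_primitive_continuous_on:
  assumes F: "ac_primitive a b F f"
  shows "continuous_on {a..b} F"
proof -
  have "continuous_on {a..b} (\<lambda>x. F a + integral {a..x} f)"
    by (intro continuous_intros indefinite_integral_continuous_1 ac_primitive_subinterval_integrable(2)[OF F]) auto
  then show ?thesis
    by (rule continuous_on_eq) (rule ac_primitiveD(2)[OF F, symmetric])
qed

lemma ac_primitive_of_derivative:
  assumes "\<And>x. x \<in> {a..b} \<Longrightarrow> (F has_vector_derivative f x) (at x)" and f: "continuous_on {a..b} f"
  shows "ac_primitive a b F f"
  unfolding ac_primitive_def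
proof (intro conjI ballI)
  show "f absolutely_integrable_on {a..b}" by (rule absolutely_integrable_continuous_real[OF f])
  fix x assume x: "x \<in> {a..b}"
  have "(f has_integral F x - F a) {a..x}"
    using assms x by (intro fundamental_theorem_of_calculus) (auto intro: has_vector_derivative_at_within)
  then show "F x = F a + integral {a..x} f" by (simp add: integral_unique)
qed

lemma bounded_product_absolutely_integrable:
  fixes prod :: "'a::euclidean_space \<Rightarrow> 'b::euclidean_space \<Rightarrow> 'c::euclidean_space"
  assumes "bounded_bilinear prod" and F: "continuous_on {a..b} F" and g: "g absolutely_integrable_on {a..b}"
  shows "(\<lambda>t::real. prod (F t) (g t)) absolutely_integrable_on {a..b}"
proof (rule absolutely_integrable_bounded_measurable_product[of prod F "{a..b}" g])
  show "bilinear prod" using assms(1) by (simp add: bilinear_conv_bounded_bilinear)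
  show "F \<in> borel_measurable (lebesgue_on {a..b})"
    by (rule continuous_imp_measurable_on_sets_lebesgue[OF F]) simp
  show "bounded (F ` {a..b})"
    by (rule compact_imp_bounded[OF compact_continuous_image[OF F]]) simp
qed (use g in auto)

lemma sum_of_small_increments:
  fixes \<Phi> :: "real \<Rightarrow> 'c::real_normed_vector" and Q :: "real \<Rightarrow> real"
  assumes "a \<le> b" and d: "d > 0"
    and step: "\<And>x y. \<lbrakk>a \<le> x; x \<le> y; y \<le> b; y - x < d\<rbrakk> \<Longrightarrow> norm (\<Phi> y - \<Phi> x) \<le> Q y - Q x"
  shows "norm (\<Phi> b - \<Phi> a) \<le> Q b - Q a"
proof -
  obtain n :: nat where n: "(b - a) / d < real n" using reals_Archimedean2 by blast
  have n0: "0 < n" using n assms(1) d by (smt (verit) divide_nonneg_pos of_nat_0_less_iff)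
  define h where "h = (b - a) / real n"
  have h: "0 \<le> h" "h < d" using assms(1) d n n0 by (auto simp: h_def field_simps)
  have hn: "real n * h = b - a" using n0 by (simp add: h_def)
  have "norm (\<Phi> (a + real k * h) - \<Phi> a) \<le> Q (a + real k * h) - Q a" if "k \<le> n" for k
    using that
  proof (induction k)
    case (Suc k)
    let ?x = "a + real k * h" and ?y = "a + real (Suc k) * h"
    have "real (Suc k) * h \<le> real n * h" using Suc.prems h by (intro mult_right_mono) auto
    then have "?y \<le> b" using hn by simp
    moreover have "a \<le> ?x" "?x \<le> ?y" "?y - ?x < d" using h by (auto simp: algebra_simps)
    ultimately have "norm (\<Phi> ?y - \<Phi> ?x) \<le> Q ?y - Q ?x" by (intro step)
    moreover have "norm (\<Phi> ?y - \<Phi> a) \<le> norm (\<Phi> ?y - \<Phi> ?x) + norm (\<Phi> ?x - \<Phi> a)"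
      using norm_triangle_ineq[of "\<Phi> ?y - \<Phi> ?x" "\<Phi> ?x - \<Phi> a"] by simp
    ultimately show ?case using Suc by simp
  qed simp
  from this[of n] show ?thesis by (simp add: hn)
qed

text \<open>On an interval \<open>[x, y]\<close> the increment of the product is the integral of
  \<open>prod (F y) (g t) + prod (f t) (G x)\<close>. Replacing \<open>F y\<close> and \<open>G x\<close> by the values at \<open>t\<close> costs at most
  a multiple of \<open>e\<close> times the integral of \<open>\<parallel>f\<parallel> + \<parallel>g\<parallel>\<close> if \<open>F\<close> and \<open>G\<close> vary by less than \<open>e\<close> on \<open>[x, y]\<close>.
  By uniform continuity these errors, summed over short intervals, are arbitrarily small. In
  this way derivatives at individual points are never needed.\<close>

lemma ac_primitive_product_increment:
  fixes prod :: "'a::euclidean_space \<Rightarrow> 'b::euclidean_space \<Rightarrow> 'c::euclidean_space"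
  assumes prod: "bounded_bilinear prod" and F: "ac_primitive a b F f" and G: "ac_primitive a b G g"
    and ab: "a \<le> b"
  defines "P \<equiv> \<lambda>t. prod (F t) (g t) + prod (f t) (G t)"
  shows "P absolutely_integrable_on {a..b}"
    and "prod (F b) (G b) - prod (F a) (G a) = integral {a..b} P"
proof -
  interpret bounded_bilinear prod by (rule prod)
  note cont = ac_primitive_continuous_on[OF F] ac_primitive_continuous_on[OF G]
  note fg = ac_primitiveD(1)[OF F] ac_primitiveD(1)[OF G]
  show P: "P absolutely_integrable_on {a..b}"
    unfolding P_def
    by (intro set_integral_add(1) bounded_product_absolutely_integrable[OF prod] cont fg
        bounded_product_absolutely_integrable[OF flip])
  obtain K where K: "0 < K" "\<And>u v. norm (prod u v) \<le> norm u * norm v * K"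
    using pos_bounded by blast
  define R where "R t = norm (f t) + norm (g t)" for t
  have R: "R integrable_on {a..b}"
    unfolding R_def
    by (intro integrable_add) (use fg in \<open>auto simp: absolutely_integrable_on_def\<close>)
  have sub: "h integrable_on {x..y}" if "h integrable_on {a..b}" "a \<le> x" "y \<le> b"
    for x y and h :: "real \<Rightarrow> 'z::banach"
    using that by (intro integrable_on_subinterval[of h "{a..b}" x y]) auto
  have P': "P integrable_on {a..b}" using P by (rule set_lebesgue_integral_eq_integral(1))
  define \<Phi> where "\<Phi> x = prod (F x) (G x) - integral {a..x} P" for x
  have bound: "norm (\<Phi> b - \<Phi> a) \<le> e * (K * integral {a..b} R)" if e: "e > 0" for e
  proof -
    have "uniformly_continuous_on {a..b} F" "uniformly_continuous_on {a..b} G"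
      using cont by (auto intro: compact_uniformly_continuous)
    then obtain d1 d2 where d1: "d1 > 0" "\<And>x y. \<lbrakk>x \<in> {a..b}; y \<in> {a..b}; dist x y < d1\<rbrakk> \<Longrightarrow> dist (F x) (F y) < e"
      and d2: "d2 > 0" "\<And>x y. \<lbrakk>x \<in> {a..b}; y \<in> {a..b}; dist x y < d2\<rbrakk> \<Longrightarrow> dist (G x) (G y) < e"
      using e unfolding uniformly_continuous_on_def by metis
    have "norm (\<Phi> b - \<Phi> a) \<le> e * K * integral {a..b} R - e * K * integral {a..a} R"
    proof (rule sum_of_small_increments[OF ab, of "min d1 d2" \<Phi> "\<lambda>x. e * K * integral {a..x} R"])
      show "min d1 d2 > 0" using d1 d2 by simp
      fix x y assume xy: "a \<le> x" "x \<le> y" "y \<le> b" "y - x < min d1 d2"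
      have int: "f integrable_on {x..y}" "g integrable_on {x..y}"
        using ac_primitive_subinterval_integrable[OF F] ac_primitive_subinterval_integrable[OF G] xy by auto
      have combP: "integral {a..y} P - integral {a..x} P = integral {x..y} P"
        using Henstock_Kurzweil_Integration.integral_combine[of a x y P] sub[OF P', of a y] xy
        by (simp add: algebra_simps)
      have combR: "integral {a..y} R - integral {a..x} R = integral {x..y} R"
        using Henstock_Kurzweil_Integration.integral_combine[of a x y R] sub[OF R, of a y] xy
        by (simp add: algebra_simps)
      have "prod (F y) (integral {x..y} g) = integral {x..y} (\<lambda>t. prod (F y) (g t))"
        using integral_linear[OF int(2) bounded_linear_right[of "F y"]] by (simp add: o_def)
      moreover have "prod (integral {x..y} f) (G x) = integral {x..y} (\<lambda>t. prod (f t) (G x))"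
        using integral_linear[OF int(1) bounded_linear_left[of "G x"]] by (simp add: o_def)
      moreover have intc: "(\<lambda>t. prod (F y) (g t)) integrable_on {x..y}" "(\<lambda>t. prod (f t) (G x)) integrable_on {x..y}"
        using integrable_linear[OF int(2) bounded_linear_right[of "F y"]]
          integrable_linear[OF int(1) bounded_linear_left[of "G x"]] by (simp_all add: o_def)
      moreover have "prod (F y) (G y) - prod (F x) (G x)
          = prod (F y) (integral {x..y} g) + prod (integral {x..y} f) (G x)"
        unfolding ac_primitive_increment[OF F xy(1-3), symmetric] ac_primitive_increment[OF G xy(1-3), symmetric]
        by (simp add: diff_left diff_right)
      ultimately have eq: "prod (F y) (G y) - prod (F x) (G x)
          = integral {x..y} (\<lambda>t. prod (F y) (g t) + prod (f t) (G x))"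
        by (simp add: Henstock_Kurzweil_Integration.integral_add)
      have "\<Phi> y - \<Phi> x = (prod (F y) (G y) - prod (F x) (G x)) - (integral {a..y} P - integral {a..x} P)"
        by (simp add: \<Phi>_def)
      also have "\<dots> = integral {x..y} (\<lambda>t. (prod (F y) (g t) + prod (f t) (G x)) - P t)"
        unfolding eq combP
        by (intro Henstock_Kurzweil_Integration.integral_diff[symmetric] integrable_add intc sub[OF P'] xy)
      also have "norm \<dots> \<le> integral {x..y} (\<lambda>t. e * K * R t)"
      proof (rule Henstock_Kurzweil_Integration.integral_norm_bound_integral)
        show "(\<lambda>t. prod (F y) (g t) + prod (f t) (G x) - P t) integrable_on {x..y}"
          by (intro integrable_diff integrable_add intc sub[OF P'] xy)
        show "(\<lambda>t. e * K * R t) integrable_on {x..y}"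
          using integrable_on_cmult_left[OF sub[OF R], of x y "e * K"] xy by simp
        fix t assume t: "t \<in> {x..y}"
        have "norm (prod (F y) (g t) + prod (f t) (G x) - P t)
            = norm (prod (F y - F t) (g t) + prod (f t) (G x - G t))"
          by (simp add: P_def diff_left diff_right algebra_simps)
        also have "\<dots> \<le> norm (F y - F t) * norm (g t) * K + norm (f t) * norm (G x - G t) * K"
          by (rule order_trans[OF norm_triangle_ineq]) (intro add_mono K)
        also have "\<dots> \<le> e * norm (g t) * K + norm (f t) * e * K"
        proof -
          have "norm (F y - F t) \<le> e" "norm (G x - G t) \<le> e"
            using d1(2)[of y t] d2(2)[of x t] t xy by (auto simp: dist_norm)
          then show ?thesis using K by (intro add_mono mult_right_mono mult_left_mono) auto
        qed
        finally show "norm (prod (F y) (g t) + prod (f t) (G x) - P t) \<le> e * K * R t"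
          by (simp add: R_def algebra_simps)
      qed
      finally show "norm (\<Phi> y - \<Phi> x) \<le> e * K * integral {a..y} R - e * K * integral {a..x} R"
        by (simp flip: combR add: right_diff_distrib)
    qed
    then show ?thesis by (simp add: mult_ac)
  qed
  have "norm (\<Phi> b - \<Phi> a) \<le> 0"
  proof (rule field_le_epsilon)
    fix e :: real assume e: "e > 0"
    define C where "C = K * integral {a..b} R"
    have C: "0 \<le> C" unfolding C_def using K(1) R
      by (intro mult_nonneg_nonneg Henstock_Kurzweil_Integration.integral_nonneg) (auto simp: R_def)
    have "norm (\<Phi> b - \<Phi> a) \<le> e / (C + 1) * C"
      using bound[of "e / (C + 1)"] e C unfolding C_def[symmetric] by simp
    also have "\<dots> \<le> 0 + e" using e C by (simp add: field_simps)
    finally show "norm (\<Phi> b - \<Phi> a) \<le> 0 + e" .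
  qed
  then show "prod (F b) (G b) - prod (F a) (G a) = integral {a..b} P"
    by (simp add: \<Phi>_def) (metis add_diff_cancel_left' diff_add_cancel)
qed

lemma ac_primitive_subinterval:
  assumes F: "ac_primitive a b F f" and x: "x \<in> {a..b}"
  shows "ac_primitive a x F f"
  unfolding ac_primitive_def
proof (intro conjI ballI)
  show "f absolutely_integrable_on {a..x}"
    using ac_primitive_subinterval_integrable(1)[OF F, of a x] x by simp
  show "F y = F a + integral {a..y} f" if "y \<in> {a..x}" for y
    by (rule ac_primitiveD(2)[OF F]) (use that x in auto)
qed

theorem ac_primitive_product:
  fixes prod :: "'a::euclidean_space \<Rightarrow> 'b::euclidean_space \<Rightarrow> 'c::euclidean_space"
  assumes prod: "bounded_bilinear prod" and F: "ac_primitive a b F f" and G: "ac_primitive a b G g"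
    and ab: "a \<le> b"
  shows "ac_primitive a b (\<lambda>t. prod (F t) (G t)) (\<lambda>t. prod (F t) (g t) + prod (f t) (G t))"
  unfolding ac_primitive_def
proof (intro conjI ballI)
  show "(\<lambda>t. prod (F t) (g t) + prod (f t) (G t)) absolutely_integrable_on {a..b}"
    by (rule ac_primitive_product_increment(1)[OF prod F G ab])
  fix x assume x: "x \<in> {a..b}"
  show "prod (F x) (G x) = prod (F a) (G a) + integral {a..x} (\<lambda>t. prod (F t) (g t) + prod (f t) (G t))"
    using ac_primitive_product_increment(2)[OF prod ac_primitive_subinterval[OF F x] ac_primitive_subinterval[OF G x]] x
    by (simp add: algebra_simps)
qed

section \<open>The space of square integrable functions\<close>

lemma finite_measure_leb: "finite_measure (leb a b)"
  by (rule finite_measure_lebesgue_on) simp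

lemma L2_iff: "u \<in> L2 a b \<longleftrightarrow> u \<in> borel_measurable (leb a b) \<and> integrable (leb a b) (\<lambda>x. (norm (u x))\<^sup>2)"
  by (simp add: L2_def)

lemma L2_measurable: "u \<in> L2 a b \<Longrightarrow> u \<in> borel_measurable (leb a b)"
  by (simp add: L2_def)

lemma L2_dominated:
  assumes u: "u \<in> L2 a b" and v: "v \<in> borel_measurable (leb a b)"
    and le: "AE x in leb a b. norm (v x) \<le> C * norm (u x)"
  shows "v \<in> L2 a b"
  unfolding L2_iff
proof (rule conjI[OF v], rule Bochner_Integration.integrable_bound)
  show "integrable (leb a b) (\<lambda>x. C\<^sup>2 * (norm (u x))\<^sup>2)" using u by (simp add: L2_iff)
  show "(\<lambda>x. (norm (v x))\<^sup>2) \<in> borel_measurable (leb a b)" using v by measurable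
  show "AE x in leb a b. norm ((norm (v x))\<^sup>2) \<le> norm (C\<^sup>2 * (norm (u x))\<^sup>2)"
    using le
  proof eventually_elim
    case (elim x)
    then have "(norm (v x))\<^sup>2 \<le> (C * norm (u x))\<^sup>2" by (intro power_mono) auto
    then show ?case by (simp add: power_mult_distrib)
  qed
qed

lemma L2_0: "(\<lambda>x. 0) \<in> L2 a b" by (simp add: L2_iff)

lemma L2_add:
  assumes u: "u \<in> L2 a b" and v: "v \<in> L2 a b"
  shows "(\<lambda>x. u x + v x) \<in> L2 a b"
  unfolding L2_iff
proof (rule conjI, goal_cases)
  case 1
  show ?case using L2_measurable[OF u] L2_measurable[OF v] by measurable
next
  case 2
  show ?case
  proof (rule Bochner_Integration.integrable_bound)
    note [measurable] = L2_measurable[OF u] L2_measurable[OF v]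
    show "integrable (leb a b) (\<lambda>x. 2 * (norm (u x))\<^sup>2 + 2 * (norm (v x))\<^sup>2)"
      using u v by (simp add: L2_iff)
    show "(\<lambda>x. (norm (u x + v x))\<^sup>2) \<in> borel_measurable (leb a b)" by measurable
    have "(norm (u x + v x))\<^sup>2 \<le> 2 * (norm (u x))\<^sup>2 + 2 * (norm (v x))\<^sup>2" for x
    proof -
      have "(norm (u x + v x))\<^sup>2 \<le> (norm (u x) + norm (v x))\<^sup>2"
        by (intro power_mono norm_triangle_ineq) auto
      also have "\<dots> \<le> 2 * (norm (u x))\<^sup>2 + 2 * (norm (v x))\<^sup>2"
        using sum_squares_bound[of "norm (u x)" "norm (v x)"] by (simp add: power2_sum)
      finally show ?thesis .
    qed
    then show "AE x in leb a b. norm ((norm (u x + v x))\<^sup>2) \<le> norm (2 * (norm (u x))\<^sup>2 + 2 * (norm (v x))\<^sup>2)"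
      by simp
  qed
qed

lemma L2_linear:
  assumes u: "u \<in> L2 a b" and Q: "bounded_linear Q"
  shows "(\<lambda>x. Q (u x)) \<in> L2 a b"
proof (rule L2_dominated[OF u])
  show "(\<lambda>x. Q (u x)) \<in> borel_measurable (leb a b)"
    by (rule borel_measurable_continuous_on[OF _ L2_measurable[OF u]])
       (rule linear_continuous_on[OF Q])
  show "AE x in leb a b. norm (Q (u x)) \<le> onorm Q * norm (u x)" by (simp add: onorm[OF Q])
qed

lemma L2_bounded_scale:
  assumes u: "u \<in> L2 a b" and k: "k \<in> borel_measurable (leb a b)" "AE x in leb a b. \<bar>k x\<bar> \<le> C"
  shows "(\<lambda>x. k x *\<^sub>R u x) \<in> L2 a b"
proof (rule L2_dominated[OF u])
  show "(\<lambda>x. k x *\<^sub>R u x) \<in> borel_measurable (leb a b)" using k(1) L2_measurable[OF u] by measurable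
  show "AE x in leb a b. norm (k x *\<^sub>R u x) \<le> C * norm (u x)"
    using k(2) by eventually_elim (simp add: mult_right_mono)
qed

lemma subspace_L2: "subspace (L2 a b)"
  unfolding subspace_def zero_fun_def plus_fun_def scaleR_fun_def
  using L2_0 L2_add L2_bounded_scale[of _ a b "\<lambda>_. c" "\<bar>c\<bar>" for c] by auto

lemma L2_diff: "\<lbrakk>u \<in> L2 a b; v \<in> L2 a b\<rbrakk> \<Longrightarrow> (\<lambda>x. u x - v x) \<in> L2 a b"
  using subspace_diff[OF subspace_L2, of u a b v] by (simp add: fun_diff_def)

lemma L2_inner_integrable:
  assumes u: "u \<in> L2 a b" and v: "v \<in> L2 a b"
  shows "integrable (leb a b) (\<lambda>x. u x \<bullet> v x)"
proof (rule Bochner_Integration.integrable_bound)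
  note [measurable] = L2_measurable[OF u] L2_measurable[OF v]
  show "integrable (leb a b) (\<lambda>x. (norm (u x))\<^sup>2 + (norm (v x))\<^sup>2)"
    using u v by (simp add: L2_iff)
  show "(\<lambda>x. u x \<bullet> v x) \<in> borel_measurable (leb a b)" by measurable
  have "\<bar>u x \<bullet> v x\<bar> \<le> (norm (u x))\<^sup>2 + (norm (v x))\<^sup>2" for x
  proof -
    have "\<bar>u x \<bullet> v x\<bar> \<le> norm (u x) * norm (v x)" by (rule Cauchy_Schwarz_ineq2)
    also have "\<dots> \<le> (norm (u x))\<^sup>2 + (norm (v x))\<^sup>2"
      using sum_squares_bound[of "norm (u x)" "norm (v x)"]
        mult_nonneg_nonneg[OF norm_ge_zero norm_ge_zero, of "u x" "v x"] by linarith
    finally show ?thesis .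
  qed
  then show "AE x in leb a b. norm (u x \<bullet> v x) \<le> norm ((norm (u x))\<^sup>2 + (norm (v x))\<^sup>2)" by simp
qed

lemma L2_integrable: 
  assumes u: "u \<in> L2 a b"
  shows "integrable (leb a b) u"
proof -
  interpret finite_measure "leb a b" by (rule finite_measure_leb)
  show ?thesis
  proof (rule Bochner_Integration.integrable_bound)
    show "integrable (leb a b) (\<lambda>x. 1 + (norm (u x))\<^sup>2)" using u by (simp add: L2_iff)
    have "norm (u x) \<le> 1 + (norm (u x))\<^sup>2" for x
    proof -
      have "0 \<le> (norm (u x) - 1 / 2)\<^sup>2" by simp
      then have "0 \<le> (norm (u x))\<^sup>2 - norm (u x) + 1 / 4" by (simp add: power2_diff power_divide)
      then show ?thesis by linarith
    qed
    then show "AE x in leb a b. norm (u x) \<le> norm (1 + (norm (u x))\<^sup>2)" by simp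
  qed (use L2_measurable[OF u] in measurable)
qed

definition L2_ip :: "real \<Rightarrow> real \<Rightarrow> (real \<Rightarrow> real ^ 'n) \<Rightarrow> (real \<Rightarrow> real ^ 'n) \<Rightarrow> real" where
  "L2_ip a b u v = (LINT x|leb a b. u x \<bullet> v x)"

lemma L2_ip_self: "L2_ip a b u u = (LINT x|leb a b. (norm (u x))\<^sup>2)"
  by (simp add: L2_ip_def power2_norm_eq_inner)

lemma seminorm_L2_eq_0_iff:
  assumes "u \<in> L2 a b"
  shows "seminorm_of (L2_ip a b) u = 0 \<longleftrightarrow> (AE x in leb a b. u x = 0)"
  using assms by (simp add: seminorm_of_def L2_ip_self L2_iff integral_nonneg_eq_0_iff_AE)

text \<open>On an interval of finite length \<open>norm y \<le> s + (norm y)\<^sup>2 / (4 s)\<close> bounds the mean by the mean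
  square; \<open>s\<close> is chosen to make the constant term small.\<close>

lemma L1_Cauchy_of_L2_Cauchy:
  fixes X :: "nat \<Rightarrow> real \<Rightarrow> real ^ 'n"
  assumes X: "\<And>n. X n \<in> L2 a b"
    and C: "\<And>e. e > 0 \<Longrightarrow> \<exists>M. \<forall>m\<ge>M. \<forall>n\<ge>M. seminorm_of (L2_ip a b) (X m - X n) < e"
    and e: "e > 0"
  shows "\<exists>N. \<forall>i\<ge>N. \<forall>j\<ge>N. (LINT x|leb a b. norm (X i x - X j x)) < e"
proof -
  interpret finite_measure "leb a b" by (rule finite_measure_leb)
  define \<mu> where "\<mu> = measure (leb a b) {a<..<b}"
  \<comment> \<open>The summand \<open>1\<close> avoids a division by zero for an empty interval.\<close>
  define s where "s = e / (2 * (\<mu> + 1))"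
  have s: "s > 0" "s * \<mu> < e / 2"
  proof -
    have "0 \<le> \<mu>" by (simp add: \<mu>_def)
    then show "s > 0" "s * \<mu> < e / 2" using e by (auto simp: s_def field_simps)
  qed
  obtain M where M: "\<And>m n. \<lbrakk>M \<le> m; M \<le> n\<rbrakk> \<Longrightarrow> seminorm_of (L2_ip a b) (X m - X n) < sqrt (2 * s * e)"
    using C[of "sqrt (2 * s * e)"] s e by auto
  have "(LINT x|leb a b. norm (X i x - X j x)) < e" if "M \<le> i" "M \<le> j" for i j
  proof -
    have d: "(\<lambda>x. X i x - X j x) \<in> L2 a b" by (rule L2_diff[OF X X])
    have 1: "(LINT x|leb a b. (norm (X i x - X j x))\<^sup>2) < 2 * s * e"
      using M[OF that] by (simp add: seminorm_of_def L2_ip_self fun_diff_def)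
    have "norm y \<le> s + (norm y)\<^sup>2 / (4 * s)" for y :: "real ^ 'n"
    proof -
      have "0 \<le> (norm y - 2 * s)\<^sup>2" by simp
      then have "norm y * (4 * s) \<le> 4 * s\<^sup>2 + (norm y)\<^sup>2" by (simp add: power2_diff mult_ac power_mult_distrib)
      then show ?thesis using s(1) by (simp add: field_simps power2_eq_square)
    qed
    then have "(LINT x|leb a b. norm (X i x - X j x)) \<le> (LINT x|leb a b. s + (norm (X i x - X j x))\<^sup>2 / (4 * s))"
      using d by (intro integral_mono) (auto simp: L2_iff intro!: integrable_norm L2_integrable)
    also have "\<dots> = s * \<mu> + (LINT x|leb a b. (norm (X i x - X j x))\<^sup>2) / (4 * s)"
      using d by (simp add: L2_iff \<mu>_def mult.commute)
    also have "(LINT x|leb a b. (norm (X i x - X j x))\<^sup>2) / (4 * s) \<le> e / 2"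
      using 1 s(1) by (simp add: field_simps)
    finally show ?thesis using s by linarith
  qed
  then show ?thesis by blast
qed

text \<open>A subsequence converges almost everywhere because the sequence is Cauchy in the mean. Fatou's
  lemma, applied to \<open>(norm (X m - X (r i)))\<^sup>2\<close> as \<open>i\<close> tends to infinity, shows that the pointwise
  limit is also the limit in the mean square.\<close>

lemma L2_complete:
  fixes X :: "nat \<Rightarrow> real \<Rightarrow> real ^ 'n"
  assumes X: "\<And>n. X n \<in> L2 a b"
    and C: "\<And>e. e > 0 \<Longrightarrow> \<exists>M. \<forall>m\<ge>M. \<forall>n\<ge>M. seminorm_of (L2_ip a b) (X m - X n) < e"
  shows "\<exists>x\<in>L2 a b. (\<lambda>n. seminorm_of (L2_ip a b) (X n - x)) \<longlonglongrightarrow> 0"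
proof -
  note [measurable] = L2_measurable[OF X]
  obtain r where r: "strict_mono r" and ae: "AE x in leb a b. Cauchy (\<lambda>i. X (r i) x)"
    using cauchy_L1_AE_cauchy_subseq[of "leb a b" X] L2_integrable[OF X] L1_Cauchy_of_L2_Cauchy[OF X C] by blast
  define x where "x t = lim (\<lambda>i. X (r i) t)" for t
  have x_meas [measurable]: "x \<in> borel_measurable (leb a b)" unfolding x_def by measurable
  have x_lim: "AE t in leb a b. (\<lambda>i. X (r i) t) \<longlonglongrightarrow> x t"
    using ae by eventually_elim (simp add: x_def Cauchy_convergent_iff convergent_LIMSEQ_iff)
  have bound: "integrable (leb a b) (\<lambda>t. (norm (X m t - x t))\<^sup>2) \<and> (LINT t|leb a b. (norm (X m t - x t))\<^sup>2) \<le> e\<^sup>2"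
    if e: "e > 0" and M: "\<forall>n\<ge>M. seminorm_of (L2_ip a b) (X m - X n) < e" for m M e
  proof -
    have le: "(\<integral>\<^sup>+ t. ennreal ((norm (X m t - X (r i) t))\<^sup>2) \<partial>leb a b) \<le> ennreal (e\<^sup>2)" if "i \<ge> M" for i
    proof -
      have "r i \<ge> M" using that seq_suble[OF r, of i] by linarith
      then have "sqrt (LINT t|leb a b. (norm (X m t - X (r i) t))\<^sup>2) < e"
        using M by (simp add: seminorm_of_def L2_ip_self fun_diff_def)
      then have "(LINT t|leb a b. (norm (X m t - X (r i) t))\<^sup>2) \<le> e\<^sup>2"
        using e by (simp add: real_sqrt_less_iff sqrt_le_D less_imp_le)
      moreover have "integrable (leb a b) (\<lambda>t. (norm (X m t - X (r i) t))\<^sup>2)"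
        using L2_diff[OF X X] by (simp add: L2_iff)
      ultimately show ?thesis by (simp add: nn_integral_eq_integral)
    qed
    have "(\<integral>\<^sup>+ t. ennreal ((norm (X m t - x t))\<^sup>2) \<partial>leb a b)
        = (\<integral>\<^sup>+ t. liminf (\<lambda>i. ennreal ((norm (X m t - X (r i) t))\<^sup>2)) \<partial>leb a b)"
    proof (rule nn_integral_cong_AE)
      show "AE t in leb a b. ennreal ((norm (X m t - x t))\<^sup>2)
          = liminf (\<lambda>i. ennreal ((norm (X m t - X (r i) t))\<^sup>2))"
        using x_lim
      proof eventually_elim
        case (elim t)
        have "(\<lambda>i. ennreal ((norm (X m t - X (r i) t))\<^sup>2)) \<longlonglongrightarrow> ennreal ((norm (X m t - x t))\<^sup>2)"
          by (intro tendsto_ennrealI tendsto_intros elim)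
        from lim_imp_Liminf[OF trivial_limit_sequentially this] show ?case by (rule sym)
      qed
    qed
    also have "\<dots> \<le> liminf (\<lambda>i. \<integral>\<^sup>+ t. ennreal ((norm (X m t - X (r i) t))\<^sup>2) \<partial>leb a b)"
      by (rule nn_integral_liminf) measurable
    also have "\<dots> \<le> liminf (\<lambda>i::nat. ennreal (e\<^sup>2))"
      by (rule Liminf_mono) (use le in \<open>auto simp: eventually_sequentially\<close>)
    also have "\<dots> = ennreal (e\<^sup>2)" by (simp add: Liminf_const)
    finally have *: "(\<integral>\<^sup>+ t. ennreal ((norm (X m t - x t))\<^sup>2) \<partial>leb a b) \<le> ennreal (e\<^sup>2)" .
    then have int: "integrable (leb a b) (\<lambda>t. (norm (X m t - x t))\<^sup>2)"
      by (intro integrableI_bounded) (auto simp: le_less_trans)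
    then show ?thesis using * by (simp add: nn_integral_eq_integral ennreal_le_iff)
  qed
  have Xm: "X m - x \<in> L2 a b" if "\<forall>n\<ge>M. seminorm_of (L2_ip a b) (X m - X n) < 1" for m M
    using bound[OF _ that] by (simp add: L2_iff fun_diff_def)
  obtain M where "\<forall>m\<ge>M. \<forall>n\<ge>M. seminorm_of (L2_ip a b) (X m - X n) < 1" using C[of 1] by auto
  then have "X M - x \<in> L2 a b" using Xm by blast
  then have "X M - (X M - x) \<in> L2 a b" using X subspace_diff[OF subspace_L2] by blast
  then have x: "x \<in> L2 a b" by simp
  moreover have "(\<lambda>n. seminorm_of (L2_ip a b) (X n - x)) \<longlonglongrightarrow> 0"
  proof (rule LIMSEQ_I)
    fix e :: real assume e: "0 < e"
    obtain M where M: "\<forall>m\<ge>M. \<forall>n\<ge>M. seminorm_of (L2_ip a b) (X m - X n) < e / 2" using C[of "e / 2"] e by auto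
    have "seminorm_of (L2_ip a b) (X m - x) \<le> e / 2" if "m \<ge> M" for m
      using bound[of "e / 2" M m] M that e
      by (simp add: seminorm_of_def L2_ip_self fun_diff_def real_le_lsqrt del: le_divide_eq_numeral1)
    moreover have "0 \<le> seminorm_of (L2_ip a b) (X m - x)" for m
      by (simp add: seminorm_of_def L2_ip_self)
    ultimately show "\<exists>M. \<forall>m\<ge>M. norm (seminorm_of (L2_ip a b) (X m - x) - 0) < e"
      using e by (intro exI[of _ M] allI impI) (fastforce intro: le_less_trans[of _ "e / 2"])
  qed
  ultimately show ?thesis by blast
qed

lemma semi_inner_space_L2: "semi_inner_space (L2 a b) (L2_ip a b)"
proof
  show "subspace (L2 a b :: (real \<Rightarrow> real ^ 'n) set)" by (rule subspace_L2)
  fix u v w :: "real \<Rightarrow> real ^ 'n" and r :: real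
  assume "u \<in> L2 a b" "v \<in> L2 a b" "w \<in> L2 a b"
  then show "L2_ip a b (u + v) w = L2_ip a b u w + L2_ip a b v w"
    by (simp add: L2_ip_def inner_add_left L2_inner_integrable)
next
  fix u v :: "real \<Rightarrow> real ^ 'n" and r :: real
  show "L2_ip a b (r *\<^sub>R u) v = r * L2_ip a b u v"
    by (simp add: L2_ip_def scaleR_fun_def)
  show "L2_ip a b u v = L2_ip a b v u"
    by (simp add: L2_ip_def inner_commute)
  show "0 \<le> L2_ip a b u u" by (simp add: L2_ip_self)
qed

section \<open>The Sobolev space\<close>

lemma test_function_smooth: "test_function a b \<phi> \<Longrightarrow> smooth \<phi>"
  by (simp add: test_function_def smooth_def)

lemma smooth_scaleR_integrable:
  fixes f :: "real \<Rightarrow> 'b::euclidean_space"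
  assumes "smooth \<phi>" "integrable (leb a b) f"
  shows "integrable (leb a b) (\<lambda>x. \<phi> x *\<^sub>R f x)"
  using bounded_product_absolutely_integrable[OF bounded_bilinear_scaleR smooth_continuous_on[OF assms(1)], where g = f and a = a and b = b]
    assms(2) by (simp add: integrable_leb_iff)

lemma LINT_indicator_interval:
  fixes f :: "real \<Rightarrow> 'b::euclidean_space"
  assumes f: "integrable (leb a b) f" and pq: "a < p" "q < b"
  shows "(LINT x|leb a b. indicator {p<..<q} x *\<^sub>R f x) = integral {p..q} f"
proof -
  have fpq: "integrable (leb p q) f"
    using f pq by (auto simp: integrable_leb_iff intro: absolutely_integrable_on_subinterval)
  have "(LINT x|leb a b. indicator {p<..<q} x *\<^sub>R f x) = (LINT x|leb a b. (if x \<in> {p<..<q} then f x else 0))"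
    by (intro Bochner_Integration.integral_cong) (auto simp: indicator_def)
  also have "\<dots> = (LINT x|leb p q. f x)"
    using pq by (intro integral_restrict) auto
  finally show ?thesis using LINT_leb_eq_integral[OF fpq] by simp
qed

text \<open>Smooth functions approximate the indicator of an interval boundedly, so by dominated convergence
  all interval integrals of \<open>f\<close> vanish.\<close>

lemma fundamental_lemma_calculus_of_variations:
  fixes f :: "real \<Rightarrow> 'b::euclidean_space"
  assumes f: "integrable (leb a b) f"
    and zero: "\<And>\<psi> p q. \<lbrakk>smooth \<psi>; a < p; p < q; q < b; \<And>x. x \<notin> {p<..<q} \<Longrightarrow> \<psi> x = 0\<rbrakk>
      \<Longrightarrow> (LINT x|leb a b. \<psi> x *\<^sub>R f x) = 0"
  shows "AE x in leb a b. f x = 0"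
proof (rule AE_zero_of_interval_integrals_zero[OF f])
  fix p q assume pq: "a < p" "p < q" "q < b"
  obtain \<psi> :: "nat \<Rightarrow> real \<Rightarrow> real" where \<psi>: "\<And>n. smooth (\<psi> n)" "\<And>n x. x \<notin> {p<..<q} \<Longrightarrow> \<psi> n x = 0"
    "\<And>n x. \<bar>\<psi> n x\<bar> \<le> 1" "\<And>x. (\<lambda>n. \<psi> n x) \<longlonglongrightarrow> indicator {p<..<q} x"
    using smooth_approximations_of_interval[OF pq(2)] by blast
  have "(\<lambda>n. LINT x|leb a b. \<psi> n x *\<^sub>R f x) \<longlonglongrightarrow> (LINT x|leb a b. indicator {p<..<q} x *\<^sub>R f x)"
  proof (rule integral_dominated_convergence)
    show "integrable (leb a b) (\<lambda>x. norm (f x))" using f by simp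
    show "(\<lambda>x. \<psi> n x *\<^sub>R f x) \<in> borel_measurable (leb a b)" for n
      using smooth_scaleR_integrable[OF \<psi>(1) f] by (rule borel_measurable_integrable)
    show "AE x in leb a b. (\<lambda>n. \<psi> n x *\<^sub>R f x) \<longlonglongrightarrow> indicator {p<..<q} x *\<^sub>R f x"
      by (intro AE_I2 tendsto_intros \<psi>(4))
    show "AE x in leb a b. norm (\<psi> n x *\<^sub>R f x) \<le> norm (f x)" for n
      using \<psi>(3) by (intro AE_I2) (simp add: mult_left_le_one_le)
    show "(\<lambda>x. indicator {p<..<q} x *\<^sub>R f x) \<in> borel_measurable (leb a b)"
    proof (rule borel_measurable_LIMSEQ_metric)
      show "(\<lambda>x. \<psi> n x *\<^sub>R f x) \<in> borel_measurable (leb a b)" for n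
        using smooth_scaleR_integrable[OF \<psi>(1) f] by (rule borel_measurable_integrable)
      show "(\<lambda>n. \<psi> n x *\<^sub>R f x) \<longlonglongrightarrow> indicator {p<..<q} x *\<^sub>R f x" for x
        by (intro tendsto_intros \<psi>(4))
    qed
  qed
  moreover have "(LINT x|leb a b. \<psi> n x *\<^sub>R f x) = 0" for n
    by (rule zero[OF \<psi>(1) pq \<psi>(2)])
  ultimately have "(LINT x|leb a b. indicator {p<..<q} x *\<^sub>R f x) = 0"
    using LIMSEQ_unique[OF tendsto_const] by fastforce
  then show "integral {p..q} f = 0" using LINT_indicator_interval[OF f] pq by simp
qed

text \<open>The lemma of du Bois-Reymond. Let \<open>G\<close> be the primitive of \<open>g\<close> and \<open>f = w - G\<close>. By the product rule,
  \<open>f\<close> is orthogonal to all derivatives of test functions, hence to all smooth compactly supported \<open>\<psi>\<close> with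
  mean zero. Subtracting a multiple of a fixed \<open>\<rho>\<^sub>0\<close> with nonzero mean from an arbitrary \<open>\<psi>\<close>
  makes its mean zero; consequently \<open>f - C\<close> is orthogonal to every \<open>\<psi>\<close> for a suitable constant \<open>C\<close>.\<close>

lemma has_weak_derivative_primitive:
  fixes w g :: "real \<Rightarrow> real ^ 'n"
  assumes ab: "a < b" and w: "w \<in> L2 a b" and g: "g \<in> L2 a b" and weak: "has_weak_derivative a b w g"
  shows "\<exists>v. ac_primitive a b v g \<and> (AE x in leb a b. v x = w x)"
proof -
  interpret finite_measure "leb a b" by (rule finite_measure_leb)
  define G where "G x = integral {a..x} g" for x
  have gi: "integrable (leb a b) g" and wi: "integrable (leb a b) w" using w g by (auto intro: L2_integrable)
  have acG: "ac_primitive a b G g"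
    unfolding ac_primitive_def using gi by (simp add: integrable_leb_iff G_def)
  have Gi: "integrable (leb a b) G"
    unfolding integrable_leb_iff by (rule absolutely_integrable_continuous_real[OF ac_primitive_continuous_on[OF acG]])
  define f where "f x = w x - G x" for x
  have fi: "integrable (leb a b) f" unfolding f_def using wi Gi by simp
  have mean_zero: "(LINT x|leb a b. \<psi> x *\<^sub>R f x) = 0"
    if \<psi>: "smooth \<psi>" "a < p" "p < q" "q < b" "\<And>x. x \<notin> {p<..<q} \<Longrightarrow> \<psi> x = 0" and mean: "(LINT x|leb a b. \<psi> x) = 0"
    for \<psi> p q
  proof -
    have \<psi>i: "integrable (leb a b) \<psi>"
      unfolding integrable_leb_iff by (rule absolutely_integrable_continuous_real[OF smooth_continuous_on[OF \<psi>(1)]])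
    have "(\<psi> has_integral integral {p..q} \<psi>) {p..q}"
      by (intro integrable_integral integrable_continuous_real smooth_continuous_on \<psi>(1))
    then have "(\<psi> has_integral integral {p..q} \<psi>) {a..b}"
      by (rule has_integral_on_superset) (use \<psi> in auto)
    then have mean': "integral {p..q} \<psi> = 0"
      using mean LINT_leb_eq_integral[OF \<psi>i] by (simp add: integral_unique)
    obtain \<phi> where \<phi>: "smooth \<phi>" "\<And>x. (\<phi> has_real_derivative \<psi> x) (at x)"
      "\<And>x. x \<le> p \<Longrightarrow> \<phi> x = 0" "\<And>x. q \<le> x \<Longrightarrow> \<phi> x = 0"
      using smooth_primitive_compact_support[OF \<psi>(1,5), of p q] \<psi>(3) mean' by auto
    have "test_function a b \<phi>"
      by (rule test_functionI[OF \<phi>(1) \<psi>(2,4)]) (use \<phi> in auto)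
    moreover have "deriv \<phi> = \<psi>" using DERIV_imp_deriv[OF \<phi>(2)] by blast
    ultimately have 1: "(LINT x|leb a b. \<psi> x *\<^sub>R w x) = - (LINT x|leb a b. \<phi> x *\<^sub>R g x)"
      using weak unfolding has_weak_derivative_def by metis
    have ac\<phi>: "ac_primitive a b \<phi> \<psi>"
      by (rule ac_primitive_of_derivative)
         (use \<phi>(2) smooth_continuous_on[OF \<psi>(1)] in \<open>auto simp: has_real_derivative_iff_has_vector_derivative\<close>)
    have "\<phi> b *\<^sub>R G b - \<phi> a *\<^sub>R G a = integral {a..b} (\<lambda>t. \<phi> t *\<^sub>R g t + \<psi> t *\<^sub>R G t)"
      by (rule ac_primitive_product_increment(2)[OF bounded_bilinear_scaleR ac\<phi> acG]) (use ab in simp)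
    also have "\<dots> = (LINT x|leb a b. \<phi> x *\<^sub>R g x + \<psi> x *\<^sub>R G x)"
      by (rule LINT_leb_eq_integral[symmetric])
         (intro Bochner_Integration.integrable_add smooth_scaleR_integrable \<phi>(1) \<psi>(1) gi Gi)
    also have "\<dots> = (LINT x|leb a b. \<phi> x *\<^sub>R g x) + (LINT x|leb a b. \<psi> x *\<^sub>R G x)"
      by (intro Bochner_Integration.integral_add smooth_scaleR_integrable \<phi>(1) \<psi>(1) gi Gi)
    finally have 2: "(LINT x|leb a b. \<phi> x *\<^sub>R g x) = - (LINT x|leb a b. \<psi> x *\<^sub>R G x)"
      using \<phi>(3)[of a] \<phi>(4)[of b] \<psi>(2,4) by (simp add: eq_neg_iff_add_eq_0)
    have "(LINT x|leb a b. \<psi> x *\<^sub>R f x) = (LINT x|leb a b. \<psi> x *\<^sub>R w x) - (LINT x|leb a b. \<psi> x *\<^sub>R G x)"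
      unfolding f_def scaleR_diff_right
      by (intro Bochner_Integration.integral_diff smooth_scaleR_integrable \<psi>(1) wi Gi)
    then show ?thesis using 1 2 by simp
  qed
  obtain \<rho>\<^sub>0 p\<^sub>0 q\<^sub>0 where \<rho>\<^sub>0: "smooth \<rho>\<^sub>0" "a < p\<^sub>0" "p\<^sub>0 < q\<^sub>0" "q\<^sub>0 < b" "\<And>x. x \<notin> {p\<^sub>0<..<q\<^sub>0} \<Longrightarrow> \<rho>\<^sub>0 x = 0"
    "(LINT x|leb a b. \<rho>\<^sub>0 x) \<noteq> 0"
  proof -
    have "\<not> (AE x in leb a b. (1::real) = 0)"
    proof
      assume "AE x in leb a b. (1::real) = 0"
      then have "(LINT x|leb a b. (1::real)) = 0" by (rule integral_eq_zero_AE)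
      then show False using ab by (simp add: measure_restrict_space)
    qed
    then show ?thesis
      using fundamental_lemma_calculus_of_variations[of a b "\<lambda>x. 1::real"] that by force
  qed
  define k where "k = 1 / (LINT x|leb a b. \<rho>\<^sub>0 x)"
  define C where "C = k *\<^sub>R (LINT x|leb a b. \<rho>\<^sub>0 x *\<^sub>R f x)"
  have "AE x in leb a b. f x - C = 0"
  proof (rule fundamental_lemma_calculus_of_variations)
    show "integrable (leb a b) (\<lambda>x. f x - C)" using fi by simp
    fix \<psi> p q assume \<psi>: "smooth \<psi>" "a < p" "p < q" "q < b" "\<And>x. x \<notin> {p<..<q} \<Longrightarrow> \<psi> x = 0"
    have \<psi>i: "integrable (leb a b) \<psi>" and \<rho>i: "integrable (leb a b) \<rho>\<^sub>0"
      unfolding integrable_leb_iff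
      by (intro absolutely_integrable_continuous_real smooth_continuous_on \<psi>(1) \<rho>\<^sub>0(1))+
    define I where "I = (LINT x|leb a b. \<psi> x)"
    \<comment> \<open>The factor \<open>1\<close> only gives the shape of \<open>smooth_linear_combination\<close>.\<close>
    define \<theta> where "\<theta> x = 1 * \<psi> x + (- I * k) * \<rho>\<^sub>0 x" for x
    have "(LINT x|leb a b. \<theta> x *\<^sub>R f x) = 0"
    proof (rule mean_zero)
      show "smooth \<theta>" unfolding \<theta>_def[abs_def] by (rule smooth_linear_combination[OF \<psi>(1) \<rho>\<^sub>0(1)])
      show "a < min p p\<^sub>0" "min p p\<^sub>0 < max q q\<^sub>0" "max q q\<^sub>0 < b" using \<psi> \<rho>\<^sub>0 by auto
      show "\<theta> x = 0" if "x \<notin> {min p p\<^sub>0<..<max q q\<^sub>0}" for x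
      proof -
        have "x \<notin> {p<..<q}" "x \<notin> {p\<^sub>0<..<q\<^sub>0}"
          using that by (auto simp: min_less_iff_disj less_max_iff_disj)
        then show ?thesis using \<psi>(5) \<rho>\<^sub>0(5) by (simp add: \<theta>_def)
      qed
      show "(LINT x|leb a b. \<theta> x) = 0"
        using \<psi>i \<rho>i \<rho>\<^sub>0(6) by (simp add: \<theta>_def I_def k_def)
    qed
    moreover have "(LINT x|leb a b. \<theta> x *\<^sub>R f x)
        = (LINT x|leb a b. \<psi> x *\<^sub>R f x) + (- I * k) *\<^sub>R (LINT x|leb a b. \<rho>\<^sub>0 x *\<^sub>R f x)"
    proof -
      have "(LINT x|leb a b. \<theta> x *\<^sub>R f x)
          = (LINT x|leb a b. \<psi> x *\<^sub>R f x + (- I * k) *\<^sub>R (\<rho>\<^sub>0 x *\<^sub>R f x))"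
        by (intro Bochner_Integration.integral_cong) (auto simp: \<theta>_def algebra_simps)
      also have "\<dots> = (LINT x|leb a b. \<psi> x *\<^sub>R f x) + (LINT x|leb a b. (- I * k) *\<^sub>R (\<rho>\<^sub>0 x *\<^sub>R f x))"
        by (intro Bochner_Integration.integral_add Bochner_Integration.integrable_scaleR_right
            smooth_scaleR_integrable fi \<psi>(1) \<rho>\<^sub>0(1))
      finally show ?thesis by (simp del: scaleR_scaleR)
    qed
    ultimately have "(LINT x|leb a b. \<psi> x *\<^sub>R f x) = I *\<^sub>R C"
      by (simp add: C_def algebra_simps)
    moreover have "(LINT x|leb a b. \<psi> x *\<^sub>R (f x - C)) = (LINT x|leb a b. \<psi> x *\<^sub>R f x) - I *\<^sub>R C"
    proof -
      have "(LINT x|leb a b. \<psi> x *\<^sub>R (f x - C)) = (LINT x|leb a b. \<psi> x *\<^sub>R f x) - (LINT x|leb a b. \<psi> x *\<^sub>R C)"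
        unfolding scaleR_diff_right
        by (intro Bochner_Integration.integral_diff smooth_scaleR_integrable fi \<psi>(1)) auto
      then show ?thesis using \<psi>i by (simp add: I_def)
    qed
    ultimately show "(LINT x|leb a b. \<psi> x *\<^sub>R (f x - C)) = 0" by simp
  qed
  then have "AE x in leb a b. C + G x = w x"
    by eventually_elim (simp add: f_def algebra_simps)
  moreover have "ac_primitive a b (\<lambda>x. C + G x) g"
    using acG unfolding ac_primitive_def by (simp add: G_def)
  ultimately show ?thesis by blast
qed

lemma weak_derivative_unique:
  fixes w g g' :: "real \<Rightarrow> real ^ 'n"
  assumes "g \<in> L2 a b" "g' \<in> L2 a b" and g: "has_weak_derivative a b w g" and g': "has_weak_derivative a b w g'"
  shows "AE x in leb a b. g x = g' x"
proof -
  have i: "integrable (leb a b) g" "integrable (leb a b) g'" using assms(1,2) by (auto intro: L2_integrable)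
  have "AE x in leb a b. g x - g' x = 0"
  proof (rule fundamental_lemma_calculus_of_variations)
    show "integrable (leb a b) (\<lambda>x. g x - g' x)" using i by simp
    fix \<psi> p q assume \<psi>: "smooth \<psi>" "a < p" "p < q" "q < b" "\<And>x. x \<notin> {p<..<q} \<Longrightarrow> \<psi> x = 0"
    have test: "test_function a b \<psi>" by (rule test_functionI[OF \<psi>(1,2,4,5)])
    have "(LINT x|leb a b. \<psi> x *\<^sub>R g x) = (LINT x|leb a b. \<psi> x *\<^sub>R g' x)"
      using g[unfolded has_weak_derivative_def, rule_format, OF test]
        g'[unfolded has_weak_derivative_def, rule_format, OF test] by simp
    then show "(LINT x|leb a b. \<psi> x *\<^sub>R (g x - g' x)) = 0"
      unfolding scaleR_diff_right
      using Bochner_Integration.integral_diff[OF i(1,2)[THEN smooth_scaleR_integrable[OF \<psi>(1)]]] by simp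
  qed
  then show ?thesis by eventually_elim simp
qed

text \<open>The set of points of the open interval where the functions differ is open and negligible,
  hence empty; the end points follow by continuity.\<close>

lemma continuous_eq_of_AE_eq:
  fixes u v :: "real \<Rightarrow> 'b::real_normed_vector"
  assumes ab: "a < b" and u: "continuous_on {a..b} u" and v: "continuous_on {a..b} v"
    and ae: "AE x in leb a b. u x = v x" and x: "x \<in> {a..b}"
  shows "u x = v x"
proof -
  let ?d = "\<lambda>x. u x - v x"
  have cont: "continuous_on {a..b} ?d" by (intro continuous_intros u v)
  define Z where "Z = {a<..<b} \<inter> ?d -` (- {0})"
  have "open Z"
    unfolding Z_def by (intro continuous_open_preimage continuous_on_subset[OF cont]) auto
  moreover have "negligible Z"
  proof -
    have "AE x in lebesgue. x \<notin> Z"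
      using ae by (auto simp: AE_restrict_space_iff Z_def elim!: eventually_mono)
    then show ?thesis
      unfolding negligible_iff_null_sets by (simp add: completion.AE_iff_null_sets)
  qed
  ultimately have "Z = {}" using open_not_negligible by blast
  then have "{a<..<b} \<subseteq> {x \<in> {a..b}. ?d x = 0}" by (auto simp: Z_def)
  moreover have "closed {x \<in> {a..b}. ?d x = 0}"
    by (rule continuous_closed_preimage_constant[OF cont]) simp
  ultimately have "closure {a<..<b} \<subseteq> {x \<in> {a..b}. ?d x = 0}" by (rule closure_minimal)
  then show ?thesis using x ab by auto
qed

lemma cont_rep_eqI:
  fixes v w :: "real \<Rightarrow> real ^ 'n"
  assumes ab: "a < b" and v: "continuous_on {a..b} v" "AE x in leb a b. v x = w x" and x: "x \<in> {a..b}"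
  shows "cont_rep a b w x = v x"
proof -
  have "continuous_on {a..b} (cont_rep a b w) \<and> (AE x in leb a b. cont_rep a b w x = w x)"
    unfolding cont_rep_def by (rule someI[of _ v]) (use v in blast)
  then have "continuous_on {a..b} (cont_rep a b w)" "AE x in leb a b. cont_rep a b w x = v x"
    using v(2) by auto
  then show ?thesis by (intro continuous_eq_of_AE_eq[OF ab _ v(1) _ x])
qed

lemma weak_deriv:
  assumes "w \<in> H1 a b"
  shows weak_deriv_L2: "weak_deriv a b w \<in> L2 a b"
    and has_weak_derivative_weak_deriv: "has_weak_derivative a b w (weak_deriv a b w)"
proof -
  have "\<exists>g. g \<in> L2 a b \<and> has_weak_derivative a b w g" using assms by (auto simp: H1_def)
  then have "weak_deriv a b w \<in> L2 a b \<and> has_weak_derivative a b w (weak_deriv a b w)"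
    unfolding weak_deriv_def by (rule someI_ex)
  then show "weak_deriv a b w \<in> L2 a b" "has_weak_derivative a b w (weak_deriv a b w)" by auto
qed

theorem H1_cont_rep:
  fixes w :: "real \<Rightarrow> real ^ 'n"
  assumes ab: "a < b" and w: "w \<in> H1 a b"
  shows "ac_primitive a b (cont_rep a b w) (weak_deriv a b w)"
    and "AE x in leb a b. cont_rep a b w x = w x"
proof -
  obtain v where v: "ac_primitive a b v (weak_deriv a b w)" "AE x in leb a b. v x = w x"
    using has_weak_derivative_primitive[OF ab _ weak_deriv[OF w]] w by (auto simp: H1_def)
  have eq: "cont_rep a b w x = v x" if "x \<in> {a..b}" for x
    by (rule cont_rep_eqI[OF ab ac_primitive_continuous_on[OF v(1)] v(2) that])
  have "a \<in> {a..b}" using ab by simp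
  then show "ac_primitive a b (cont_rep a b w) (weak_deriv a b w)"
    unfolding ac_primitive_def using ac_primitiveD[OF v(1)] eq by metis
  show "AE x in leb a b. cont_rep a b w x = w x"
    using v(2) eq by (auto simp: AE_restrict_space_iff elim!: eventually_mono)
qed

lemma has_weak_derivative_linear:
  fixes w\<^sub>1 w\<^sub>2 g\<^sub>1 g\<^sub>2 :: "real \<Rightarrow> real ^ 'n"
  assumes L2: "w\<^sub>1 \<in> L2 a b" "w\<^sub>2 \<in> L2 a b" "g\<^sub>1 \<in> L2 a b" "g\<^sub>2 \<in> L2 a b"
    and weak: "has_weak_derivative a b w\<^sub>1 g\<^sub>1" "has_weak_derivative a b w\<^sub>2 g\<^sub>2"
  shows "has_weak_derivative a b (\<lambda>x. w\<^sub>1 x + c *\<^sub>R w\<^sub>2 x) (\<lambda>x. g\<^sub>1 x + c *\<^sub>R g\<^sub>2 x)"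
  unfolding has_weak_derivative_def
proof (intro allI impI)
  fix \<phi> assume \<phi>: "test_function a b \<phi>"
  note sm = test_function_smooth[OF \<phi>]
  have lin: "(LINT x|leb a b. \<psi> x *\<^sub>R (u x + c *\<^sub>R v x))
      = (LINT x|leb a b. \<psi> x *\<^sub>R u x) + c *\<^sub>R (LINT x|leb a b. \<psi> x *\<^sub>R v x)"
    if \<psi>: "smooth \<psi>" and uv: "u \<in> L2 a b" "v \<in> L2 a b" for \<psi> and u v :: "real \<Rightarrow> real ^ 'n"
  proof -
    have i: "integrable (leb a b) (\<lambda>x. \<psi> x *\<^sub>R u x)" "integrable (leb a b) (\<lambda>x. \<psi> x *\<^sub>R v x)"
      by (intro smooth_scaleR_integrable[OF \<psi>] L2_integrable uv)+
    have "(LINT x|leb a b. \<psi> x *\<^sub>R (u x + c *\<^sub>R v x)) = (LINT x|leb a b. \<psi> x *\<^sub>R u x + c *\<^sub>R (\<psi> x *\<^sub>R v x))"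
      by (simp add: scaleR_add_right mult.commute)
    also have "\<dots> = (LINT x|leb a b. \<psi> x *\<^sub>R u x) + (LINT x|leb a b. c *\<^sub>R (\<psi> x *\<^sub>R v x))"
      using i by (intro Bochner_Integration.integral_add) (auto simp del: scaleR_scaleR)
    finally show ?thesis by (simp del: scaleR_scaleR)
  qed
  show "(LINT x|leb a b. deriv \<phi> x *\<^sub>R (w\<^sub>1 x + c *\<^sub>R w\<^sub>2 x)) = - (LINT x|leb a b. \<phi> x *\<^sub>R (g\<^sub>1 x + c *\<^sub>R g\<^sub>2 x))"
    using weak \<phi> lin[OF smooth_deriv[OF sm] L2(1,2)] lin[OF sm L2(3,4)]
    by (simp add: has_weak_derivative_def)
qed

lemma H1_linear:
  fixes w\<^sub>1 w\<^sub>2 :: "real \<Rightarrow> real ^ 'n" and c :: real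
  assumes ab: "a < b" and w: "w\<^sub>1 \<in> H1 a b" "w\<^sub>2 \<in> H1 a b"
  defines "w \<equiv> \<lambda>x. w\<^sub>1 x + c *\<^sub>R w\<^sub>2 x"
  shows "w \<in> H1 a b"
    and "AE x in leb a b. weak_deriv a b w x = weak_deriv a b w\<^sub>1 x + c *\<^sub>R weak_deriv a b w\<^sub>2 x"
    and "x \<in> {a..b} \<Longrightarrow> cont_rep a b w x = cont_rep a b w\<^sub>1 x + c *\<^sub>R cont_rep a b w\<^sub>2 x"
proof -
  have comb: "(\<lambda>x. u x + c *\<^sub>R v x) \<in> L2 a b" if "u \<in> L2 a b" "v \<in> L2 a b" for u v :: "real \<Rightarrow> real ^ 'n"
    using that by (intro L2_add L2_bounded_scale[where C = "\<bar>c\<bar>"]) auto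
  have L2: "w\<^sub>1 \<in> L2 a b" "w\<^sub>2 \<in> L2 a b" using w by (auto simp: H1_def)
  let ?g = "\<lambda>x. weak_deriv a b w\<^sub>1 x + c *\<^sub>R weak_deriv a b w\<^sub>2 x"
  have g: "?g \<in> L2 a b" by (intro comb weak_deriv_L2 w)
  have weak: "has_weak_derivative a b w ?g"
    unfolding w_def by (intro has_weak_derivative_linear L2 weak_deriv w)
  show H1: "w \<in> H1 a b" unfolding H1_def using g weak comb[OF L2] by (auto simp: w_def)
  show "AE x in leb a b. weak_deriv a b w x = ?g x"
    by (rule weak_derivative_unique[OF weak_deriv_L2[OF H1] g has_weak_derivative_weak_deriv[OF H1] weak])
  note c1 = H1_cont_rep[OF ab w(1)] and c2 = H1_cont_rep[OF ab w(2)]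
  show "cont_rep a b w x = cont_rep a b w\<^sub>1 x + c *\<^sub>R cont_rep a b w\<^sub>2 x" if x: "x \<in> {a..b}"
  proof (rule cont_rep_eqI[OF ab _ _ x])
    show "continuous_on {a..b} (\<lambda>x. cont_rep a b w\<^sub>1 x + c *\<^sub>R cont_rep a b w\<^sub>2 x)"
      by (intro continuous_intros ac_primitive_continuous_on[OF c1(1)] ac_primitive_continuous_on[OF c2(1)])
    show "AE x in leb a b. cont_rep a b w\<^sub>1 x + c *\<^sub>R cont_rep a b w\<^sub>2 x = w x"
      using c1(2) c2(2) by eventually_elim (simp add: w_def)
  qed
qed

text \<open>The chosen representatives are equal as functions, because the predicates from which they are
  chosen depend only on the class of \<open>w\<close>.\<close>

lemma H1_AE_cong:
  fixes w w' :: "real \<Rightarrow> real ^ 'n"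
  assumes "w \<in> L2 a b" "w' \<in> L2 a b" and ae: "AE x in leb a b. w x = w' x"
  shows "w \<in> H1 a b \<longleftrightarrow> w' \<in> H1 a b"
    and "weak_deriv a b w = weak_deriv a b w'" and "cont_rep a b w = cont_rep a b w'"
proof -
  have "(LINT x|leb a b. deriv \<phi> x *\<^sub>R w x) = (LINT x|leb a b. deriv \<phi> x *\<^sub>R w' x)" if "test_function a b \<phi>" for \<phi>
  proof (rule Bochner_Integration.integral_cong_AE)
    show "(\<lambda>x. deriv \<phi> x *\<^sub>R w x) \<in> borel_measurable (leb a b)" "(\<lambda>x. deriv \<phi> x *\<^sub>R w' x) \<in> borel_measurable (leb a b)"
      by (rule borel_measurable_integrable[OF smooth_scaleR_integrable[OF smooth_deriv[OF test_function_smooth[OF that]]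
              L2_integrable]], rule assms)+
    show "AE x in leb a b. deriv \<phi> x *\<^sub>R w x = deriv \<phi> x *\<^sub>R w' x" using ae by eventually_elim simp
  qed
  then have eq: "has_weak_derivative a b w g \<longleftrightarrow> has_weak_derivative a b w' g" for g
    unfolding has_weak_derivative_def by (simp cong: imp_cong)
  show "w \<in> H1 a b \<longleftrightarrow> w' \<in> H1 a b" using assms(1,2) eq by (simp add: H1_def)
  show "weak_deriv a b w = weak_deriv a b w'" by (simp add: weak_deriv_def eq)
  have "(AE x in leb a b. v x = w x) \<longleftrightarrow> (AE x in leb a b. v x = w' x)" for v
    using ae by (auto elim: eventually_elim2)
  then show "cont_rep a b w = cont_rep a b w'" by (simp add: cont_rep_def)
qed

text \<open>The product rule for \<open>r |w|\<^sup>2\<close>, applied first to \<open>|w|\<^sup>2\<close>, whose derivative is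
  \<open>2 w \<bullet> w'\<close>, and then to the product with \<open>r\<close>.\<close>

lemma weighted_energy_identity:
  fixes w :: "real \<Rightarrow> real ^ 'n"
  assumes ab: "a < b" and w: "w \<in> H1 a b" and r: "\<And>x. (r has_real_derivative r' x) (at x)" "continuous_on UNIV r'"
  shows "2 * (LINT x|leb a b. r x * (w x \<bullet> weak_deriv a b w x))
     = r b * (norm (cont_rep a b w b))\<^sup>2 - r a * (norm (cont_rep a b w a))\<^sup>2 - (LINT x|leb a b. r' x * (norm (w x))\<^sup>2)"
proof -
  let ?v = "cont_rep a b w" and ?g = "weak_deriv a b w"
  note v = H1_cont_rep[OF ab w]
  have wL2: "w \<in> L2 a b" "?g \<in> L2 a b" using w weak_deriv_L2 by (auto simp: H1_def)
  have r_ac: "ac_primitive a b r r'"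
    by (rule ac_primitive_of_derivative)
       (use r in \<open>auto simp: has_real_derivative_iff_has_vector_derivative intro: continuous_on_subset\<close>)
  have v2: "ac_primitive a b (\<lambda>t. ?v t \<bullet> ?v t) (\<lambda>t. ?v t \<bullet> ?g t + ?g t \<bullet> ?v t)"
    using ac_primitive_product[OF bounded_bilinear_inner v(1) v(1)] ab by simp
  let ?P = "\<lambda>t. r t * (?v t \<bullet> ?g t + ?g t \<bullet> ?v t) + r' t * (?v t \<bullet> ?v t)"
  note prod = ac_primitive_product_increment[OF bounded_bilinear_mult r_ac v2]
  have Pi: "integrable (leb a b) ?P"
    using prod(1) ab by (simp add: integrable_leb_iff)
  have cont_r: "continuous_on {a..b} r" "continuous_on {a..b} r'"
    using ac_primitive_continuous_on[OF r_ac] r(2) continuous_on_subset by blast+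
  have i1: "integrable (leb a b) (\<lambda>x. r x * (w x \<bullet> ?g x))"
    using bounded_product_absolutely_integrable[OF bounded_bilinear_mult cont_r(1)] L2_inner_integrable[OF wL2]
    by (simp add: integrable_leb_iff)
  have i2: "integrable (leb a b) (\<lambda>x. r' x * (norm (w x))\<^sup>2)"
    using bounded_product_absolutely_integrable[OF bounded_bilinear_mult cont_r(2)] wL2(1)
    by (simp add: integrable_leb_iff L2_iff)
  have "r b * (?v b \<bullet> ?v b) - r a * (?v a \<bullet> ?v a) = (LINT x|leb a b. ?P x)"
    using prod(2) ab LINT_leb_eq_integral[OF Pi] by simp
  also have "\<dots> = (LINT x|leb a b. 2 * (r x * (w x \<bullet> ?g x)) + r' x * (norm (w x))\<^sup>2)"
  proof (rule Bochner_Integration.integral_cong_AE)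
    show "AE x in leb a b. ?P x = 2 * (r x * (w x \<bullet> ?g x)) + r' x * (norm (w x))\<^sup>2"
      using v(2) by eventually_elim (simp add: inner_commute power2_norm_eq_inner)
    show "?P \<in> borel_measurable (leb a b)" using Pi by (rule borel_measurable_integrable)
    show "(\<lambda>x. 2 * (r x * (w x \<bullet> ?g x)) + r' x * (norm (w x))\<^sup>2) \<in> borel_measurable (leb a b)"
      using i1 i2 by (intro borel_measurable_integrable) simp
  qed
  also have "\<dots> = 2 * (LINT x|leb a b. r x * (w x \<bullet> ?g x)) + (LINT x|leb a b. r' x * (norm (w x))\<^sup>2)"
    using i1 i2 by simp
  finally show ?thesis by (simp add: power2_norm_eq_inner)
qed

section \<open>Scalar Hamiltonian densities and the Lyapunov inner product\<close>

lemma symmetric_matrix_inner: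
  fixes Q :: "real ^ 'n ^ 'n"
  assumes "transpose Q = Q"
  shows "u \<bullet> (Q *v v) = v \<bullet> (Q *v u)"
  by (metis assms dot_lmul_matrix inner_commute vector_transpose_matrix)

lemma matrix_inv_symmetric:
  fixes P :: "real ^ 'n ^ 'n"
  assumes sym: "transpose P = P" and inv: "invertible P"
  shows "matrix_inv P ** P = mat 1" "transpose (matrix_inv P) = matrix_inv P"
proof -
  have P: "P ** matrix_inv P = mat 1" "matrix_inv P ** P = mat 1"
    using inv by (auto simp: invertible_def matrix_inv_def intro: someI2_ex)
  then show "matrix_inv P ** P = mat 1" by simp
  have "transpose (matrix_inv P) ** P = mat 1"
    using P(1) sym by (metis matrix_transpose_mul transpose_mat)
  then have "transpose (matrix_inv P) = transpose (matrix_inv P) ** (P ** matrix_inv P)"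
    using P(1) by simp
  also have "\<dots> = matrix_inv P"
    using \<open>transpose (matrix_inv P) ** P = mat 1\<close> by (simp add: matrix_mul_assoc)
  finally show "transpose (matrix_inv P) = matrix_inv P" .
qed

lemma block_vector_linear:
  "block_vector (v + c *\<^sub>R v') (w + c *\<^sub>R w') = block_vector v w + c *\<^sub>R block_vector v' w'"
  by (simp add: vec_eq_iff block_vector_def split: sum.split)

text \<open>A separate density \<open>k\<close> with pointwise bounds confines almost-everywhere arguments about \<open>\<H>\<close>
  to the passage from \<open>\<H>u\<close> to \<open>k u\<close>.\<close>

locale scalar_hamiltonian =
  fixes a b m M :: real and \<H> :: "real \<Rightarrow> real ^ 'n ^ 'n" and k :: "real \<Rightarrow> real"
  assumes ab: "a < b" and m_pos: "0 < m"
    and \<H>_measurable: "\<H> \<in> borel_measurable (leb a b)"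
    and k_measurable: "k \<in> borel_measurable (leb a b)"
    and k_bounds: "\<And>x. x \<in> {a<..<b} \<Longrightarrow> m \<le> k x" "\<And>x. x \<in> {a<..<b} \<Longrightarrow> k x \<le> M"
    and \<H>_scalar: "AE x in leb a b. \<H> x = k x *\<^sub>R mat 1"
begin

lemma AE_abs_k_le: "AE x in leb a b. \<bar>k x\<bar> \<le> M"
  using k_bounds m_pos by (intro AE_I2) (fastforce simp: abs_le_iff)

lemma mat_mult_AE: "AE x in leb a b. mat_mult \<H> u x = k x *\<^sub>R u x"
  using \<H>_scalar by eventually_elim (simp add: mat_mult_def flip: scaleR_matrix_vector_assoc)

lemma scaled_L2: "u \<in> L2 a b \<Longrightarrow> (\<lambda>x. k x *\<^sub>R u x) \<in> L2 a b"
  by (rule L2_bounded_scale[OF _ k_measurable AE_abs_k_le])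

lemma mat_mult_L2:
  assumes u: "u \<in> L2 a b"
  shows "mat_mult \<H> u \<in> L2 a b"
proof (rule L2_dominated[OF scaled_L2[OF u]])
  note [measurable] = L2_measurable[OF u] \<H>_measurable
  have "(\<lambda>x. mat_mult \<H> u x $ i) \<in> borel_measurable (leb a b)" for i
  proof -
    have "(\<lambda>x. \<H> x $ i) \<in> borel_measurable (leb a b)"
      by (rule borel_measurable_continuous_on[OF _ \<H>_measurable]) (intro continuous_intros)
    then have "(\<lambda>x. \<H> x $ i \<bullet> u x) \<in> borel_measurable (leb a b)" by measurable
    then show ?thesis by (simp add: mat_mult_def matrix_mult_dot row_def vec_lambda_eta)
  qed
  then show "mat_mult \<H> u \<in> borel_measurable (leb a b)"
    unfolding borel_measurable_euclidean_space[of "mat_mult \<H> u"] by (auto simp: Basis_vec_def inner_axis)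
  show "AE x in leb a b. norm (mat_mult \<H> u x) \<le> 1 * norm (k x *\<^sub>R u x)"
    using mat_mult_AE[of u] by eventually_elim simp
qed

lemma mat_mult_linear: "mat_mult \<H> (u + c *\<^sub>R v) = (\<lambda>x. mat_mult \<H> u x + c *\<^sub>R mat_mult \<H> v x)"
  by (simp add: fun_eq_iff mat_mult_def scaleR_fun_def matrix_vector_right_distrib matrix_vector_mult_scaleR)

lemma inner_H_eq:
  assumes "u \<in> L2 a b" "v \<in> L2 a b"
  shows "inner_H a b \<H> u v = (LINT x|leb a b. k x * (u x \<bullet> v x))"
  unfolding inner_H_def
proof (rule Bochner_Integration.integral_cong_AE)
  show "(\<lambda>x. mat_mult \<H> u x \<bullet> v x) \<in> borel_measurable (leb a b)"
    by (intro borel_measurable_integrable L2_inner_integrable mat_mult_L2 assms)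
  have "integrable (leb a b) (\<lambda>x. (k x *\<^sub>R u x) \<bullet> v x)"
    by (intro L2_inner_integrable scaled_L2 assms)
  then show "(\<lambda>x. k x * (u x \<bullet> v x)) \<in> borel_measurable (leb a b)"
    by (intro borel_measurable_integrable) simp
  show "AE x in leb a b. mat_mult \<H> u x \<bullet> v x = k x * (u x \<bullet> v x)"
    using mat_mult_AE[of u] by eventually_elim simp
qed

text \<open>The form \<open>\<langle>u, v\<rangle>\<^sub>H + \<integral> e \<H>u \<bullet> Q v\<close>. With \<open>k\<close> scalar it is symmetric as soon as \<open>Q\<close> is.\<close>

definition lyapunov_ip :: "(real \<Rightarrow> real) \<Rightarrow> real ^ 'n ^ 'n \<Rightarrow> (real \<Rightarrow> real ^ 'n) \<Rightarrow> (real \<Rightarrow> real ^ 'n) \<Rightarrow> real" where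
  "lyapunov_ip e Q u v = (LINT x|leb a b. k x * (u x \<bullet> (v x + e x *\<^sub>R (Q *v v x))))"

end

text \<open>The bound on \<open>E * q\<close> keeps the perturbation below half of the energy, so that the perturbed
  form stays between one half and twice the original one.\<close>

locale lyapunov_weight = scalar_hamiltonian a b m M \<H> k
  for a b m M :: real and \<H> :: "real \<Rightarrow> real ^ 'n ^ 'n" and k :: "real \<Rightarrow> real" +
  fixes e :: "real \<Rightarrow> real" and Q :: "real ^ 'n ^ 'n" and E q :: real
  assumes e_continuous: "continuous_on {a..b} e" and e_bound: "\<And>x. x \<in> {a<..<b} \<Longrightarrow> \<bar>e x\<bar> \<le> E"
    and Q_symmetric: "transpose Q = Q"
    and Q_bound: "\<And>v. norm (Q *v v) \<le> q * norm v" and small: "E * q \<le> 1 / 2" and q_nonneg: "0 \<le> q"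
begin

abbreviation ipL :: "(real \<Rightarrow> real ^ 'n) \<Rightarrow> (real \<Rightarrow> real ^ 'n) \<Rightarrow> real" where "ipL \<equiv> lyapunov_ip e Q"

lemma e_measurable: "e \<in> borel_measurable (leb a b)"
  by (rule continuous_imp_measurable_on_sets_lebesgue[OF continuous_on_subset[OF e_continuous]]) auto

lemma e_L2: "u \<in> L2 a b \<Longrightarrow> (\<lambda>x. e x *\<^sub>R u x) \<in> L2 a b"
  by (rule L2_bounded_scale[where C = E, OF _ e_measurable]) (use e_bound in auto)

lemma Q_L2: "u \<in> L2 a b \<Longrightarrow> (\<lambda>x. Q *v u x) \<in> L2 a b"
  by (rule L2_linear) auto

lemma ipL_integrable:
  assumes "u \<in> L2 a b" "v \<in> L2 a b"
  shows "integrable (leb a b) (\<lambda>x. k x * (u x \<bullet> v x))"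
    and "integrable (leb a b) (\<lambda>x. k x * (u x \<bullet> (e x *\<^sub>R (Q *v v x))))"
    and "integrable (leb a b) (\<lambda>x. k x * (u x \<bullet> (v x + e x *\<^sub>R (Q *v v x))))"
proof -
  have *: "integrable (leb a b) (\<lambda>x. k x * (u x \<bullet> w x))" if "w \<in> L2 a b" for w
    using L2_inner_integrable[OF scaled_L2[OF assms(1)] that] by simp
  show "integrable (leb a b) (\<lambda>x. k x * (u x \<bullet> v x))" by (rule *[OF assms(2)])
  show "integrable (leb a b) (\<lambda>x. k x * (u x \<bullet> (e x *\<^sub>R (Q *v v x))))" by (intro * e_L2 Q_L2 assms)
  show "integrable (leb a b) (\<lambda>x. k x * (u x \<bullet> (v x + e x *\<^sub>R (Q *v v x))))"
    by (intro * L2_add e_L2 Q_L2 assms)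
qed

lemma ipL_pointwise_bounds:
  assumes x: "x \<in> {a<..<b}"
  shows "1 / 2 * (k x * (v \<bullet> v)) \<le> k x * (v \<bullet> (v + e x *\<^sub>R (Q *v v)))"
    and "k x * (v \<bullet> (v + e x *\<^sub>R (Q *v v))) \<le> 2 * (k x * (v \<bullet> v))"
proof -
  have "\<bar>v \<bullet> (e x *\<^sub>R (Q *v v))\<bar> \<le> \<bar>e x\<bar> * (norm v * norm (Q *v v))"
    using Cauchy_Schwarz_ineq2[of v "Q *v v"] by (simp add: abs_mult mult_left_mono)
  also have "\<dots> \<le> E * (norm v * (q * norm v))"
    using e_bound[OF x] Q_bound[of v] q_nonneg
    by (intro mult_mono) (auto intro: order_trans[OF abs_ge_zero])
  also have "\<dots> = (E * q) * (v \<bullet> v)" by (simp add: dot_square_norm power2_eq_square)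
  also have "\<dots> \<le> 1 / 2 * (v \<bullet> v)" using small by (intro mult_right_mono) auto
  finally have *: "\<bar>v \<bullet> (e x *\<^sub>R (Q *v v))\<bar> \<le> 1 / 2 * (v \<bullet> v)" .
  have k: "0 \<le> k x" using k_bounds(1)[OF x] m_pos by simp
  have "1 / 2 * (v \<bullet> v) \<le> v \<bullet> (v + e x *\<^sub>R (Q *v v))" "v \<bullet> (v + e x *\<^sub>R (Q *v v)) \<le> 2 * (v \<bullet> v)"
    using * inner_ge_zero[of v] unfolding inner_add_right by linarith+
  from mult_left_mono[OF this(1) k] mult_left_mono[OF this(2) k]
  show "1 / 2 * (k x * (v \<bullet> v)) \<le> k x * (v \<bullet> (v + e x *\<^sub>R (Q *v v)))"
    and "k x * (v \<bullet> (v + e x *\<^sub>R (Q *v v))) \<le> 2 * (k x * (v \<bullet> v))"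
    by (simp_all add: mult.left_commute)
qed

lemma ipL_bounds:
  assumes u: "u \<in> L2 a b"
  shows "1 / 2 * inner_H a b \<H> u u \<le> ipL u u" and "ipL u u \<le> 2 * inner_H a b \<H> u u"
proof -
  note int = ipL_integrable[OF u u]
  have "(LINT x|leb a b. 1 / 2 * (k x * (u x \<bullet> u x))) \<le> ipL u u"
    unfolding lyapunov_ip_def
    by (intro integral_mono int Bochner_Integration.integrable_mult_right ipL_pointwise_bounds) auto
  then show "1 / 2 * inner_H a b \<H> u u \<le> ipL u u" by (simp add: inner_H_eq u)
  have "ipL u u \<le> (LINT x|leb a b. 2 * (k x * (u x \<bullet> u x)))"
    unfolding lyapunov_ip_def
    by (intro integral_mono int Bochner_Integration.integrable_mult_right ipL_pointwise_bounds) auto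
  then show "ipL u u \<le> 2 * inner_H a b \<H> u u" by (simp add: inner_H_eq u)
qed

lemma inner_H_bounds:
  assumes u: "u \<in> L2 a b"
  shows "m * L2_ip a b u u \<le> inner_H a b \<H> u u" "inner_H a b \<H> u u \<le> M * L2_ip a b u u"
proof -
  note int = ipL_integrable(1)[OF u u] L2_inner_integrable[OF u u]
  have "(LINT x|leb a b. m * (u x \<bullet> u x)) \<le> (LINT x|leb a b. k x * (u x \<bullet> u x))"
    by (intro integral_mono int Bochner_Integration.integrable_mult_right mult_right_mono k_bounds) auto
  then show "m * L2_ip a b u u \<le> inner_H a b \<H> u u" by (simp add: inner_H_eq u L2_ip_def)
  have "(LINT x|leb a b. k x * (u x \<bullet> u x)) \<le> (LINT x|leb a b. M * (u x \<bullet> u x))"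
    by (intro integral_mono int Bochner_Integration.integrable_mult_right mult_right_mono k_bounds) auto
  then show "inner_H a b \<H> u u \<le> M * L2_ip a b u u" by (simp add: inner_H_eq u L2_ip_def)
qed

lemma semi_inner_space_ipL: "semi_inner_space (L2 a b) ipL"
proof
  show "subspace (L2 a b :: (real \<Rightarrow> real ^ 'n) set)" by (rule subspace_L2)
next
  fix u v w :: "real \<Rightarrow> real ^ 'n" and r :: real
  assume uvw: "u \<in> L2 a b" "v \<in> L2 a b" "w \<in> L2 a b"
  show "ipL (u + v) w = ipL u w + ipL v w"
    using ipL_integrable(3)[OF uvw(1,3)] ipL_integrable(3)[OF uvw(2,3)]
    by (simp add: lyapunov_ip_def inner_add_left distrib_left)
next
  fix u v :: "real \<Rightarrow> real ^ 'n" and r :: real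
  show "ipL (r *\<^sub>R u) v = r * ipL u v"
    by (simp add: lyapunov_ip_def scaleR_fun_def mult.left_commute[of _ r])
  show "ipL u v = ipL v u"
    unfolding lyapunov_ip_def
    by (intro Bochner_Integration.integral_cong refl)
       (simp add: inner_add_right inner_commute[of "u _" "v _"] symmetric_matrix_inner[OF Q_symmetric, of "u _" "v _"])
  assume "u \<in> L2 a b"
  then have "0 \<le> m * L2_ip a b u u" "m * L2_ip a b u u \<le> 2 * ipL u u"
    using inner_H_bounds[of u] ipL_bounds[of u] m_pos by (auto simp: L2_ip_self intro!: mult_nonneg_nonneg)
  then show "0 \<le> ipL u u" by linarith
qed

lemma M_pos: "0 < M"
  using k_bounds[of "(a + b) / 2"] ab m_pos by (auto simp: field_simps)

lemma seminorm_ipL_equivalent_L2: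
  fixes u :: "real \<Rightarrow> real ^ 'n"
  assumes u: "u \<in> L2 a b"
  defines "c \<equiv> sqrt (max (2 * M) (2 / m))"
  shows "seminorm_of ipL u \<le> c * seminorm_of (L2_ip a b) u" "seminorm_of (L2_ip a b) u \<le> c * seminorm_of ipL u"
proof -
  have L2: "0 \<le> L2_ip a b u u" by (simp add: L2_ip_self)
  have "0 \<le> m * L2_ip a b u u" using L2 m_pos by simp
  then have pos: "0 \<le> ipL u u" using ipL_bounds(1)[OF u] inner_H_bounds(1)[OF u] by linarith
  have "ipL u u \<le> (2 * M) * L2_ip a b u u" using ipL_bounds(2)[OF u] inner_H_bounds(2)[OF u] by simp
  also have "\<dots> \<le> max (2 * M) (2 / m) * L2_ip a b u u" using L2 by (intro mult_right_mono) auto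
  finally show "seminorm_of ipL u \<le> c * seminorm_of (L2_ip a b) u"
    unfolding c_def by (rule seminorm_le_of_ip_le[of ipL u _ "L2_ip a b"])
  have "m * L2_ip a b u u \<le> 2 * ipL u u" using ipL_bounds(1)[OF u] inner_H_bounds(1)[OF u] by simp
  then have "L2_ip a b u u \<le> (2 / m) * ipL u u" using m_pos by (simp add: field_simps)
  also have "\<dots> \<le> max (2 * M) (2 / m) * ipL u u" using pos by (intro mult_right_mono) auto
  finally show "seminorm_of (L2_ip a b) u \<le> c * seminorm_of ipL u"
    unfolding c_def by (rule seminorm_le_of_ip_le[of "L2_ip a b" u _ ipL])
qed

lemma complete_ipL: "complete_semi_inner_space (L2 a b) ipL"
proof (rule complete_of_equivalent_seminorm[OF semi_inner_space_ipL semi_inner_space_L2])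
  show "0 < sqrt (max (2 * M) (2 / m))" using M_pos by simp
qed (use seminorm_ipL_equivalent_L2 L2_complete in blast)+

lemma seminorm_ipL_eq_0_iff:
  assumes u: "u \<in> L2 a b"
  shows "seminorm_of ipL u = 0 \<longleftrightarrow> (AE x in leb a b. u x = 0)"
proof -
  have "seminorm_of ipL u = 0 \<longleftrightarrow> seminorm_of (L2_ip a b) u = 0"
    using seminorm_ipL_equivalent_L2[OF u] semi_inner_space.N_nonneg[OF semi_inner_space_ipL u]
      semi_inner_space.N_nonneg[OF semi_inner_space_L2 u] by auto
  then show ?thesis using seminorm_L2_eq_0_iff[OF u] by simp
qed

lemma seminorm_ipL_equivalent_H:
  assumes u: "u \<in> L2 a b"
  shows "seminorm_of ipL u \<le> sqrt 2 * seminorm_of (inner_H a b \<H>) u"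
    and "seminorm_of (inner_H a b \<H>) u \<le> sqrt 2 * seminorm_of ipL u"
  using ipL_bounds[OF u] by (auto intro!: seminorm_le_of_ip_le)

end

context scalar_hamiltonian
begin

lemma pH_dom_subset: "pH_dom a b \<H> W \<subseteq> L2 a b"
  by (auto simp: pH_dom_def)

lemma pH_dom_H1: "u \<in> pH_dom a b \<H> W \<Longrightarrow> mat_mult \<H> u \<in> H1 a b"
  by (auto simp: pH_dom_def)

lemma pH_op_L2:
  assumes "u \<in> pH_dom a b \<H> W"
  shows "pH_op a b P1 P0 \<H> u \<in> L2 a b"
  unfolding pH_op_def
  by (intro L2_add L2_linear[OF _ matrix_vector_mul_bounded_linear] weak_deriv_L2 pH_dom_H1[OF assms] mat_mult_L2)
     (use assms pH_dom_subset in blast)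

lemma pH_dom_cong:
  assumes u: "u \<in> L2 a b" and v: "v \<in> L2 a b" and ae: "AE x in leb a b. u x = v x"
  shows "u \<in> pH_dom a b \<H> W \<longleftrightarrow> v \<in> pH_dom a b \<H> W"
    and "AE x in leb a b. pH_op a b P1 P0 \<H> u x = pH_op a b P1 P0 \<H> v x"
proof -
  have mm: "AE x in leb a b. mat_mult \<H> u x = mat_mult \<H> v x"
    using ae by eventually_elim (simp add: mat_mult_def)
  note cong = H1_AE_cong[OF mat_mult_L2[OF u] mat_mult_L2[OF v] mm]
  show "u \<in> pH_dom a b \<H> W \<longleftrightarrow> v \<in> pH_dom a b \<H> W" using u v cong by (simp add: pH_dom_def)
  show "AE x in leb a b. pH_op a b P1 P0 \<H> u x = pH_op a b P1 P0 \<H> v x"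
    using mm by eventually_elim (simp add: pH_op_def cong(2))
qed

text \<open>The chosen weak derivative of a sum agrees with the sum of the chosen weak derivatives only
  almost everywhere, whereas the boundary values are exactly linear.\<close>

lemma pH_linear:
  assumes u: "u \<in> pH_dom a b \<H> W" and v: "v \<in> pH_dom a b \<H> W"
  shows "u + c *\<^sub>R v \<in> pH_dom a b \<H> W"
    and "AE x in leb a b. pH_op a b P1 P0 \<H> (u + c *\<^sub>R v) x
       = pH_op a b P1 P0 \<H> u x + c *\<^sub>R pH_op a b P1 P0 \<H> v x"
proof -
  note lin = H1_linear[OF ab pH_dom_H1[OF u] pH_dom_H1[OF v], where c = c, folded mat_mult_linear]
  have "u + c *\<^sub>R v \<in> L2 a b"
    using u v pH_dom_subset by (intro subspace_add[OF subspace_L2] subspace_scale[OF subspace_L2]) auto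
  moreover have "W *v block_vector (cont_rep a b (mat_mult \<H> (u + c *\<^sub>R v)) b) (cont_rep a b (mat_mult \<H> (u + c *\<^sub>R v)) a) = 0"
    using lin(3)[where x = a] lin(3)[where x = b] ab u v
    by (simp add: pH_dom_def block_vector_linear matrix_vector_right_distrib matrix_vector_mult_scaleR)
  ultimately show "u + c *\<^sub>R v \<in> pH_dom a b \<H> W" using lin(1) by (simp add: pH_dom_def)
  show "AE x in leb a b. pH_op a b P1 P0 \<H> (u + c *\<^sub>R v) x
       = pH_op a b P1 P0 \<H> u x + c *\<^sub>R pH_op a b P1 P0 \<H> v x"
    using lin(2)
    by eventually_elim
       (simp add: pH_op_def mat_mult_linear matrix_vector_right_distrib matrix_vector_mult_scaleR scaleR_add_right)
qed

lemma zero_mem_pH_dom: "0 \<in> pH_dom a b \<H> W"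
proof -
  let ?z = "\<lambda>x::real. 0 :: real ^ 'n"
  have mm: "mat_mult \<H> 0 = ?z" by (simp add: mat_mult_def fun_eq_iff)
  have "?z \<in> H1 a b"
    unfolding H1_def using L2_0 by (auto simp: has_weak_derivative_def intro!: bexI[of _ ?z])
  moreover have "cont_rep a b ?z x = 0" if "x \<in> {a..b}" for x
    by (rule cont_rep_eqI[OF ab _ _ that]) auto
  moreover have "block_vector (0 :: real ^ 'n) 0 = 0" by (simp add: vec_eq_iff block_vector_def split: sum.split)
  ultimately show ?thesis
    using ab less_imp_le[OF ab] subspace_0[OF subspace_L2, of a b] by (simp add: pH_dom_def mm)
qed

lemma pH_op_0: "AE x in leb a b. pH_op a b P1 P0 \<H> 0 x = 0"
  using pH_linear(2)[OF zero_mem_pH_dom zero_mem_pH_dom, of P1 P0 1] by simp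

lemma subspace_pH_dom: "subspace (pH_dom a b \<H> W)"
  unfolding subspace_def
proof (intro conjI ballI allI zero_mem_pH_dom)
  show "u + v \<in> pH_dom a b \<H> W" if "u \<in> pH_dom a b \<H> W" "v \<in> pH_dom a b \<H> W" for u v
    using pH_linear(1)[OF that, of 1] by simp
  show "c *\<^sub>R v \<in> pH_dom a b \<H> W" if "v \<in> pH_dom a b \<H> W" for c v
    using pH_linear(1)[OF zero_mem_pH_dom that, of c] by simp
qed

end

text \<open>Multiplication by \<open>Q\<close> cancels the leading coefficient \<open>P1\<close>, so the additional term in the form is
  \<open>\<integral> e w \<bullet> w' + \<integral> e w \<bullet> Q P0 w\<close> with \<open>w = \<H>u\<close>. The first integral is a
  boundary term minus \<open>(p + 1) \<integral> |e| |w|\<^sup>2\<close>, and the second is at most \<open>p \<integral> |e| |w|\<^sup>2\<close>. What is left over,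
  \<open>- \<integral> |e| |w|\<^sup>2\<close>, dominates the energy because \<open>|w|\<^sup>2 = k\<^sup>2 |u|\<^sup>2 \<ge> m k |u|\<^sup>2\<close>.\<close>

lemma (in lyapunov_weight) lyapunov_dissipation:
  fixes P1 P0 :: "real ^ 'n ^ 'n"
  assumes u: "u \<in> pH_dom a b \<H> W" and QP1: "Q ** P1 = mat 1"
    and e: "\<And>x. (e has_real_derivative (2 * p + 2) * \<bar>e x\<bar>) (at x)"
    and QP0: "\<And>v. norm ((Q ** P0) *v v) \<le> p * norm v" and p: "0 \<le> p"
    and \<epsilon>: "0 \<le> \<epsilon>" "\<And>x. x \<in> {a<..<b} \<Longrightarrow> \<epsilon> \<le> \<bar>e x\<bar>"
    and boundary: "inner_H a b \<H> u (pH_op a b P1 P0 \<H> u)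
      + (e b * (norm (cont_rep a b (mat_mult \<H> u) b))\<^sup>2 - e a * (norm (cont_rep a b (mat_mult \<H> u) a))\<^sup>2) / 2 \<le> 0"
  shows "ipL u (pH_op a b P1 P0 \<H> u) \<le> - (\<epsilon> * m / 2) * ipL u u"
proof -
  let ?A = "pH_op a b P1 P0 \<H> u"
  define w where "w = mat_mult \<H> u"
  define g where "g = weak_deriv a b w"
  have uL2: "u \<in> L2 a b" using u pH_dom_subset by blast
  have AL2: "?A \<in> L2 a b" by (rule pH_op_L2[OF u])
  have wH1: "w \<in> H1 a b" unfolding w_def by (rule pH_dom_H1[OF u])
  have wL2: "w \<in> L2 a b" and gL2: "g \<in> L2 a b"
    using mat_mult_L2[OF uL2] weak_deriv_L2[OF wH1] by (auto simp: w_def g_def)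
  have w_AE: "AE x in leb a b. w x = k x *\<^sub>R u x" unfolding w_def by (rule mat_mult_AE)
  have QA: "Q *v ?A x = g x + (Q ** P0) *v w x" for x
  proof -
    have "Q *v (P1 *v g x) = g x" using QP1 by (simp add: matrix_vector_mul_assoc)
    then show ?thesis
      by (simp add: pH_op_def w_def g_def matrix_vector_right_distrib matrix_vector_mul_assoc)
  qed
  let ?Z = "\<lambda>x. (Q ** P0) *v w x"
  have ZL2: "?Z \<in> L2 a b" by (rule L2_linear[OF wL2]) auto
  have e'_cont: "continuous_on UNIV (\<lambda>x. (2 * p + 2) * \<bar>e x\<bar>)"
    using e DERIV_isCont by (intro continuous_intros continuous_at_imp_continuous_on) blast
  have scaled: "integrable (leb a b) (\<lambda>x. e x * (y x \<bullet> z x))" "integrable (leb a b) (\<lambda>x. \<bar>e x\<bar> * (y x \<bullet> z x))"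
    if "y \<in> L2 a b" "z \<in> L2 a b" for y z :: "real \<Rightarrow> real ^ 'n"
  proof -
    show 1: "integrable (leb a b) (\<lambda>x. e x * (y x \<bullet> z x))"
      using L2_inner_integrable[OF e_L2[OF that(1)] that(2)] by simp
    have "(\<lambda>x. \<bar>e x\<bar> *\<^sub>R y x) \<in> L2 a b"
      by (rule L2_bounded_scale[OF that(1), where C = E]) (use e_measurable e_bound in auto)
    from L2_inner_integrable[OF this that(2)]
    show "integrable (leb a b) (\<lambda>x. \<bar>e x\<bar> * (y x \<bullet> z x))" by simp
  qed
  have "ipL u ?A = (LINT x|leb a b. k x * (u x \<bullet> ?A x) + k x * (u x \<bullet> (e x *\<^sub>R (Q *v ?A x))))"
    unfolding lyapunov_ip_def by (simp add: inner_add_right distrib_left)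
  also have "\<dots> = inner_H a b \<H> u ?A + (LINT x|leb a b. k x * (u x \<bullet> (e x *\<^sub>R (Q *v ?A x))))"
    using ipL_integrable[OF uL2 AL2] by (simp add: inner_H_eq[OF uL2 AL2])
  also have "(LINT x|leb a b. k x * (u x \<bullet> (e x *\<^sub>R (Q *v ?A x))))
      = (LINT x|leb a b. e x * (w x \<bullet> g x) + e x * (w x \<bullet> ?Z x))"
  proof (rule Bochner_Integration.integral_cong_AE)
    show "(\<lambda>x. k x * (u x \<bullet> (e x *\<^sub>R (Q *v ?A x)))) \<in> borel_measurable (leb a b)"
      by (intro borel_measurable_integrable ipL_integrable uL2 AL2)
    show "(\<lambda>x. e x * (w x \<bullet> g x) + e x * (w x \<bullet> ?Z x)) \<in> borel_measurable (leb a b)"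
      by (intro borel_measurable_integrable Bochner_Integration.integrable_add scaled wL2 gL2 ZL2)
    show "AE x in leb a b. k x * (u x \<bullet> (e x *\<^sub>R (Q *v ?A x))) = e x * (w x \<bullet> g x) + e x * (w x \<bullet> ?Z x)"
      using w_AE by eventually_elim (simp add: QA inner_add_right algebra_simps)
  qed
  also have "\<dots> = (LINT x|leb a b. e x * (w x \<bullet> g x)) + (LINT x|leb a b. e x * (w x \<bullet> ?Z x))"
    by (intro Bochner_Integration.integral_add scaled wL2 gL2 ZL2)
  finally have split: "ipL u ?A = inner_H a b \<H> u ?A
      + ((LINT x|leb a b. e x * (w x \<bullet> g x)) + (LINT x|leb a b. e x * (w x \<bullet> ?Z x)))" .
  have energy: "2 * (LINT x|leb a b. e x * (w x \<bullet> g x))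
      = e b * (norm (cont_rep a b w b))\<^sup>2 - e a * (norm (cont_rep a b w a))\<^sup>2
        - (2 * p + 2) * (LINT x|leb a b. \<bar>e x\<bar> * (w x \<bullet> w x))"
    unfolding g_def weighted_energy_identity[OF ab wH1 e e'_cont]
    by (simp add: power2_norm_eq_inner mult.assoc)
  have "(LINT x|leb a b. e x * (w x \<bullet> ?Z x)) \<le> (LINT x|leb a b. p * (\<bar>e x\<bar> * (w x \<bullet> w x)))"
  proof (intro integral_mono Bochner_Integration.integrable_mult_right scaled wL2 ZL2)
    fix x
    have "e x * (w x \<bullet> ?Z x) \<le> \<bar>e x\<bar> * \<bar>w x \<bullet> ?Z x\<bar>" by (metis abs_ge_self abs_mult)
    also have "\<dots> \<le> \<bar>e x\<bar> * (norm (w x) * (p * norm (w x)))"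
      using order_trans[OF Cauchy_Schwarz_ineq2[of "w x" "?Z x"] mult_left_mono[OF QP0[of "w x"] norm_ge_zero]]
      by (intro mult_left_mono) auto
    finally show "e x * (w x \<bullet> ?Z x) \<le> p * (\<bar>e x\<bar> * (w x \<bullet> w x))"
      by (simp add: dot_square_norm power2_eq_square mult_ac)
  qed
  then have lower_order: "(LINT x|leb a b. e x * (w x \<bullet> ?Z x)) \<le> p * (LINT x|leb a b. \<bar>e x\<bar> * (w x \<bullet> w x))"
    by simp
  have "\<epsilon> * m * inner_H a b \<H> u u = (LINT x|leb a b. \<epsilon> * m * (k x * (u x \<bullet> u x)))"
    by (simp add: inner_H_eq[OF uL2 uL2])
  also have "\<dots> \<le> (LINT x|leb a b. \<bar>e x\<bar> * (w x \<bullet> w x))"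
  proof (intro integral_mono_AE Bochner_Integration.integrable_mult_right ipL_integrable scaled uL2 wL2)
    show "AE x in leb a b. \<epsilon> * m * (k x * (u x \<bullet> u x)) \<le> \<bar>e x\<bar> * (w x \<bullet> w x)"
      using w_AE AE_space
    proof eventually_elim
      case (elim x)
      then have x: "x \<in> {a<..<b}" by simp
      have "\<epsilon> * m * (k x * (u x \<bullet> u x)) \<le> \<bar>e x\<bar> * k x * (k x * (u x \<bullet> u x))"
        using \<epsilon>(1) \<epsilon>(2)[OF x] k_bounds(1)[OF x] m_pos
        by (intro mult_right_mono mult_mono mult_nonneg_nonneg) auto
      then show ?case by (simp add: elim(1) mult_ac)
    qed
  qed
  finally have coercive: "\<epsilon> * m * inner_H a b \<H> u u \<le> (LINT x|leb a b. \<bar>e x\<bar> * (w x \<bullet> w x))" .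
  have "\<epsilon> * m / 2 * ipL u u \<le> \<epsilon> * m * inner_H a b \<H> u u"
    using mult_left_mono[OF ipL_bounds(2)[OF uL2], of "\<epsilon> * m / 2"] \<epsilon>(1) m_pos by simp
  with coercive have "\<epsilon> * m / 2 * ipL u u \<le> (LINT x|leb a b. \<bar>e x\<bar> * (w x \<bullet> w x))" by linarith
  moreover have "(LINT x|leb a b. e x * (w x \<bullet> g x))
      = (e b * (norm (cont_rep a b w b))\<^sup>2 - e a * (norm (cont_rep a b w a))\<^sup>2) / 2
        - p * (LINT x|leb a b. \<bar>e x\<bar> * (w x \<bullet> w x)) - (LINT x|leb a b. \<bar>e x\<bar> * (w x \<bullet> w x))"
    using energy by (simp add: algebra_simps)
  ultimately show ?thesis
    using split lower_order boundary[folded w_def] by simp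
qed

text \<open>The sign of \<open>e\<close> decides which end point contributes: for positive \<open>e\<close> the term at \<open>a\<close> has
  the good sign, for negative \<open>e\<close> the term at \<open>b\<close>. In both cases the maximum of \<open>|e|\<close> on
  \<open>[a, b]\<close> is \<open>E\<close>, attained at \<open>\<eta>\<close>.\<close>

lemma boundary_weight_exists:
  fixes a b c q p \<eta> :: real
  assumes ab: "a < b" and c: "0 < c" and q: "0 \<le> q" and p: "0 \<le> p" and \<eta>: "\<eta> \<in> {a, b}"
  obtains e E \<epsilon> where "\<And>x. (e has_real_derivative (2 * p + 2) * \<bar>e x\<bar>) (at x)"
    "\<And>x. x \<in> {a<..<b} \<Longrightarrow> \<bar>e x\<bar> \<le> E" "E * q \<le> 1 / 2" "0 < \<epsilon>" "\<And>x. x \<in> {a<..<b} \<Longrightarrow> \<epsilon> \<le> \<bar>e x\<bar>"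
    "\<And>y :: real \<Rightarrow> real. (\<And>x. 0 \<le> y x) \<Longrightarrow> e b * y b - e a * y a \<le> 2 * c * y \<eta>"
proof -
  define l where "l = 2 * p + 2"
  have l: "0 < l" using p by (simp add: l_def)
  define E where "E = min (1 / (2 * (q + 1))) (2 * c)"
  have E: "0 < E" "E \<le> 2 * c" using q c by (auto simp: E_def)
  have "E * q \<le> 1 / (2 * (q + 1)) * q" using q by (intro mult_right_mono) (auto simp: E_def)
  also have "\<dots> \<le> 1 / 2" using q by (simp add: field_simps)
  finally have Eq: "E * q \<le> 1 / 2" .
  define \<epsilon> where "\<epsilon> = E * exp (- l * (b - a))"
  have \<epsilon>: "0 < \<epsilon>" using E by (simp add: \<epsilon>_def)
  show ?thesis
  proof (cases "\<eta> = b")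
    case True
    define e where "e x = E * exp (l * (x - b))" for x
    have abs: "\<bar>e x\<bar> = e x" for x using E by (simp add: e_def)
    show ?thesis
    proof (rule that[of e E \<epsilon>])
      show "(e has_real_derivative (2 * p + 2) * \<bar>e x\<bar>) (at x)" for x
        unfolding abs unfolding e_def[abs_def] l_def by (auto intro!: derivative_eq_intros simp: algebra_simps)
      show "\<bar>e x\<bar> \<le> E" if "x \<in> {a<..<b}" for x
        unfolding abs using E l that by (simp add: e_def mult_nonneg_nonpos)
      show "\<epsilon> \<le> \<bar>e x\<bar>" if "x \<in> {a<..<b}" for x
      proof -
        have "l * (a - b) \<le> l * (x - b)" using l that by (intro mult_left_mono) auto
        then show ?thesis unfolding abs using E by (simp add: e_def \<epsilon>_def algebra_simps)
      qed
      show "e b * y b - e a * y a \<le> 2 * c * y \<eta>" if y: "\<And>x. 0 \<le> y x" for y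
      proof -
        have "0 \<le> e a * y a" using E y by (simp add: e_def)
        moreover have "e b * y b \<le> 2 * c * y b" using E y by (intro mult_right_mono) (auto simp: e_def)
        ultimately show ?thesis using True by simp
      qed
    qed (fact Eq \<epsilon>)+
  next
    case False
    then have \<eta>: "\<eta> = a" using \<eta> by simp
    define e where "e x = - (E * exp (l * (a - x)))" for x
    have abs: "\<bar>e x\<bar> = - e x" for x using E by (simp add: e_def)
    show ?thesis
    proof (rule that[of e E \<epsilon>])
      show "(e has_real_derivative (2 * p + 2) * \<bar>e x\<bar>) (at x)" for x
        unfolding abs unfolding e_def[abs_def] l_def by (auto intro!: derivative_eq_intros simp: algebra_simps)
      show "\<bar>e x\<bar> \<le> E" if "x \<in> {a<..<b}" for x
        unfolding abs using E l that by (simp add: e_def mult_nonneg_nonpos)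
      show "\<epsilon> \<le> \<bar>e x\<bar>" if "x \<in> {a<..<b}" for x
      proof -
        have "l * (a - b) \<le> l * (a - x)" using l that by (intro mult_left_mono) auto
        then show ?thesis unfolding abs using E by (simp add: e_def \<epsilon>_def algebra_simps)
      qed
      show "e b * y b - e a * y a \<le> 2 * c * y \<eta>" if y: "\<And>x. 0 \<le> y x" for y
      proof -
        have "e b * y b \<le> 0" using E y by (simp add: e_def)
        moreover have "- e a * y a \<le> 2 * c * y a" using E y by (intro mult_right_mono) (auto simp: e_def)
        ultimately show ?thesis using \<eta> by simp
      qed
    qed (fact Eq \<epsilon>)+
  qed
qed

text \<open>The density is read off from a diagonal entry of \<open>\<H>\<close>; every index gives the same function almost
  everywhere, and \<open>undefined\<close> just names one. Unlike a function that
  represents \<open>\<H>\<close> almost everywhere, the entry is measurable and satisfies the bounds at every point.\<close>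

lemma scalar_hamiltonianI:
  fixes \<H> :: "real \<Rightarrow> real ^ 'n ^ 'n"
  assumes "a < b" "0 < m" "\<H> \<in> borel_measurable (leb a b)"
    and bounds: "\<And>x. x \<in> {a<..<b} \<Longrightarrow> mat_le (mat m) (\<H> x) \<and> mat_le (\<H> x) (mat M)"
    and scalar: "AE x in leb a b. \<H> x = h x *\<^sub>R mat 1"
  shows "scalar_hamiltonian a b m M \<H> (\<lambda>x. \<H> x $ undefined $ undefined)"
proof
  let ?i = "undefined :: 'n"
  have entry: "axis ?i 1 \<bullet> (A *v axis ?i 1) = A $ ?i $ ?i" for A :: "real ^ 'n ^ 'n"
    by (simp add: matrix_vector_mult_basis inner_axis' column_def)
  show "(\<lambda>x. \<H> x $ ?i $ ?i) \<in> borel_measurable (leb a b)"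
    by (rule borel_measurable_continuous_on[OF _ assms(3)]) (intro continuous_intros)
  show "m \<le> \<H> x $ ?i $ ?i" "\<H> x $ ?i $ ?i \<le> M" if "x \<in> {a<..<b}" for x
  proof -
    have "0 \<le> axis ?i 1 \<bullet> ((\<H> x - mat m) *v axis ?i 1)" "0 \<le> axis ?i 1 \<bullet> ((mat M - \<H> x) *v axis ?i 1)"
      using bounds[OF that] unfolding mat_le_def psd_def by blast+
    then show "m \<le> \<H> x $ ?i $ ?i" "\<H> x $ ?i $ ?i \<le> M" by (simp_all add: entry mat_def)
  qed
  show "AE x in leb a b. \<H> x = (\<H> x $ ?i $ ?i) *\<^sub>R mat 1"
    using scalar by eventually_elim (simp add: mat_def)
qed (use assms in auto)

section \<open>Exponential stability\<close>

theorem theorem1p4: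
  fixes a b m M0 c \<eta> :: real
    and P1 P0 :: "real ^ 'n ^ 'n"
    and \<H> :: "real \<Rightarrow> real ^ 'n ^ 'n"
    and W :: "real ^ ('n + 'n) ^ 'n"
  assumes "a < b"
    and "transpose P1 = P1" and "invertible P1"
    and "P0 = - transpose P0"
    and "\<H> \<in> borel_measurable (lebesgue_on {a<..<b})"
    and "m > 0" and "M0 > 0"
    and "\<And>x. x \<in> {a<..<b} \<Longrightarrow>
           mat_le (mat m) (\<H> x) \<and> \<H> x = transpose (\<H> x) \<and> mat_le (\<H> x) (mat M0)"
    and scalar_valued: "\<exists>h :: real \<Rightarrow> real. bounded (h ` {a<..<b}) \<and>
           (AE x in lebesgue_on {a<..<b}. \<H> x = h x *\<^sub>R mat 1)"
    and "rank W = CARD('n)"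
    and "let B = W ** matrix_inv (block_matrix P1 (- P1) (mat 1) (mat 1))
         in psd (B ** block_matrix 0 (mat 1) (mat 1) 0 ** transpose B)"
    and "m_dissipative (L2 a b) (inner_H a b \<H>) (pH_dom a b \<H> W) (pH_op a b P1 P0 \<H>)"
    and "c > 0" and "\<eta> \<in> {a, b}"
    and "\<And>u. u \<in> pH_dom a b \<H> W \<Longrightarrow>
           inner_H a b \<H> u (pH_op a b P1 P0 \<H> u)
             \<le> - c * (norm (cont_rep a b (mat_mult \<H> u) \<eta>))\<^sup>2"
  shows "\<exists>S. generates (L2 a b) (inner_H a b \<H>) (pH_dom a b \<H> W) (pH_op a b P1 P0 \<H>) S
           \<and> exponentially_stable (L2 a b) (inner_H a b \<H>) S"
proof -
  let ?V = "L2 a b :: (real \<Rightarrow> real ^ 'n) set" and ?D = "pH_dom a b \<H> W" and ?A = "pH_op a b P1 P0 \<H>"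
  note damping = assms(15)
  obtain h where "AE x in leb a b. \<H> x = h x *\<^sub>R mat 1" using scalar_valued by blast
  then have sh: "scalar_hamiltonian a b m M0 \<H> (\<lambda>x. \<H> x $ undefined $ undefined)"
    using assms(1,5,6,8) by (intro scalar_hamiltonianI) auto
  define k where "k x = \<H> x $ undefined $ undefined" for x
  define Q where "Q = matrix_inv P1"
  note Q = matrix_inv_symmetric[OF assms(2,3), folded Q_def]
  define q where "q = onorm ((*v) Q)"
  define p where "p = onorm ((*v) (Q ** P0))"
  have onorms: "0 \<le> q" "0 \<le> p" unfolding q_def p_def by (auto intro: onorm_pos_le)
  obtain e E \<epsilon> where e: "\<And>x. (e has_real_derivative (2 * p + 2) * \<bar>e x\<bar>) (at x)"
    "\<And>x. x \<in> {a<..<b} \<Longrightarrow> \<bar>e x\<bar> \<le> E" "E * q \<le> 1 / 2" "0 < \<epsilon>" "\<And>x. x \<in> {a<..<b} \<Longrightarrow> \<epsilon> \<le> \<bar>e x\<bar>"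
    "\<And>y :: real \<Rightarrow> real. (\<And>x. 0 \<le> y x) \<Longrightarrow> e b * y b - e a * y a \<le> 2 * c * y \<eta>"
    using boundary_weight_exists[OF assms(1,13) onorms assms(14)] by blast
  interpret lyapunov_weight a b m M0 \<H> k e Q E q
  proof (intro lyapunov_weight.intro lyapunov_weight_axioms.intro)
    show "scalar_hamiltonian a b m M0 \<H> k" using sh by (simp add: k_def[abs_def])
    show "continuous_on {a..b} e"
      using e(1) DERIV_isCont by (intro continuous_at_imp_continuous_on) blast
    show "norm (Q *v v) \<le> q * norm v" for v unfolding q_def by (rule onorm) auto
  qed (use e onorms Q in auto)
  define \<delta> where "\<delta> = \<epsilon> * m / 2"
  have \<delta>: "0 < \<delta>" using e(4) assms(6) by (simp add: \<delta>_def)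
  have diss: "ipL u (?A u) \<le> - \<delta> * ipL u u" if u: "u \<in> ?D" for u
    unfolding \<delta>_def
  proof (rule lyapunov_dissipation[OF u Q(1) e(1) _ onorms(2) _ e(5)])
    show "norm ((Q ** P0) *v v) \<le> p * norm v" for v unfolding p_def by (rule onorm) auto
    show "0 \<le> \<epsilon>" using e(4) by simp
    show "inner_H a b \<H> u (?A u) + (e b * (norm (cont_rep a b (mat_mult \<H> u) b))\<^sup>2
        - e a * (norm (cont_rep a b (mat_mult \<H> u) a))\<^sup>2) / 2 \<le> 0"
    proof -
      have "e b * (norm (cont_rep a b (mat_mult \<H> u) b))\<^sup>2 - e a * (norm (cont_rep a b (mat_mult \<H> u) a))\<^sup>2
          \<le> 2 * c * (norm (cont_rep a b (mat_mult \<H> u) \<eta>))\<^sup>2"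
        using e(6)[of "\<lambda>x. (norm (cont_rep a b (mat_mult \<H> u) x))\<^sup>2"] by simp
      moreover have "x + d / 2 \<le> 0" if "x \<le> - c * y" "d \<le> 2 * c * y" for x y d :: real
        using that by simp
      ultimately show ?thesis using damping[OF u] by blast
    qed
  qed
  obtain \<mu> where \<mu>: "\<mu> > 0"
    "\<And>f. f \<in> ?V \<Longrightarrow> \<exists>u\<in>?D. seminorm_of (inner_H a b \<H>) (\<mu> *\<^sub>R u - ?A u - f) = 0"
    using assms(12) unfolding m_dissipative_def by blast
  have DV: "?D \<subseteq> ?V" by (rule pH_dom_subset)
  have AV: "?A u \<in> ?V" if "u \<in> ?D" for u by (rule pH_op_L2[OF that])
  interpret L: complete_semi_inner_space ?V ipL by (rule complete_ipL)
  have "\<exists>S. generates ?V ipL ?D ?A S \<and> (\<forall>t\<ge>0. \<forall>u\<in>?V. seminorm_of ipL (S t u) \<le> exp (- \<delta> * t) * seminorm_of ipL u)"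
  proof (rule L.generation[OF subspace_pH_dom DV AV _ _ _ _ \<delta> \<mu>(1) diss])
    fix u v assume uv: "u \<in> ?D" "v \<in> ?D"
    have "?A (u + v) - (?A u + ?A v) \<in> ?V"
      using uv AV subspace_add[OF subspace_pH_dom uv] by auto
    then show "seminorm_of ipL (?A (u + v) - (?A u + ?A v)) = 0"
      using pH_linear(2)[OF uv, of P1 P0 1] by (subst seminorm_ipL_eq_0_iff) (auto elim!: eventually_mono)
  next
    fix r u assume u: "u \<in> ?D"
    have "?A (r *\<^sub>R u) - r *\<^sub>R ?A u \<in> ?V"
      using u AV subspace_scale[OF subspace_pH_dom u] by auto
    then show "seminorm_of ipL (?A (r *\<^sub>R u) - r *\<^sub>R ?A u) = 0"
      using pH_linear(2)[OF zero_mem_pH_dom u, of P1 P0 r] pH_op_0[of P1 P0]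
      by (subst seminorm_ipL_eq_0_iff) (auto simp: scaleR_fun_def elim: eventually_elim2)
  next
    fix u v assume u: "u \<in> ?D" and v: "v \<in> ?V" and "seminorm_of ipL (u - v) = 0"
    then have "AE x in leb a b. u x = v x"
      using DV by (subst (asm) seminorm_ipL_eq_0_iff) (auto elim!: eventually_mono)
    then show "v \<in> ?D" using pH_dom_cong(1)[of u v] u v DV by blast
  next
    fix u assume u: "u \<in> ?D" "seminorm_of ipL u = 0"
    then have "AE x in leb a b. u x = 0 x" using seminorm_ipL_eq_0_iff[of u] DV by auto
    then have "AE x in leb a b. ?A u x = ?A 0 x"
      using u DV by (intro pH_dom_cong(2)) auto
    with pH_op_0[of P1 P0] have "AE x in leb a b. ?A u x = 0" by (auto elim: eventually_elim2)
    then show "seminorm_of ipL (?A u) = 0" using seminorm_ipL_eq_0_iff[OF AV[OF u(1)]] by simp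
  next
    fix f assume f: "f \<in> ?V"
    obtain u where u: "u \<in> ?D" "seminorm_of (inner_H a b \<H>) (\<mu> *\<^sub>R u - ?A u - f) = 0" using \<mu>(2)[OF f] by blast
    have mem: "\<mu> *\<^sub>R u - ?A u - f \<in> ?V" using u(1) DV AV f by auto
    have "seminorm_of ipL (\<mu> *\<^sub>R u - ?A u - f) = 0"
      using seminorm_ipL_equivalent_H(1)[OF mem] L.N_nonneg[OF mem] u(2) by simp
    then show "\<exists>u\<in>?D. seminorm_of ipL (\<mu> *\<^sub>R u - ?A u - f) = 0" using u(1) by blast
  qed
  then obtain S where S: "generates ?V ipL ?D ?A S"
    and decay: "\<And>t u. \<lbrakk>0 \<le> t; u \<in> ?V\<rbrakk> \<Longrightarrow> seminorm_of ipL (S t u) \<le> exp (- \<delta> * t) * seminorm_of ipL u"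
    by blast
  have H_nonneg: "0 \<le> seminorm_of (inner_H a b \<H>) u" if "u \<in> ?V" for u
    using order_trans[OF L.N_nonneg[OF that] seminorm_ipL_equivalent_H(1)[OF that]]
    by (simp add: zero_le_mult_iff)
  have "generates ?V (inner_H a b \<H>) ?D ?A S"
    by (rule generates_equivalent_seminorm[OF subspace_L2 L.N_nonneg H_nonneg seminorm_ipL_equivalent_H _ S]) auto
  moreover have "exponentially_stable ?V (inner_H a b \<H>) S"
  proof (rule exponentially_stableI[where C = 2 and \<omega> = \<delta>])
    show "seminorm_of (inner_H a b \<H>) 0 \<le> 1"
      using seminorm_ipL_equivalent_H(2)[of 0] by simp
    fix t :: real and u :: "real \<Rightarrow> real ^ 'n" assume t: "0 \<le> t" and u: "u \<in> ?V"
    have St: "S t u \<in> ?V"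
      using S t u by (auto simp: generates_def C0_semigroup_def bounded_operator_def)
    have "seminorm_of (inner_H a b \<H>) (S t u) \<le> sqrt 2 * seminorm_of ipL (S t u)"
      by (rule seminorm_ipL_equivalent_H(2)[OF St])
    also have "\<dots> \<le> sqrt 2 * (exp (- \<delta> * t) * (sqrt 2 * seminorm_of (inner_H a b \<H>) u))"
      by (intro mult_left_mono order_trans[OF decay[OF t u]] seminorm_ipL_equivalent_H(1)[OF u]) auto
    also have "\<dots> = 2 * exp (- \<delta> * t) * seminorm_of (inner_H a b \<H>) u"
      by (simp add: mult.left_commute[of "sqrt 2"] flip: mult.assoc)
    finally show "seminorm_of (inner_H a b \<H>) (S t u) \<le> 2 * exp (- \<delta> * t) * seminorm_of (inner_H a b \<H>) u" .
  qed (use \<delta> in auto)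
  ultimately show ?thesis by blast
qed

end
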